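(* Let $G$ be a countable discrete infinite amenable group, let $(X_1,G)$ and $(X_2,G)$ be two $G$-systems and let $n\ge2$. Let $G$ act diagonally on $X_1\times X_2$. (1) If $(X_1,G)$ and $(X_2,G)$ both have u.p.e. of order $n$ then so does $(X_1\times X_2,G)$. (2) If $(X_1,G)$ and $(X_2,G)$ both have topological $K$ then so does $(X_1\times X_2,G)$. (3) If $(X_1,G)$ and $(X_2,G)$ both have c.p.e. then so does $(X_1\times X_2,G)$.
   Context: Let $F(G)$ be the set of non-empty finite subsets of $G$. A sequence $\{F_n\}_{n\in\mathbb{N}}\subseteq F(G)$ is a Følner sequence if for all $K\in F(G)$ and $\delta>0$ one has $|K^{-1}F_n\cap K^{-1}(G\setminus F_n)|<\delta|F_n|$ for all large $n$. A $G$-system $(X,G)$ is a compact metric space $X$ with a continuous action $G\times X\to X$. A factor of $(X,G)$ is a $G$-system $(Y,G)$ with a continuous surjective $G$-equivariant map $X\to Y$; it is non-trivial if $Y$ is not a single point. For a finite cover $\mathcal{U}$ of $X$ and $F\in F(G)$, $\mathcal{U}_F=\bigvee_{g\in F}g^{-1}\mathcal{U}$ (the family of intersections); $N(\mathcal{U})$ is the minimal cardinality of a subfamily of $\mathcal{U}$ covering $X$; $h_{\text{top}}(G,\mathcal{U})=\lim_{m\to+\infty}\frac{1}{|F_m|}\log N(\mathcal{U}_{F_m})$, the limit existing and being independent of the Følner sequence. The topological entropy of $(X,G)$ is $\sup h_{\text{top}}(G,\mathcal{U})$ over finite open covers $\mathcal{U}$. $(X,G)$ has u.p.e. of order $n$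 if every cover $\mathcal{U}$ of $X$ by $n$ non-dense open sets has $h_{\text{top}}(G,\mathcal{U})>0$. $(X,G)$ has topological $K$ (u.p.e. of all orders) if every cover of $X$ by finitely many non-dense open sets has positive topological entropy, equivalently it has u.p.e. of order $m$ for every $m\ge2$. $(X,G)$ has c.p.e. if every non-trivial factor of $(X,G)$ has positive topological entropy. *)

theory Defs
  imports "HOL-Analysis.Analysis" "HOL-Algebra.Group_Action"
begin

definition folner_sequence :: "('g, 'm) monoid_scheme \<Rightarrow> (nat \<Rightarrow> 'g set) \<Rightarrow> bool" where
  "folner_sequence G F \<longleftrightarrow>
     (\<forall>n. F n \<subseteq> carrier G \<and> finite (F n) \<and> F n \<noteq> {}) \<and>
     (\<forall>K \<delta>. K \<subseteq> carrier G \<and> finite K \<and> K \<noteq> {} \<and> (0::real) < \<delta> \<longrightarrow>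
        (\<forall>\<^sub>F n in sequentially.
           real (card ((set_inv\<^bsub>G\<^esub> K <#>\<^bsub>G\<^esub> F n) \<inter> (set_inv\<^bsub>G\<^esub> K <#>\<^bsub>G\<^esub> (carrier G - F n))))
             < \<delta> * real (card (F n))))"

text \<open>Amenability of a countable discrete group is taken in the sense of Folner.\<close>

definition amenable :: "('g, 'm) monoid_scheme \<Rightarrow> bool" where
  "amenable G \<longleftrightarrow> (\<exists>F. folner_sequence G F)"

text \<open>A compact metric space enters only through its topology.  The library predicate
  \<^const>\<open>group_action\<close> asks every map \<open>\<phi> g\<close> to be extensional, i.e. to take the dummy value
  \<^const>\<open>undefined\<close> outside \<open>topspace X\<close>.  The group carries the discrete topology.\<close>

definition G_system ::
  "('g, 'm) monoid_scheme \<Rightarrow> 'a topology \<Rightarrow> ('g \<Rightarrow> 'a \<Rightarrow> 'a) \<Rightarrow> bool" where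
  "G_system G X \<phi> \<longleftrightarrow>
     compact_space X \<and> metrizable_space X \<and> group_action G (topspace X) \<phi> \<and>
     continuous_map (prod_topology (discrete_topology (carrier G)) X) X (\<lambda>(g, x). \<phi> g x)"

text \<open>The restriction makes the diagonal action extensional on the product.\<close>

definition diagonal_action ::
  "'a topology \<Rightarrow> ('g \<Rightarrow> 'a \<Rightarrow> 'a) \<Rightarrow> 'b topology \<Rightarrow> ('g \<Rightarrow> 'b \<Rightarrow> 'b) \<Rightarrow> 'g \<Rightarrow> 'a \<times> 'b \<Rightarrow> 'a \<times> 'b" where
  "diagonal_action X \<phi> Y \<psi> g =
     restrict (\<lambda>(x, y). (\<phi> g x, \<psi> g y)) (topspace (prod_topology X Y))"

definition is_factor ::
  "('g, 'm) monoid_scheme \<Rightarrow> 'a topology \<Rightarrow> ('g \<Rightarrow> 'a \<Rightarrow> 'a)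
     \<Rightarrow> 'c topology \<Rightarrow> ('g \<Rightarrow> 'c \<Rightarrow> 'c) \<Rightarrow> bool" where
  "is_factor G X \<phi> Y \<psi> \<longleftrightarrow>
     G_system G Y \<psi> \<and>
     (\<exists>\<pi>. continuous_map X Y \<pi> \<and> \<pi> ` topspace X = topspace Y \<and>
          (\<forall>g \<in> carrier G. \<forall>x \<in> topspace X. \<pi> (\<phi> g x) = \<psi> g (\<pi> x)))"

definition nontrivial_space :: "'a topology \<Rightarrow> bool" where
  "nontrivial_space Y \<longleftrightarrow> \<not> (\<exists>y. topspace Y = {y})"

text \<open>The join of the covers \<open>g\<inverse>\<U>\<close>, \<open>g \<in> F\<close>: the function \<open>c\<close> selects one member of
  \<open>\<U>\<close> for every \<open>g\<close>.\<close>

definition cover_join ::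
  "'a set \<Rightarrow> ('g \<Rightarrow> 'a \<Rightarrow> 'a) \<Rightarrow> 'a set set \<Rightarrow> 'g set \<Rightarrow> 'a set set" where
  "cover_join S \<phi> \<U> F = {{x \<in> S. \<forall>g \<in> F. \<phi> g x \<in> c g} | c. c \<in> F \<rightarrow> \<U>}"

definition covering_number :: "'a set \<Rightarrow> 'a set set \<Rightarrow> nat" where
  "covering_number S \<U> = (LEAST k. \<exists>\<V> \<subseteq> \<U>. finite \<V> \<and> S \<subseteq> \<Union>\<V> \<and> card \<V> = k)"

text \<open>The common limit along all Folner sequences.\<close>

definition cover_entropy ::
  "('g, 'm) monoid_scheme \<Rightarrow> 'a topology \<Rightarrow> ('g \<Rightarrow> 'a \<Rightarrow> 'a) \<Rightarrow> 'a set set \<Rightarrow> real" where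
  "cover_entropy G X \<phi> \<U> =
     (THE h. \<forall>F. folner_sequence G F \<longrightarrow>
        (\<lambda>m. ln (real (covering_number (topspace X) (cover_join (topspace X) \<phi> \<U> (F m))))
               / real (card (F m))) \<longlonglongrightarrow> h)"

definition finite_open_cover :: "'a topology \<Rightarrow> 'a set set \<Rightarrow> bool" where
  "finite_open_cover X \<U> \<longleftrightarrow> finite \<U> \<and> (\<forall>U \<in> \<U>. openin X U) \<and> \<Union>\<U> = topspace X"

definition topological_entropy ::
  "('g, 'm) monoid_scheme \<Rightarrow> 'a topology \<Rightarrow> ('g \<Rightarrow> 'a \<Rightarrow> 'a) \<Rightarrow> ereal" where
  "topological_entropy G X \<phi> = (SUP \<U> \<in> {\<U>. finite_open_cover X \<U>}. ereal (cover_entropy G X \<phi> \<U>))"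

text \<open>A cover by \<open>n\<close> sets is an \<open>n\<close>-tuple of sets; repetitions are allowed.  (For \<open>n\<close> distinct
  sets, finite spaces with few open sets would satisfy the property vacuously.)\<close>

definition has_upe ::
  "nat \<Rightarrow> ('g, 'm) monoid_scheme \<Rightarrow> 'a topology \<Rightarrow> ('g \<Rightarrow> 'a \<Rightarrow> 'a) \<Rightarrow> bool" where
  "has_upe n G X \<phi> \<longleftrightarrow>
     (\<forall>U. (\<forall>i<n. openin X (U i) \<and> Abstract_Topology.closure_of X (U i) \<noteq> topspace X) \<and> (\<Union>i\<in>{..<n}. U i) = topspace X
        \<longrightarrow> 0 < cover_entropy G X \<phi> (U ` {..<n}))"

definition has_topological_K ::
  "('g, 'm) monoid_scheme \<Rightarrow> 'a topology \<Rightarrow> ('g \<Rightarrow> 'a \<Rightarrow> 'a) \<Rightarrow> bool" where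
  "has_topological_K G X \<phi> \<longleftrightarrow>
     (\<forall>\<U>. finite_open_cover X \<U> \<and> (\<forall>U \<in> \<U>. Abstract_Topology.closure_of X U \<noteq> topspace X)
        \<longrightarrow> 0 < cover_entropy G X \<phi> \<U>)"

text \<open>A definition cannot quantify over types, so \<open>Y\<close> ranges over the factors whose points lie in
  the point type of \<open>X\<close>.  Every factor is conjugate to one of these, through a section of the
  factor map; the lemma \<open>has_cpe_factor\<close> below extends the property to factors over any type.\<close>

definition has_cpe ::
  "('g, 'm) monoid_scheme \<Rightarrow> 'a topology \<Rightarrow> ('g \<Rightarrow> 'a \<Rightarrow> 'a) \<Rightarrow> bool" where
  "has_cpe G X \<phi> \<longleftrightarrow>
     (\<forall>(Y :: 'a topology) \<psi>. is_factor G X \<phi> Y \<psi> \<and> nontrivial_space Y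
        \<longrightarrow> 0 < topological_entropy G Y \<psi>)"

lemma covering_number_bij:
  assumes p: "bij_betw p A B" and U: "\<And>U. U \<in> \<U> \<Longrightarrow> U \<subseteq> A"
  shows "covering_number B ((`) p ` \<U>) = covering_number A \<U>"
proof -
  have inj: "inj_on ((`) p) \<U>"
    using p U unfolding bij_betw_def inj_on_def
    by (metis inj_on_def inj_on_image_eq_iff)
  have BA: "B = p ` A" and pinj: "inj_on p A" using p by (auto simp: bij_betw_def)
  have "(\<exists>\<V> \<subseteq> (`) p ` \<U>. finite \<V> \<and> B \<subseteq> \<Union>\<V> \<and> card \<V> = k) \<longleftrightarrow>
        (\<exists>\<V> \<subseteq> \<U>. finite \<V> \<and> A \<subseteq> \<Union>\<V> \<and> card \<V> = k)" (is "?L \<longleftrightarrow> ?R") for k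
  proof -
    have *: "B \<subseteq> \<Union>((`) p ` \<W>) \<longleftrightarrow> A \<subseteq> \<Union>\<W>" if "\<W> \<subseteq> \<U>" for \<W>
    proof -
      have "\<Union>\<W> \<subseteq> A" using that U by blast
      then have "p ` A \<subseteq> p ` \<Union>\<W> \<longleftrightarrow> A \<subseteq> \<Union>\<W>"
        using inj_on_image_subset_iff[OF pinj] by blast
      then show ?thesis by (simp add: BA image_Union)
    qed
    have c: "card ((`) p ` \<W>) = card \<W>" "finite ((`) p ` \<W>) \<longleftrightarrow> finite \<W>" if "\<W> \<subseteq> \<U>" for \<W>
      using inj_on_subset[OF inj that] by (auto simp: card_image finite_image_iff)
    show ?thesis
    proof
      assume ?L
      then obtain \<W> where "\<W> \<subseteq> \<U>" "finite ((`) p ` \<W>)" "B \<subseteq> \<Union>((`) p ` \<W>)" "card ((`) p ` \<W>) = k"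
        unfolding subset_image_iff by (elim exE conjE) simp
      then have "finite \<W> \<and> A \<subseteq> \<Union>\<W> \<and> card \<W> = k" using *[of \<W>] c[of \<W>] by simp
      then show ?R using \<open>\<W> \<subseteq> \<U>\<close> by (intro exI[of _ \<W>] conjI) simp_all
    next
      assume ?R
      then obtain \<W> where W: "\<W> \<subseteq> \<U>" "finite \<W>" "A \<subseteq> \<Union>\<W>" "card \<W> = k" by blast
      then show ?L
        by (intro exI[of _ "(`) p ` \<W>"] conjI) (simp_all only: image_mono * c)
    qed
  qed
  then show ?thesis unfolding covering_number_def by simp
qed

lemma cover_join_bij:
  assumes p: "bij_betw p A B" and U: "\<And>U. U \<in> \<U> \<Longrightarrow> U \<subseteq> A"
    and eq: "\<And>g x. g \<in> F \<Longrightarrow> x \<in> A \<Longrightarrow> p (\<phi> g x) = \<psi> g (p x)"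
    and cl: "\<And>g x. g \<in> F \<Longrightarrow> x \<in> A \<Longrightarrow> \<phi> g x \<in> A"
  shows "cover_join B \<psi> ((`) p ` \<U>) F = (`) p ` cover_join A \<phi> \<U> F"
proof -
  have pinj: "inj_on p A" and B: "B = p ` A" using p by (auto simp: bij_betw_def)
  have *: "{y \<in> B. \<forall>g \<in> F. \<psi> g y \<in> d g} = p ` {x \<in> A. \<forall>g \<in> F. \<phi> g x \<in> c g}"
    if c: "c \<in> F \<rightarrow> \<U>" and d: "\<And>g. g \<in> F \<Longrightarrow> d g = p ` c g" for c d
  proof -
    have "\<psi> g (p x) \<in> d g \<longleftrightarrow> \<phi> g x \<in> c g" if "g \<in> F" "x \<in> A" for g x
    proof -
      have "c g \<subseteq> A" using c U that by auto
      then show ?thesis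
        using inj_on_image_mem_iff[OF pinj cl[OF that]] d[OF that(1)] eq[OF that] by metis
    qed
    then show ?thesis unfolding B by auto
  qed
  show ?thesis
  proof (intro equalityI subsetI)
    fix S assume "S \<in> cover_join B \<psi> ((`) p ` \<U>) F"
    then obtain d where S: "S = {y \<in> B. \<forall>g \<in> F. \<psi> g y \<in> d g}" and d: "d \<in> F \<rightarrow> (`) p ` \<U>"
      unfolding cover_join_def by blast
    have "\<forall>g\<in>F. \<exists>V. V \<in> \<U> \<and> d g = p ` V" using d by blast
    then obtain c where "\<forall>g\<in>F. c g \<in> \<U> \<and> d g = p ` c g" by metis
    then have c: "c \<in> F \<rightarrow> \<U>" and cd: "\<And>g. g \<in> F \<Longrightarrow> d g = p ` c g" by auto
    have Sp: "S = p ` {x \<in> A. \<forall>g \<in> F. \<phi> g x \<in> c g}"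
      unfolding S by (rule *[OF c cd])
    show "S \<in> (`) p ` cover_join A \<phi> \<U> F"
      unfolding cover_join_def using Sp c by blast
  next
    fix S assume "S \<in> (`) p ` cover_join A \<phi> \<U> F"
    then obtain c where S: "S = p ` {x \<in> A. \<forall>g \<in> F. \<phi> g x \<in> c g}" and c: "c \<in> F \<rightarrow> \<U>"
      unfolding cover_join_def by blast
    have "S = {y \<in> B. \<forall>g \<in> F. \<psi> g y \<in> p ` c g}"
      unfolding S using *[OF c, of "\<lambda>g. p ` c g"] by simp
    moreover have "(\<lambda>g. p ` c g) \<in> F \<rightarrow> (`) p ` \<U>" using c by auto
    ultimately show "S \<in> cover_join B \<psi> ((`) p ` \<U>) F"
      unfolding cover_join_def by (intro CollectI exI[of _ "\<lambda>g. p ` c g"] conjI)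
  qed
qed

lemma cover_entropy_conjugate:
  assumes p: "bij_betw p (topspace X) (topspace Y)"
    and U: "\<And>U. U \<in> \<U> \<Longrightarrow> U \<subseteq> topspace X"
    and eq: "\<And>g x. g \<in> carrier G \<Longrightarrow> x \<in> topspace X \<Longrightarrow> p (\<phi> g x) = \<psi> g (p x)"
    and cl: "\<And>g x. g \<in> carrier G \<Longrightarrow> x \<in> topspace X \<Longrightarrow> \<phi> g x \<in> topspace X"
  shows "cover_entropy G Y \<psi> ((`) p ` \<U>) = cover_entropy G X \<phi> \<U>"
proof -
  have *: "covering_number (topspace Y) (cover_join (topspace Y) \<psi> ((`) p ` \<U>) (F m)) =
        covering_number (topspace X) (cover_join (topspace X) \<phi> \<U> (F m))"
    if "folner_sequence G F" for F m
  proof -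
    have F: "F m \<subseteq> carrier G" using that by (auto simp: folner_sequence_def)
    have "cover_join (topspace Y) \<psi> ((`) p ` \<U>) (F m) = (`) p ` cover_join (topspace X) \<phi> \<U> (F m)"
      by (rule cover_join_bij[OF p U]) (use F eq cl in auto)
    moreover have "V \<subseteq> topspace X" if "V \<in> cover_join (topspace X) \<phi> \<U> (F m)" for V
      using that by (auto simp: cover_join_def)
    ultimately show ?thesis using covering_number_bij[OF p] by metis
  qed
  show ?thesis
    unfolding cover_entropy_def
    by (rule arg_cong[where f=The], rule ext) (use * in auto)
qed

lemma has_cpe_factor:
  fixes X :: "'a topology" and Y :: "'c topology"
  assumes cpe: "has_cpe G X \<phi>" and fac: "is_factor G X \<phi> Y \<psi>" and nt: "nontrivial_space Y"
  shows "0 < topological_entropy G Y \<psi>"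
proof -
  from fac obtain \<pi> where sysY: "G_system G Y \<psi>" and cont: "continuous_map X Y \<pi>"
    and surj: "\<pi> ` topspace X = topspace Y"
    and eqv: "\<And>g x. g \<in> carrier G \<Longrightarrow> x \<in> topspace X \<Longrightarrow> \<pi> (\<phi> g x) = \<psi> g (\<pi> x)"
    unfolding is_factor_def by blast
  interpret Y: group_action G "topspace Y" \<psi> using sysY by (simp add: G_system_def)
  define s where "s = inv_into (topspace X) \<pi>"
  define A where "A = s ` topspace Y"
  have ps: "\<pi> (s y) = y" if "y \<in> topspace Y" for y
    using that surj unfolding s_def by (simp add: f_inv_into_f)
  have sp: "s (\<pi> a) = a" if "a \<in> A" for a
    using that ps unfolding A_def by auto
  have sA: "s y \<in> A" if "y \<in> topspace Y" for y using that by (simp add: A_def)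
  have pA: "\<pi> a \<in> topspace Y" if "a \<in> A" for a using that ps by (auto simp: A_def)
  define Y' where "Y' = pullback_topology A \<pi> Y"
  have opY': "openin Y' S \<longleftrightarrow> (\<exists>U. openin Y U \<and> S = \<pi> -` U \<inter> A)" for S
    by (simp add: Y'_def openin_pullback_topology)
  have topY': "topspace Y' = A"
    using pA by (auto simp: Y'_def topspace_pullback_topology)
  have cp: "continuous_map Y' Y \<pi>"
    unfolding continuous_map_def topY' opY' using pA by fastforce
  have cs: "continuous_map Y Y' s"
    unfolding continuous_map_def topY' opY'
  proof (intro conjI allI impI)
    show "s \<in> topspace Y \<rightarrow> A" using sA by auto
    fix S assume "\<exists>U. openin Y U \<and> S = \<pi> -` U \<inter> A"
    then obtain U where U: "openin Y U" "S = \<pi> -` U \<inter> A" by blast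
    have "{x \<in> topspace Y. s x \<in> S} = U"
      using U ps sA openin_subset[OF U(1)] by auto
    then show "openin Y {x \<in> topspace Y. s x \<in> S}" using U by simp
  qed
  have hm: "homeomorphic_maps Y' Y \<pi> s"
    unfolding homeomorphic_maps_def using cp cs sp ps topY' by auto
  then have hom: "Y' homeomorphic_space Y" by (auto simp: homeomorphic_space_def)
  have bij: "bij_betw \<pi> (topspace Y') (topspace Y)"
    unfolding topY' by (rule bij_betw_byWitness[where f'=s]) (use sp ps sA pA in auto)
  define \<psi>' where "\<psi>' = (\<lambda>g. restrict (\<lambda>a. s (\<psi> g (\<pi> a))) A)"
  have \<psi>Y: "\<psi> g y \<in> topspace Y" if "g \<in> carrier G" "y \<in> topspace Y" for g y
    using Y.element_image[OF that] by simp
  have \<psi>'A: "\<psi>' g a \<in> A" if "g \<in> carrier G" "a \<in> A" for g a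
    using that by (simp add: \<psi>'_def sA pA \<psi>Y)
  have eq': "\<pi> (\<psi>' g a) = \<psi> g (\<pi> a)" if "g \<in> carrier G" "a \<in> A" for g a
    using that by (simp add: \<psi>'_def ps pA \<psi>Y)
  have Ggrp: "group G" using Y.group_hom by (simp add: group_hom_def)
  then interpret G: group G .
  have mult: "\<psi>' (g \<otimes>\<^bsub>G\<^esub> h) a = \<psi>' g (\<psi>' h a)" if "g \<in> carrier G" "h \<in> carrier G" "a \<in> A" for g h a
  proof -
    have "\<psi> (g \<otimes>\<^bsub>G\<^esub> h) (\<pi> a) = \<psi> g (\<psi> h (\<pi> a))"
      using Y.composition_rule[OF pA] that by simp
    then show ?thesis
      using that \<psi>'A eq' by (simp add: \<psi>'_def ps pA \<psi>Y sA)
  qed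
  have one: "\<psi>' \<one>\<^bsub>G\<^esub> a = a" if "a \<in> A" for a
    using that Y.id_eq_one pA[OF that] sp by (metis \<psi>'_def restrict_apply')
  have bijA: "\<psi>' g \<in> carrier (BijGroup A)" if g: "g \<in> carrier G" for g
  proof -
    have "bij_betw (\<psi>' g) A A"
    proof (rule bij_betw_byWitness[where f'="\<psi>' (inv\<^bsub>G\<^esub> g)"])
      show "\<forall>a\<in>A. \<psi>' (inv\<^bsub>G\<^esub> g) (\<psi>' g a) = a" "\<forall>a\<in>A. \<psi>' g (\<psi>' (inv\<^bsub>G\<^esub> g) a) = a"
        using mult[of "inv\<^bsub>G\<^esub> g" g] mult[of g "inv\<^bsub>G\<^esub> g"] one g by auto
    qed (use \<psi>'A g in auto)
    then show ?thesis by (simp add: BijGroup_def Bij_def \<psi>'_def)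
  qed
  have act: "group_action G A \<psi>'"
    unfolding group_action_def group_hom_def group_hom_axioms_def
  proof (intro conjI Ggrp group_BijGroup homI bijA)
    fix g h assume gh: "g \<in> carrier G" "h \<in> carrier G"
    have "\<psi>' (g \<otimes>\<^bsub>G\<^esub> h) = compose A (\<psi>' g) (\<psi>' h)"
    proof (rule extensionalityI[where A=A])
      show "\<psi>' (g \<otimes>\<^bsub>G\<^esub> h) \<in> extensional A" by (simp add: \<psi>'_def)
    qed (use mult[OF gh] in \<open>auto simp: compose_def\<close>)
    then show "\<psi>' (g \<otimes>\<^bsub>G\<^esub> h) = \<psi>' g \<otimes>\<^bsub>BijGroup A\<^esub> \<psi>' h"
      using bijA gh by (simp add: BijGroup_def)
  qed
  let ?D = "discrete_topology (carrier G)"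
  have c\<psi>: "continuous_map (prod_topology ?D Y) Y (\<lambda>(g, x). \<psi> g x)"
    using sysY by (simp add: G_system_def)
  have "continuous_map (prod_topology ?D Y') (prod_topology ?D Y) (\<lambda>(g, a). (g, \<pi> a))"
    by (simp add: continuous_map_prod_top cp)
  then have "continuous_map (prod_topology ?D Y') Y' (s \<circ> ((\<lambda>(g, x). \<psi> g x) \<circ> (\<lambda>(g, a). (g, \<pi> a))))"
    by (rule continuous_map_compose[OF continuous_map_compose[OF _ c\<psi>] cs])
  then have cact: "continuous_map (prod_topology ?D Y') Y' (\<lambda>(g, a). \<psi>' g a)"
    by (rule continuous_map_eq) (auto simp: topY' \<psi>'_def)
  have "compact_space Y'" "metrizable_space Y'"
    using sysY hom homeomorphic_compact_space homeomorphic_metrizable_space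
    unfolding G_system_def by blast+
  then have sysY': "G_system G Y' \<psi>'"
    using act cact by (simp add: G_system_def topY')
  have "is_factor G X \<phi> Y' \<psi>'"
    unfolding is_factor_def
  proof (intro conjI sysY' exI[of _ "s \<circ> \<pi>"] ballI)
    show "continuous_map X Y' (s \<circ> \<pi>)" using cont cs continuous_map_compose by blast
    show "(s \<circ> \<pi>) ` topspace X = topspace Y'"
      unfolding topY' A_def using surj by (metis image_comp)
    fix g x assume gx: "g \<in> carrier G" "x \<in> topspace X"
    then have "\<pi> x \<in> topspace Y" using surj by auto
    then show "(s \<circ> \<pi>) (\<phi> g x) = \<psi>' g ((s \<circ> \<pi>) x)"
      using eqv[OF gx] by (simp add: \<psi>'_def sA ps)
  qed
  moreover have "nontrivial_space Y'"
  proof -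
    have "topspace Y = \<pi> ` A" using bij topY' by (auto simp: bij_betw_def)
    then have "topspace Y = {\<pi> y}" if "topspace Y' = {y}" for y using that topY' by simp
    then show ?thesis using nt unfolding nontrivial_space_def by blast
  qed
  ultimately have "0 < topological_entropy G Y' \<psi>'"
    using cpe unfolding has_cpe_def by blast
  then obtain \<U> where \<U>: "finite_open_cover Y' \<U>" and pos: "0 < ereal (cover_entropy G Y' \<psi>' \<U>)"
    unfolding topological_entropy_def less_SUP_iff by blast
  have "cover_entropy G Y \<psi> ((`) \<pi> ` \<U>) = cover_entropy G Y' \<psi>' \<U>"
  proof (rule cover_entropy_conjugate[OF bij])
    show "U \<subseteq> topspace Y'" if "U \<in> \<U>" for U
      using \<U> that by (auto simp: finite_open_cover_def)
  qed (use eq' \<psi>'A topY' in auto)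
  moreover have "finite_open_cover Y ((`) \<pi> ` \<U>)"
  proof -
    have "openin Y (\<pi> ` U)" if "openin Y' U" for U
      using hm that homeomorphic_imp_open_map homeomorphic_map_maps open_map_def by metis
    moreover have "\<Union>((`) \<pi> ` \<U>) = topspace Y"
      using \<U> bij unfolding finite_open_cover_def bij_betw_def by (metis image_Union)
    ultimately show ?thesis using \<U> by (auto simp: finite_open_cover_def)
  qed
  ultimately show ?thesis
    using pos unfolding topological_entropy_def less_SUP_iff by force
qed

end

theory Submission
  imports Defs
begin

text \<open>
A tuple of sets \<open>V i\<close> has positive independence density if for some \<open>q > 0\<close> every finite set \<open>E\<close> of group
elements contains a set \<open>J\<close> with at least \<open>q |E|\<close> elements such that every pattern
\<open>\<omega> : J \<rightarrow> I\<close> is realised: some point \<open>x\<close> has \<open>g x \<in> V (\<omega> g)\<close> for all \<open>g \<in> J\<close>. This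
combinatorial notion is equivalent to positive entropy, and it passes to products for a trivial reason: given
\<open>E\<close>, take \<open>J \<subseteq> E\<close> for the first system and then \<open>L \<subseteq> J\<close> for the second one; on \<open>L\<close>
the two patterns are realised independently of each other. The three parts of the theorem are translations of this remark.

The equivalence has two directions. If \<open>J\<close> is independent for sets \<open>V i\<close> with \<open>U i \<inter> V i = {}\<close>, then
one member of the cover generated by the \<open>U i\<close> realises at most \<open>(k - 1) ^ |J|\<close> of the \<open>k ^ |J|\<close> patterns,
so the covering numbers grow exponentially (\<open>positive_entropy_if_positive_density\<close>). Conversely, if the \<open>V i\<close>
are pairwise disjoint and the cover by their complements has positive entropy, then a Sauer-Shelah type argument
(\<open>card_shattered_ge\<close>, \<open>large_shattered_set\<close>) finds independent sets of positive proportion inside Folner sets,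
and averaging over translates carries them into every finite set (\<open>positive_density_if_positive_entropy\<close>).
The entropy of a cover is a definite description of a limit, so the existence of that limit along all
Folner sequences has to be known first; this is the Ornstein-Weiss lemma (\<open>ornstein_weiss\<close>).

For u.p.e. of order \<open>n\<close>, the hypothesis on each of the two systems gives that all \<open>n\<close>-tuples of non-empty open sets have positive
density (\<open>positive_density_if_upe\<close>). The complements of the closures of \<open>n\<close> non-dense open sets of the product
contain boxes, and the boxes have positive density. Topological \<open>K\<close> is u.p.e. of all orders on a non-empty space.

For c.p.e., call two points an independence pair if all their neighbourhoods have positive density. A factor
that is not a point has positive entropy, and a cover of positive entropy is separated by some independence pair
(\<open>separating_independence_pair\<close>). Applied to the factor \<open>x \<mapsto> (u (g x))\<close>, \<open>g \<in> G\<close>, of \<open>X\<close>, this shows that a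
continuous function \<open>u\<close> that identifies the points of every independence pair of a c.p.e. system is constant
(\<open>cpe_constant\<close>). With a Urysohn function for \<open>u\<close> it follows that every point forms an independence pair with itself.
Finally let \<open>\<pi>\<close> be a factor map of \<open>X \<times> Y\<close> onto a system of entropy zero. It identifies the independence
pairs of the product, in particular \<open>(x, y)\<close> and \<open>(x', y)\<close> whenever \<open>x, x'\<close> is an independence pair of \<open>X\<close>, because
\<open>y\<close> forms such a pair with itself.
Hence \<open>\<pi>\<close> is constant in the first variable, by symmetry in the second one, and the factor is a point.
\<close>

section \<open>Folner sets and the Ornstein-Weiss limit\<close>

text \<open>For subsets of the group this is the set \<open>K\<inverse> D \<inter> K\<inverse> (G - D)\<close> of the Folner condition, written in
terms of the right translates \<open>K c\<close> that cross the border of \<open>D\<close>.\<close>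

definition folner_boundary :: "('g, 'm) monoid_scheme \<Rightarrow> 'g set \<Rightarrow> 'g set \<Rightarrow> 'g set" where
  "folner_boundary G K D =
     {c \<in> carrier G. (\<exists>k\<in>K. k \<otimes>\<^bsub>G\<^esub> c \<in> D) \<and> (\<exists>k\<in>K. k \<otimes>\<^bsub>G\<^esub> c \<notin> D)}"

definition almost_invariant :: "('g, 'm) monoid_scheme \<Rightarrow> 'g set \<Rightarrow> real \<Rightarrow> 'g set \<Rightarrow> bool" where
  "almost_invariant G K \<delta> D \<longleftrightarrow> D \<subseteq> carrier G \<and> finite D \<and> D \<noteq> {} \<and>
     real (card (folner_boundary G K D)) < \<delta> * real (card D)"

context group
begin

lemma folner_boundary_eq:
  assumes "K \<subseteq> carrier G" "D \<subseteq> carrier G"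
  shows "folner_boundary G K D = (set_inv K <#> D) \<inter> (set_inv K <#> (carrier G - D))"
proof -
  have *: "c \<in> set_inv K <#> E \<longleftrightarrow> c \<in> carrier G \<and> (\<exists>k\<in>K. k \<otimes> c \<in> E)" if E: "E \<subseteq> carrier G" for c E
  proof
    assume "c \<in> set_inv K <#> E"
    then obtain k e where ke: "k \<in> K" "e \<in> E" "c = inv k \<otimes> e"
      by (auto simp: set_mult_def SET_INV_def)
    then have "k \<otimes> c = e" using assms E
      by (metis inv_closed inv_solve_left inv_inv m_closed subsetD)
    moreover have "c \<in> carrier G" using ke assms E by auto
    ultimately show "c \<in> carrier G \<and> (\<exists>k\<in>K. k \<otimes> c \<in> E)" using ke by blast
  next
    assume "c \<in> carrier G \<and> (\<exists>k\<in>K. k \<otimes> c \<in> E)"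
    then obtain k where k: "c \<in> carrier G" "k \<in> K" "k \<otimes> c \<in> E" by blast
    then have "c = inv k \<otimes> (k \<otimes> c)" using assms
      by (metis inv_solve_left m_closed subsetD)
    then show "c \<in> set_inv K <#> E" using k by (auto simp: set_mult_def SET_INV_def)
  qed
  have "k \<otimes> c \<in> carrier G" if "c \<in> carrier G" "k \<in> K" for k c using that assms by auto
  then show ?thesis
    using assms unfolding folner_boundary_def by (auto simp: *)
qed

lemma folner_sequence_alt:
  "folner_sequence G F \<longleftrightarrow>
     (\<forall>n. F n \<subseteq> carrier G \<and> finite (F n) \<and> F n \<noteq> {}) \<and>
     (\<forall>K \<delta>. K \<subseteq> carrier G \<and> finite K \<and> K \<noteq> {} \<and> 0 < \<delta> \<longrightarrow>
        (\<forall>\<^sub>F n in sequentially. almost_invariant G K \<delta> (F n)))"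
proof (cases "\<forall>n. F n \<subseteq> carrier G \<and> finite (F n) \<and> F n \<noteq> {}")
  case True
  then have "real (card ((set_inv K <#> F n) \<inter> (set_inv K <#> (carrier G - F n)))) < \<delta> * real (card (F n))
      \<longleftrightarrow> almost_invariant G K \<delta> (F n)" if "K \<subseteq> carrier G" for K \<delta> n
    using that by (simp add: almost_invariant_def folner_boundary_eq)
  then show ?thesis
    unfolding folner_sequence_def by (simp cong: conj_cong imp_cong)
qed (auto simp: folner_sequence_def)

lemma folner_boundary_subset:
  "folner_boundary G K D \<subseteq> (\<lambda>(k, d). inv k \<otimes> d) ` (K \<times> D)" if "K \<subseteq> carrier G"
proof
  fix c assume "c \<in> folner_boundary G K D"
  then obtain k where k: "c \<in> carrier G" "k \<in> K" "k \<otimes> c \<in> D"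
    by (auto simp: folner_boundary_def)
  then have "c = inv k \<otimes> (k \<otimes> c)" using that
    by (metis inv_solve_left m_closed subsetD)
  then show "c \<in> (\<lambda>(k, d). inv k \<otimes> d) ` (K \<times> D)" using k by force
qed

lemma finite_folner_boundary:
  assumes "K \<subseteq> carrier G" "finite K" "finite D"
  shows "finite (folner_boundary G K D)"
  by (rule finite_subset[OF folner_boundary_subset]) (use assms in auto)

lemma almost_invariant_mono:
  assumes "almost_invariant G K \<delta> D" "K' \<subseteq> K" "K \<subseteq> carrier G" "finite K" "\<delta> \<le> \<delta>'"
  shows "almost_invariant G K' \<delta>' D"
proof -
  have D: "finite D" using assms by (simp add: almost_invariant_def)
  have "folner_boundary G K' D \<subseteq> folner_boundary G K D"
    using assms by (auto simp: folner_boundary_def)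
  then have "card (folner_boundary G K' D) \<le> card (folner_boundary G K D)"
    using finite_folner_boundary[OF assms(3,4) D] card_mono by blast
  moreover have "\<delta> * real (card D) \<le> \<delta>' * real (card D)"
    using assms by (simp add: mult_right_mono)
  ultimately show ?thesis using assms unfolding almost_invariant_def by simp
qed

lemma almost_invariant_exists:
  assumes "amenable G" "K \<subseteq> carrier G" "finite K" "K \<noteq> {}" "0 < \<delta>"
  shows "\<exists>D. almost_invariant G K \<delta> D"
proof -
  obtain F where "folner_sequence G F" using assms by (auto simp: amenable_def)
  then have "\<forall>\<^sub>F n in sequentially. almost_invariant G K \<delta> (F n)"
    using assms unfolding folner_sequence_alt by blast
  then show ?thesis by (auto simp: eventually_sequentially)
qed

lemma folner_boundary_Diff:
  "folner_boundary G K (D - E) \<subseteq> folner_boundary G K D \<union> folner_boundary G K E"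
  by (auto simp: folner_boundary_def)

text \<open>A translate of \<open>K'\<close> that crosses the border of \<open>K C\<close> meets some tile \<open>K c\<close> without being contained in it,
so the boundary of a union of tiles consists of translated boundary points of the single tile.\<close>

lemma folner_boundary_set_mult:
  assumes "K' \<subseteq> carrier G" "K \<subseteq> carrier G" "C \<subseteq> carrier G"
  shows "folner_boundary G K' (K <#> C) \<subseteq> (\<lambda>(b, c). b \<otimes> c) ` (folner_boundary G K' K \<times> C)"
proof
  fix x assume x: "x \<in> folner_boundary G K' (K <#> C)"
  then obtain k k2 where k: "x \<in> carrier G" "k \<in> K'" "k \<otimes> x \<in> K <#> C" "k2 \<in> K'" "k2 \<otimes> x \<notin> K <#> C"
    by (auto simp: folner_boundary_def)
  then obtain d c where dc: "d \<in> K" "c \<in> C" "k \<otimes> x = d \<otimes> c" by (auto simp: set_mult_def)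
  have cl: "k \<in> carrier G" "k2 \<in> carrier G" "d \<in> carrier G" "c \<in> carrier G" using k dc assms by auto
  have "k \<otimes> (x \<otimes> inv c) = d" using cl k dc by (metis inv_closed inv_solve_right m_assoc m_closed)
  moreover have "k2 \<otimes> (x \<otimes> inv c) \<notin> K"
  proof
    assume "k2 \<otimes> (x \<otimes> inv c) \<in> K"
    then have "(k2 \<otimes> (x \<otimes> inv c)) \<otimes> c \<in> K <#> C" using dc by (auto simp: set_mult_def)
    moreover have "(k2 \<otimes> (x \<otimes> inv c)) \<otimes> c = k2 \<otimes> x"
      using cl k by (simp add: m_assoc)
    ultimately show False using k by simp
  qed
  ultimately have "x \<otimes> inv c \<in> folner_boundary G K' K"
    using k dc cl by (auto simp: folner_boundary_def)
  moreover have "x = (x \<otimes> inv c) \<otimes> c" using k cl by (simp add: m_assoc)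
  ultimately show "x \<in> (\<lambda>(b, c). b \<otimes> c) ` (folner_boundary G K' K \<times> C)"
    using dc by force
qed

text \<open>With \<open>k \<in> K\<close> fixed, \<open>c \<mapsto> k c\<close> injects the translates inside \<open>D\<close> into \<open>D\<close>. Conversely
\<open>d \<mapsto> k\<inverse> d\<close> sends every point of \<open>D\<close> to a translate that is inside \<open>D\<close> or crosses its border.\<close>

lemma card_translates_inside:
  assumes K: "K \<subseteq> carrier G" "finite K" "K \<noteq> {}" and D: "D \<subseteq> carrier G" "finite D"
  defines "I \<equiv> {c \<in> carrier G. K #> c \<subseteq> D}"
  shows "finite I" "card I \<le> card D" "card D \<le> card I + card (folner_boundary G K D)"
proof -
  obtain k where k: "k \<in> K" using K by auto
  then have kc: "k \<in> carrier G" using K by auto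
  have inj: "inj_on (\<lambda>c. k \<otimes> c) (carrier G)" using kc by (simp add: inj_on_def)
  have sub: "(\<lambda>c. k \<otimes> c) ` I \<subseteq> D" using k by (auto simp: I_def r_coset_def)
  have IG: "I \<subseteq> carrier G" by (auto simp: I_def)
  show fin: "finite I" using sub D inj IG by (meson finite_imageD finite_subset inj_on_subset)
  show "card I \<le> card D" using sub D inj IG by (meson card_inj_on_le inj_on_subset)
  have inj2: "inj_on (\<lambda>d. inv k \<otimes> d) D"
    using kc D by (intro inj_on_subset[OF _ D(1)]) (simp add: inj_on_def)
  have "(\<lambda>d. inv k \<otimes> d) ` D \<subseteq> I \<union> folner_boundary G K D"
  proof
    fix c assume "c \<in> (\<lambda>d. inv k \<otimes> d) ` D"
    then obtain d where d: "d \<in> D" "c = inv k \<otimes> d" by auto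
    then have c: "c \<in> carrier G" "k \<otimes> c = d" using kc D
      by (auto simp: m_assoc[symmetric] subset_iff)
    show "c \<in> I \<union> folner_boundary G K D"
    proof (cases "K #> c \<subseteq> D")
      case True then show ?thesis using c by (simp add: I_def)
    next
      case False
      then obtain k2 where "k2 \<in> K" "k2 \<otimes> c \<notin> D" by (auto simp: r_coset_def)
      then show ?thesis using c(1) c(2)[symmetric] d(1) k unfolding folner_boundary_def by blast
    qed
  qed
  then have "card D \<le> card (I \<union> folner_boundary G K D)"
    using inj2 fin finite_folner_boundary[OF K(1,2) D(2)] by (meson card_inj_on_le finite_UnI)
  then show "card D \<le> card I + card (folner_boundary G K D)"
    using card_Un_le le_trans by blast
qed

lemma sum_card_translates:
  assumes "finite S" "finite Y"
  shows "(\<Sum>c\<in>S. card ((K #> c) \<inter> Y)) = (\<Sum>y\<in>Y. card {c \<in> S. y \<in> K #> c})"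
proof -
  have "(\<Sum>c\<in>S. card ((K #> c) \<inter> Y)) = (\<Sum>c\<in>S. \<Sum>y\<in>Y. if y \<in> K #> c then 1 else 0)"
    using assms by (intro sum.cong refl) (simp add: sum.If_cases Int_commute)
  also have "\<dots> = (\<Sum>y\<in>Y. \<Sum>c\<in>S. if y \<in> K #> c then 1 else 0)" by (rule sum.swap)
  also have "\<dots> = (\<Sum>y\<in>Y. card {c \<in> S. y \<in> K #> c})"
    using assms by (simp add: sum.If_cases Int_def)
  finally show ?thesis .
qed

lemma card_translates_through_point:
  assumes K: "K \<subseteq> carrier G" and y: "y \<in> carrier G"
  shows "card {c \<in> carrier G. y \<in> K #> c} = card K"
    and "finite K \<Longrightarrow> finite {c \<in> carrier G. y \<in> K #> c}"
proof -
  have eq: "{c \<in> carrier G. y \<in> K #> c} = (\<lambda>k. inv k \<otimes> y) ` K"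
  proof (intro equalityI subsetI)
    fix c assume "c \<in> {c \<in> carrier G. y \<in> K #> c}"
    then obtain k where k: "k \<in> K" "y = k \<otimes> c" "c \<in> carrier G" by (auto simp: r_coset_def)
    then have "k \<in> carrier G" using K by auto
    then have "c = inv k \<otimes> y" using k by (simp add: m_assoc[symmetric])
    then show "c \<in> (\<lambda>k. inv k \<otimes> y) ` K" using k by blast
  next
    fix c assume "c \<in> (\<lambda>k. inv k \<otimes> y) ` K"
    then obtain k where k: "k \<in> K" "c = inv k \<otimes> y" by blast
    then have "k \<in> carrier G" using K by auto
    then have "c \<in> carrier G" "k \<otimes> c = y" using k(2) y by (simp_all add: m_assoc[symmetric])
    then show "c \<in> {c \<in> carrier G. y \<in> K #> c}" using k(1) by (auto simp: r_coset_def)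
  qed
  have "inj_on (\<lambda>k. inv k \<otimes> y) K"
  proof (rule inj_onI)
    fix k l assume kl: "k \<in> K" "l \<in> K" "inv k \<otimes> y = inv l \<otimes> y"
    have "k \<in> carrier G" "l \<in> carrier G" using kl K by auto
    then show "k = l" using kl(3) y by (simp add: inv_inj[THEN inj_on_eq_iff])
  qed
  then show "card {c \<in> carrier G. y \<in> K #> c} = card K" unfolding eq by (rule card_image)
  show "finite {c \<in> carrier G. y \<in> K #> c}" if "finite K" unfolding eq using that by simp
qed

lemma sum_card_translates_le:
  assumes K: "K \<subseteq> carrier G" "finite K" and Y: "Y \<subseteq> carrier G" "finite Y"
    and S: "S \<subseteq> carrier G" "finite S"
  shows "(\<Sum>c\<in>S. card ((K #> c) \<inter> Y)) \<le> card K * card Y"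
proof -
  have "card {c \<in> S. y \<in> K #> c} \<le> card K" if y: "y \<in> Y" for y
  proof -
    have yG: "y \<in> carrier G" using y Y by blast
    have "{c \<in> S. y \<in> K #> c} \<subseteq> {c \<in> carrier G. y \<in> K #> c}" using S by blast
    from card_mono[OF card_translates_through_point(2)[OF K(1) yG K(2)] this] show ?thesis
      by (simp add: card_translates_through_point(1)[OF K(1) yG])
  qed
  then have "(\<Sum>y\<in>Y. card {c \<in> S. y \<in> K #> c}) \<le> (\<Sum>y\<in>Y. card K)" by (rule sum_mono)
  then show ?thesis by (simp add: sum_card_translates[OF S(2) Y(2)] mult.commute)
qed

lemma sum_card_translates_eq:
  assumes K: "K \<subseteq> carrier G" and Y: "Y \<subseteq> carrier G" "finite Y"
    and S: "finite S" "{c \<in> carrier G. (K #> c) \<inter> Y \<noteq> {}} \<subseteq> S" "S \<subseteq> carrier G"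
  shows "(\<Sum>c\<in>S. card ((K #> c) \<inter> Y)) = card K * card Y"
proof -
  have "card {c \<in> S. y \<in> K #> c} = card K" if y: "y \<in> Y" for y
  proof -
    have "{c \<in> S. y \<in> K #> c} = {c \<in> carrier G. y \<in> K #> c}" using S y by blast
    moreover have "y \<in> carrier G" using y Y by blast
    ultimately show ?thesis by (simp add: card_translates_through_point(1)[OF K])
  qed
  then show ?thesis by (simp add: sum_card_translates[OF S(1) Y(2)] mult.commute)
qed

lemma card_r_coset:
  assumes "K \<subseteq> carrier G" "c \<in> carrier G"
  shows "card (K #> c) = card K"
proof -
  have "K #> c = (\<lambda>k. k \<otimes> c) ` K" by (auto simp: r_coset_def)
  moreover have "inj_on (\<lambda>k. k \<otimes> c) K"
    using assms by (intro inj_on_subset[OF _ assms(1)]) (simp add: inj_on_def)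
  ultimately show ?thesis by (simp add: card_image)
qed

lemma finite_r_coset: "finite K \<Longrightarrow> finite (K #> c)"
  by (simp add: r_coset_def)

lemma set_mult_eq_Union: "K <#> C = (\<Union>c\<in>C. K #> c)"
  by (auto simp: set_mult_def r_coset_def)

lemma finite_family_max_card:
  assumes "finite \<C>" "\<C> \<noteq> {}"
  shows "\<exists>C\<in>\<C>. \<forall>C'\<in>\<C>. card C' \<le> card C"
proof -
  have "Max (card ` \<C>) \<in> card ` \<C>" using assms by (intro Max_in) auto
  then obtain C where C: "C \<in> \<C>" "Max (card ` \<C>) = card C" by (rule imageE)
  have "card C' \<le> card C" if "C' \<in> \<C>" for C'
    unfolding C(2)[symmetric] using assms(1) that by (intro Max_ge) auto
  then show ?thesis using C(1) by blast
qed

text \<open>A set \<open>D\<close> with small boundary can be filled to the proportion \<open>\<epsilon>\<close> by translates of \<open>K\<close> that overlap so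
little that their number is controlled by the size of their union. Take \<open>C\<close> of maximal size such that the translates
lie in \<open>D\<close> and the overlap is at most \<open>\<epsilon>\<close>. By maximality every translate inside \<open>D\<close> meets \<open>K C\<close> in at least the
proportion \<open>\<epsilon>\<close>, and double counting bounds \<open>|K C|\<close> from below.\<close>

lemma fill_with_translates:
  assumes K: "K \<subseteq> carrier G" "finite K" "K \<noteq> {}" and D: "D \<subseteq> carrier G" "finite D"
    and e: "0 < \<epsilon>" "\<epsilon> < 1"
  obtains C where "C \<subseteq> carrier G" "finite C" "K <#> C \<subseteq> D"
    "(1 - \<epsilon>) * real (card K) * real (card C) \<le> real (card (K <#> C))"
    "\<epsilon> * (real (card D) - real (card (folner_boundary G K D))) \<le> real (card (K <#> C))"
proof -
  define I where "I = {c \<in> carrier G. K #> c \<subseteq> D}"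
  note I = card_translates_inside[OF K D, folded I_def]
  define \<C> where "\<C> = {C. C \<subseteq> I \<and> (1 - \<epsilon>) * real (card K) * real (card C) \<le> real (card (K <#> C))}"
  have "{} \<in> \<C>" by (simp add: \<C>_def)
  have "finite \<C>" using I(1) by (auto simp: \<C>_def)
  then have "\<exists>C\<in>\<C>. \<forall>C'\<in>\<C>. card C' \<le> card C"
    using \<open>{} \<in> \<C>\<close> by (intro finite_family_max_card) auto
  then obtain C where C: "C \<in> \<C>" and max: "\<forall>C'\<in>\<C>. card C' \<le> card C"
    by (rule bexE)
  have CI: "C \<subseteq> I" using C by (simp add: \<C>_def)
  have finC: "finite C" using CI I(1) finite_subset by blast
  have IG: "I \<subseteq> carrier G" by (auto simp: I_def)
  have KCD: "K <#> C \<subseteq> D" using CI by (auto simp: set_mult_eq_Union I_def)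
  have finKC: "finite (K <#> C)" using KCD D finite_subset by blast
  have meet: "\<epsilon> * real (card K) \<le> real (card ((K #> c) \<inter> (K <#> C)))" if c: "c \<in> I" for c
  proof -
    have cG: "c \<in> carrier G" using c IG by auto
    show ?thesis
    proof (cases "c \<in> C")
      case True
      then have "(K #> c) \<inter> (K <#> C) = K #> c" by (auto simp: set_mult_eq_Union)
      then show ?thesis using e card_r_coset[OF K(1) cG] by (simp add: mult_left_le_one_le)
    next
      case False
      then have "insert c C \<notin> \<C>" using bspec[OF max, of "insert c C"] finC by auto
      then have lt: "real (card (K <#> insert c C)) < (1 - \<epsilon>) * real (card K) * (real (card C) + 1)"
        using CI c False finC by (simp add: \<C>_def not_le add.commute)
      have "K <#> insert c C = (K #> c) \<union> (K <#> C)" by (auto simp: set_mult_eq_Union)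
      then have "card K + card (K <#> C) = card (K <#> insert c C) + card ((K #> c) \<inter> (K <#> C))"
        using card_Un_Int[OF finite_r_coset[OF K(2)] finKC, of c] card_r_coset[OF K(1) cG] by simp
      moreover have "(1 - \<epsilon>) * real (card K) * real (card C) \<le> real (card (K <#> C))"
        using C by (simp add: \<C>_def)
      ultimately show ?thesis using lt by (simp add: algebra_simps)
    qed
  qed
  have "real (card I) * (\<epsilon> * real (card K)) \<le> (\<Sum>c\<in>I. real (card ((K #> c) \<inter> (K <#> C))))"
    using sum_mono[OF meet] by simp
  also have "\<dots> = real (\<Sum>c\<in>I. card ((K #> c) \<inter> (K <#> C)))" by simp
  also have "\<dots> \<le> real (card K * card (K <#> C))"
  proof -
    have "K <#> C \<subseteq> carrier G" using KCD D by blast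
    then show ?thesis
      unfolding of_nat_le_iff by (rule sum_card_translates_le[OF K(1,2) _ finKC IG I(1)])
  qed
  finally have "real (card K) * (\<epsilon> * real (card I)) \<le> real (card K) * real (card (K <#> C))"
    by (simp add: algebra_simps)
  moreover have "0 < real (card K)" using K by (simp add: card_gt_0_iff)
  ultimately have "\<epsilon> * real (card I) \<le> real (card (K <#> C))"
    by (simp only: mult_le_cancel_left_pos)
  moreover have "\<epsilon> * (real (card D) - real (card (folner_boundary G K D))) \<le> \<epsilon> * real (card I)"
    using I(3) e by (intro mult_left_mono) auto
  ultimately have "\<epsilon> * (real (card D) - real (card (folner_boundary G K D))) \<le> real (card (K <#> C))"
    by linarith
  moreover have "C \<subseteq> carrier G" using CI IG by blast
  moreover have "(1 - \<epsilon>) * real (card K) * real (card C) \<le> real (card (K <#> C))"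
    using C by (simp add: \<C>_def)
  ultimately show ?thesis using finC KCD by (intro that)
qed

text \<open>One step of filling: \<open>D\<close> splits into tiles, on which \<open>f\<close> has density at most \<open>a\<close>, and a remainder \<open>R\<close>.
If \<open>R\<close> is not negligible, it is still almost invariant, because its boundary comes from \<open>D\<close> and from the tiles, so
the bound \<open>t1\<close> applies to \<open>R\<close>, and the tiles improve on it. If \<open>R\<close> is negligible, the trivial bound \<open>M\<close>
suffices for it. The maximum takes care of the two cases.\<close>

lemma ornstein_weiss_step:
  fixes f :: "'a set \<Rightarrow> real"
  assumes sub: "\<And>A B. \<lbrakk>finite A; A \<subseteq> carrier G; finite B; B \<subseteq> carrier G\<rbrakk> \<Longrightarrow> f (A \<union> B) \<le> f A + f B"
    and inv: "\<And>A g. \<lbrakk>finite A; A \<subseteq> carrier G; g \<in> carrier G\<rbrakk> \<Longrightarrow> f (A #> g) \<le> f A"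
    and bound: "\<And>A. \<lbrakk>finite A; A \<subseteq> carrier G\<rbrakk> \<Longrightarrow> f A \<le> M * real (card A)"
    and K: "K \<subseteq> carrier G" "finite K" "K \<noteq> {}" and fK: "f K \<le> t * real (card K)"
    and t: "0 \<le> t" "t < t1" and \<epsilon>: "0 < \<epsilon>" "\<epsilon> < 1" and \<tau>: "0 < \<tau>" and M: "0 \<le> M"
    and K': "K' \<subseteq> carrier G" "finite K'" and \<delta>': "0 < \<delta>'"
    and t1: "\<And>D. almost_invariant G K' \<delta>' D \<Longrightarrow> f D \<le> t1 * real (card D)"
    and Kinv: "almost_invariant G K' (\<delta>' * \<tau> * (1 - \<epsilon>) / 2) K"
    and D1: "almost_invariant G K (1/2) D" and D2: "almost_invariant G K' (\<delta>' * \<tau> / 2) D"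
    and a: "a = t / (1 - \<epsilon>)" "a < t1"
  shows "f D \<le> max (t1 - (t1 - a) * \<epsilon> / 2) (a + M * \<tau>) * real (card D)"
proof -
  have D: "D \<subseteq> carrier G" "finite D" "D \<noteq> {}" using D1 by (auto simp: almost_invariant_def)
  obtain C where C: "C \<subseteq> carrier G" "finite C" "K <#> C \<subseteq> D"
    and C1: "(1 - \<epsilon>) * real (card K) * real (card C) \<le> real (card (K <#> C))"
    and C2: "\<epsilon> * (real (card D) - real (card (folner_boundary G K D))) \<le> real (card (K <#> C))"
    by (rule fill_with_translates[OF K D(1,2) \<epsilon>])
  define R where "R = D - (K <#> C)"
  have finKC: "finite (K <#> C)" using C D finite_subset by blast
  have "R \<subseteq> D" by (auto simp: R_def)
  then have R: "R \<subseteq> carrier G" "finite R" using D(1,2) finite_subset by auto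
  have cardR: "real (card R) = real (card D) - real (card (K <#> C))"
    unfolding R_def using C finKC D by (simp add: card_Diff_subset card_mono of_nat_diff)
  have large: "\<epsilon> / 2 * real (card D) \<le> real (card (K <#> C))"
  proof -
    have "real (card (folner_boundary G K D)) < 1/2 * real (card D)"
      using D1 by (simp add: almost_invariant_def)
    then have "1/2 * real (card D) \<le> real (card D) - real (card (folner_boundary G K D))" by linarith
    then have "\<epsilon> * (1/2 * real (card D)) \<le> \<epsilon> * (real (card D) - real (card (folner_boundary G K D)))"
      using \<epsilon> by (intro mult_left_mono) auto
    then show ?thesis using C2 by simp
  qed
  have "f {} \<le> 0" using bound[of "{}"] by simp
  have "f (K <#> C) \<le> real (card C) * f K"
    using C(2,1)
  proof (induction C rule: finite_induct)
    case empty
    then show ?case using \<open>f {} \<le> 0\<close> by (simp add: set_mult_def)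
  next
    case (insert c C)
    have "K <#> insert c C = (K #> c) \<union> (K <#> C)" by (auto simp: set_mult_eq_Union)
    moreover have "f ((K #> c) \<union> (K <#> C)) \<le> f (K #> c) + f (K <#> C)"
    proof (rule sub)
      show "finite (K <#> C)" using insert K by (auto simp: set_mult_eq_Union finite_r_coset)
    qed (use insert K in \<open>auto simp: finite_r_coset r_coset_subset_G set_mult_closed\<close>)
    moreover have "f (K #> c) \<le> f K" using insert K inv by simp
    ultimately show ?case using insert by (simp add: algebra_simps)
  qed
  also have "\<dots> \<le> real (card C) * (t * real (card K))"
    using fK by (simp add: mult_left_mono)
  also have "\<dots> = a * ((1 - \<epsilon>) * real (card K) * real (card C))"
    using a \<epsilon> by simp
  also have "\<dots> \<le> a * real (card (K <#> C))"
    using C1 a t \<epsilon> by (intro mult_left_mono) auto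
  finally have fKC: "f (K <#> C) \<le> a * real (card (K <#> C))" .
  have "D = (K <#> C) \<union> R" using C by (auto simp: R_def)
  moreover have "K <#> C \<subseteq> carrier G" using C D by blast
  ultimately have fD: "f D \<le> f (K <#> C) + f R"
    using sub[of "K <#> C" R] finKC R by simp
  show ?thesis
  proof (cases "real (card R) < \<tau> * real (card D)")
    case True
    have "f R \<le> M * real (card R)" using bound R by blast
    also have "\<dots> \<le> M * (\<tau> * real (card D))" using True M by (intro mult_left_mono) auto
    finally have "f R \<le> M * \<tau> * real (card D)" by simp
    moreover have "a * real (card (K <#> C)) \<le> a * real (card D)"
      using a t \<epsilon> C D by (intro mult_left_mono) (auto simp: card_mono)
    ultimately have "f D \<le> (a + M * \<tau>) * real (card D)" using fD fKC by (simp add: algebra_simps)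
    also have "\<dots> \<le> max (t1 - (t1 - a) * \<epsilon> / 2) (a + M * \<tau>) * real (card D)"
      by (intro mult_right_mono) auto
    finally show ?thesis .
  next
    case False
    have bC: "real (card (folner_boundary G K' (K <#> C))) \<le> \<delta>' * \<tau> / 2 * real (card D)"
    proof -
      have finB: "finite (folner_boundary G K' K)" using finite_folner_boundary K' K by blast
      have "card (folner_boundary G K' (K <#> C)) \<le> card (folner_boundary G K' K \<times> C)"
        by (rule surj_card_le[OF _ folner_boundary_set_mult[OF K'(1) K(1) C(1)]]) (simp add: finB C(2))
      then have "real (card (folner_boundary G K' (K <#> C))) \<le> real (card (folner_boundary G K' K)) * real (card C)"
        by (metis card_cartesian_product of_nat_le_iff of_nat_mult)
      also have "\<dots> \<le> (\<delta>' * \<tau> * (1 - \<epsilon>) / 2 * real (card K)) * real (card C)"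
        using Kinv by (intro mult_right_mono) (auto simp: almost_invariant_def)
      also have "\<dots> = \<delta>' * \<tau> / 2 * ((1 - \<epsilon>) * real (card K) * real (card C))" by simp
      also have "\<dots> \<le> \<delta>' * \<tau> / 2 * real (card D)"
      proof (intro mult_left_mono)
        have "card (K <#> C) \<le> card D" using C(3) D(2) by (simp add: card_mono)
        then show "(1 - \<epsilon>) * real (card K) * real (card C) \<le> real (card D)" using C1 by linarith
      qed (use \<delta>' \<tau> in simp)
      finally show ?thesis .
    qed
    have "card (folner_boundary G K' R) \<le> card (folner_boundary G K' D \<union> folner_boundary G K' (K <#> C))"
      using folner_boundary_Diff finite_folner_boundary[OF K'] D finKC unfolding R_def
      by (intro card_mono) auto
    also have "\<dots> \<le> card (folner_boundary G K' D) + card (folner_boundary G K' (K <#> C))"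
      by (rule card_Un_le)
    finally have "real (card (folner_boundary G K' R))
      \<le> real (card (folner_boundary G K' D)) + real (card (folner_boundary G K' (K <#> C)))" by linarith
    also have "\<dots> < \<delta>' * \<tau> / 2 * real (card D) + \<delta>' * \<tau> / 2 * real (card D)"
      using D2 bC by (simp add: almost_invariant_def)
    also have "\<dots> = \<delta>' * (\<tau> * real (card D))" by simp
    also have "\<dots> \<le> \<delta>' * real (card R)" using False \<delta>' by (intro mult_left_mono) auto
    finally have "real (card (folner_boundary G K' R)) < \<delta>' * real (card R)" .
    moreover have "0 < \<tau> * real (card D)" using \<tau> D by (simp add: card_gt_0_iff)
    then have "R \<noteq> {}" using False by auto
    ultimately have "f R \<le> t1 * real (card R)"
      using t1 R by (simp add: almost_invariant_def)
    then have "f D \<le> t1 * real (card D) - (t1 - a) * real (card (K <#> C))"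
      using fD fKC cardR by (simp add: algebra_simps)
    also have "\<dots> \<le> t1 * real (card D) - (t1 - a) * (\<epsilon> / 2 * real (card D))"
      using large a by (intro diff_left_mono mult_left_mono) auto
    also have "\<dots> = (t1 - (t1 - a) * \<epsilon> / 2) * real (card D)" by (simp add: algebra_simps)
    also have "\<dots> \<le> max (t1 - (t1 - a) * \<epsilon> / 2) (a + M * \<tau>) * real (card D)"
      by (intro mult_right_mono) auto
    finally show ?thesis .
  qed
qed

text \<open>Let \<open>h\<close> be the infimum of the numbers \<open>t\<close> such that \<open>f D \<le> t |D|\<close> for all sufficiently invariant \<open>D\<close>; this
bounds the upper limit along every Folner sequence. For the lower limit it is enough that \<open>h \<le> t\<close> whenever
\<open>f D \<le> t |D|\<close> holds for sets \<open>D\<close> of arbitrarily high invariance. Otherwise one filling step with such sets as tiles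
turns a bound just above \<open>h\<close> into one below \<open>h\<close>. That \<open>h\<close> is an infimum replaces the iteration of the usual
quasi-tiling argument.\<close>

theorem ornstein_weiss:
  fixes f :: "'a set \<Rightarrow> real"
  assumes am: "amenable G"
    and sub: "\<And>A B. \<lbrakk>finite A; A \<subseteq> carrier G; finite B; B \<subseteq> carrier G\<rbrakk> \<Longrightarrow> f (A \<union> B) \<le> f A + f B"
    and inv: "\<And>A g. \<lbrakk>finite A; A \<subseteq> carrier G; g \<in> carrier G\<rbrakk> \<Longrightarrow> f (A #> g) \<le> f A"
    and bound: "\<And>A. \<lbrakk>finite A; A \<subseteq> carrier G\<rbrakk> \<Longrightarrow> f A \<le> M * real (card A)"
    and nonneg: "\<And>A. \<lbrakk>finite A; A \<subseteq> carrier G\<rbrakk> \<Longrightarrow> 0 \<le> f A"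
  shows "\<exists>h. \<forall>F. folner_sequence G F \<longrightarrow> (\<lambda>m. f (F m) / real (card (F m))) \<longlonglongrightarrow> h"
proof -
  define ok where "ok K \<delta> \<longleftrightarrow> K \<subseteq> carrier G \<and> finite K \<and> K \<noteq> {} \<and> 0 < (\<delta>::real)" for K \<delta>
  define T where "T = {t. \<exists>K \<delta>. ok K \<delta> \<and> (\<forall>D. almost_invariant G K \<delta> D \<longrightarrow> f D \<le> t * real (card D))}"
  have ex: "\<exists>D. almost_invariant G K \<delta> D" if "ok K \<delta>" for K \<delta>
    using that almost_invariant_exists[OF am] by (auto simp: ok_def)
  have cardpos: "0 < real (card D)" if "almost_invariant G K \<delta> D" for K \<delta> D
    using that by (auto simp: almost_invariant_def card_gt_0_iff)
  have fnn: "0 \<le> f D" if "almost_invariant G K \<delta> D" for K \<delta> D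
    using that nonneg by (auto simp: almost_invariant_def)
  have T0: "0 \<le> t" if t: "t \<in> T" for t
  proof -
    obtain K \<delta> where "ok K \<delta>" and *: "\<forall>D. almost_invariant G K \<delta> D \<longrightarrow> f D \<le> t * real (card D)"
      using t unfolding T_def by blast
    then obtain D where D: "almost_invariant G K \<delta> D" using ex by blast
    then have "0 \<le> t * real (card D)" using * fnn by force
    then show ?thesis using cardpos[OF D] by (simp add: zero_le_mult_iff)
  qed
  have M: "0 \<le> M"
    using nonneg[of "{\<one>}"] bound[of "{\<one>}"] by simp
  have "ok {\<one>} 1" by (simp add: ok_def)
  then have MT: "M \<in> T" unfolding T_def using bound by (auto simp: almost_invariant_def)
  define h where "h = Inf T"
  have bdd: "bdd_below T" using T0 by (auto simp: bdd_below_def)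
  have hle: "h \<le> t" if "t \<in> T" for t using that bdd by (simp add: h_def cInf_lower)
  have key: "h \<le> t" if freq: "\<And>K \<delta>. ok K \<delta> \<Longrightarrow> \<exists>D. almost_invariant G K \<delta> D \<and> f D \<le> t * real (card D)" for t
  proof (rule ccontr)
    assume "\<not> h \<le> t"
    then have th: "t < h" by simp
    have t0: "0 \<le> t"
    proof -
      obtain D where D: "almost_invariant G {\<one>} 1 D" "f D \<le> t * real (card D)"
        using freq[OF \<open>ok {\<one>} 1\<close>] by blast
      then have "0 \<le> t * real (card D)" using fnn by force
      then show ?thesis using cardpos[OF D(1)] by (simp add: zero_le_mult_iff)
    qed
    \<comment> \<open>This makes \<open>1 - \<epsilon> = (h + t) / (2 h)\<close>, so that the density of the tiles stays below \<open>h\<close>.\<close>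
    define \<epsilon> where "\<epsilon> = (h - t) / (2 * h)"
    have \<epsilon>: "0 < \<epsilon>" "\<epsilon> < 1" using th t0 by (auto simp: \<epsilon>_def field_simps)
    define a where "a = t / (1 - \<epsilon>)"
    have ah: "a < h"
    proof -
      have "h * (1 - \<epsilon>) = (h + t) / 2" using th t0 by (simp add: \<epsilon>_def field_simps)
      then have "t < h * (1 - \<epsilon>)" using th by simp
      then show ?thesis using \<epsilon> by (simp add: a_def pos_divide_less_eq)
    qed
    \<comment> \<open>\<open>\<eta>\<close> is at most the gain of one filling step, and \<open>\<tau>\<close> is the size below which a remainder is negligible.\<close>
    define \<eta> where "\<eta> = (h - a) * \<epsilon> / 2"
    define \<tau> where "\<tau> = (h - a) / (2 * (M + 1))"
    have \<tau>: "0 < \<tau>" using ah M by (simp add: \<tau>_def)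
    have \<eta>: "0 < \<eta>" using ah \<epsilon> by (simp add: \<eta>_def)
    obtain t1 where t1: "t1 \<in> T" "t1 < h + \<eta>"
      using cInf_lessD[of T "h + \<eta>"] MT \<eta> by (auto simp: h_def)
    have ht1: "h \<le> t1" using t1 hle by blast
    obtain K' \<delta>' where K': "ok K' \<delta>'" and w: "\<And>D. almost_invariant G K' \<delta>' D \<Longrightarrow> f D \<le> t1 * real (card D)"
      using t1 by (auto simp: T_def)
    have "ok K' (\<delta>' * \<tau> * (1 - \<epsilon>) / 2)" using K' \<tau> \<epsilon> by (simp add: ok_def)
    then obtain K where K: "almost_invariant G K' (\<delta>' * \<tau> * (1 - \<epsilon>) / 2) K" "f K \<le> t * real (card K)"
      using freq by blast
    have KG: "K \<subseteq> carrier G" "finite K" "K \<noteq> {}" using K by (auto simp: almost_invariant_def)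
    define s where "s = max (t1 - (t1 - a) * \<epsilon> / 2) (a + M * \<tau>)"
    define \<delta> where "\<delta> = min (1/2) (\<delta>' * \<tau> / 2)"
    have "s \<in> T"
      unfolding T_def
    proof (intro CollectI exI conjI allI impI)
      show "ok (K \<union> K') \<delta>" using KG K' \<tau> by (auto simp: ok_def \<delta>_def)
      fix D assume D: "almost_invariant G (K \<union> K') \<delta> D"
      show "f D \<le> s * real (card D)"
        unfolding s_def
      proof (rule ornstein_weiss_step[where f = f and M = M, OF sub inv bound KG K(2) t0 _ \<epsilon> \<tau> M _ _ _ w K(1) _ _ a_def])
        show "almost_invariant G K (1/2) D"
          by (rule almost_invariant_mono[OF D]) (use KG K' in \<open>auto simp: ok_def \<delta>_def\<close>)
        show "almost_invariant G K' (\<delta>' * \<tau> / 2) D"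
          by (rule almost_invariant_mono[OF D]) (use KG K' in \<open>auto simp: ok_def \<delta>_def\<close>)
      qed (use th ah ht1 K' in \<open>auto simp: ok_def\<close>)
    qed
    moreover have "s < h"
    proof -
      have "M * \<tau> < h - a"
      proof -
        have "M * \<tau> \<le> (M + 1) * \<tau>" using \<tau> by simp
        also have "\<dots> = (h - a) / 2"
          using M by (simp add: \<tau>_def eq_divide_eq divide_eq_eq add_nonneg_eq_0_iff)
        finally show ?thesis using ah by simp
      qed
      moreover have "t1 - (t1 - a) * \<epsilon> / 2 < h"
      proof -
        have "(h - a) * \<epsilon> / 2 \<le> (t1 - a) * \<epsilon> / 2" using ht1 \<epsilon> by (simp add: mult_right_mono)
        then show ?thesis using t1 by (simp add: \<eta>_def)
      qed
      ultimately show ?thesis by (simp add: s_def)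
    qed
    ultimately show False using hle by force
  qed
  have "(\<lambda>m. f (F m) / real (card (F m))) \<longlonglongrightarrow> h" if F: "folner_sequence G F" for F
  proof (rule order_tendstoI)
    have ev: "\<forall>\<^sub>F n in sequentially. almost_invariant G K \<delta> (F n)" if "ok K \<delta>" for K \<delta>
      using that F unfolding folner_sequence_alt ok_def by blast
    have pos: "0 < real (card (F m))" for m
      using F by (auto simp: folner_sequence_def card_gt_0_iff)
    {
      fix y assume "y < h"
      then obtain K \<delta> where K: "ok K \<delta>" "\<And>D. almost_invariant G K \<delta> D \<Longrightarrow> y * real (card D) < f D"
        using key[of y] by force
      show "\<forall>\<^sub>F m in sequentially. y < f (F m) / real (card (F m))"
        using ev[OF K(1)] by eventually_elim (use K(2) pos in \<open>simp add: pos_less_divide_eq\<close>)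
    next
      fix y assume "h < y"
      then obtain t where t: "t \<in> T" "t < y"
        using cInf_lessD[of T y] MT by (auto simp: h_def)
      then obtain K \<delta> where K: "ok K \<delta>" "\<And>D. almost_invariant G K \<delta> D \<Longrightarrow> f D \<le> t * real (card D)"
        by (auto simp: T_def)
      show "\<forall>\<^sub>F m in sequentially. f (F m) / real (card (F m)) < y"
        using ev[OF K(1)]
      proof eventually_elim
        case (elim m)
        then have "f (F m) / real (card (F m)) \<le> t" using K(2) pos by (simp add: pos_divide_le_eq)
        then show ?case using t by simp
      qed
    }
  qed
  then show ?thesis by blast
qed

end

section \<open>Covering numbers and shattered sets\<close>

lemma covering_number_le:
  assumes "\<V> \<subseteq> \<U>" "finite \<V>" "S \<subseteq> \<Union>\<V>"
  shows "covering_number S \<U> \<le> card \<V>"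
  unfolding covering_number_def by (rule Least_le) (use assms in blast)

lemma covering_number_attained:
  assumes "\<V>0 \<subseteq> \<U>" "finite \<V>0" "S \<subseteq> \<Union>\<V>0"
  shows "\<exists>\<V>\<subseteq>\<U>. finite \<V> \<and> S \<subseteq> \<Union>\<V> \<and> card \<V> = covering_number S \<U>"
  unfolding covering_number_def by (rule LeastI_ex) (use assms in blast)

text \<open>A cover that refines the family but is not part of it still bounds the covering number.\<close>

lemma covering_number_refine:
  assumes "finite \<V>" "S \<subseteq> \<Union>\<V>" and ref: "\<And>V. V \<in> \<V> \<Longrightarrow> \<exists>U\<in>\<U>. S \<inter> V \<subseteq> U"
  shows "covering_number S \<U> \<le> card \<V>"
proof -
  have "\<forall>V\<in>\<V>. \<exists>U. U \<in> \<U> \<and> S \<inter> V \<subseteq> U" using ref by blast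
  from bchoice[OF this] obtain r where r: "\<forall>V\<in>\<V>. r V \<in> \<U> \<and> S \<inter> V \<subseteq> r V" ..
  have "S \<subseteq> \<Union>(r ` \<V>)"
  proof
    fix x assume "x \<in> S"
    then obtain V where "V \<in> \<V>" "x \<in> V" using assms(2) by blast
    then show "x \<in> \<Union>(r ` \<V>)" using r \<open>x \<in> S\<close> by blast
  qed
  then have "covering_number S \<U> \<le> card (r ` \<V>)"
    using r assms(1) by (intro covering_number_le) auto
  also have "\<dots> \<le> card \<V>" using assms(1) by (rule card_image_le)
  finally show ?thesis .
qed

lemma covering_number_pos:
  assumes "finite \<U>" "S \<subseteq> \<Union>\<U>" "S \<noteq> {}"
  shows "0 < covering_number S \<U>"
proof -
  obtain \<V> where V: "\<V> \<subseteq> \<U>" "finite \<V>" "S \<subseteq> \<Union>\<V>" "card \<V> = covering_number S \<U>"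
    using covering_number_attained[OF order_refl assms(1,2)] by blast
  then have "\<V> \<noteq> {}" using assms(3) by auto
  then show ?thesis using V by (metis card_gt_0_iff)
qed

text \<open>Members are indexed by a choice of one label to be avoided at every coordinate. In the application
\<open>A g i\<close> is the set of points moved by \<open>g\<close> into the \<open>i\<close>-th set, and the family is the join of the cover by complements.
Points that carry no label at a coordinate are allowed, which is why counting patterns alone does not bound the
covering number.\<close>

definition avoidance_cover :: "('z \<Rightarrow> 'i \<Rightarrow> 'a set) \<Rightarrow> 'i set \<Rightarrow> 'z set \<Rightarrow> 'a set set" where
  "avoidance_cover A I Z = {{x. \<forall>z\<in>Z. x \<notin> A z (c z)} | c. c \<in> Z \<rightarrow> I}"

definition shatters :: "('z \<Rightarrow> 'i \<Rightarrow> 'a set) \<Rightarrow> 'i set \<Rightarrow> 'a set \<Rightarrow> 'z set \<Rightarrow> bool" where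
  "shatters A I T W \<longleftrightarrow> (\<forall>\<omega>\<in>W \<rightarrow> I. \<exists>x\<in>T. \<forall>z\<in>W. x \<in> A z (\<omega> z))"

lemma avoidance_cover_covers:
  assumes "finite Z" "\<And>z i j. z \<in> Z \<Longrightarrow> i \<in> I \<Longrightarrow> j \<in> I \<Longrightarrow> i \<noteq> j \<Longrightarrow> A z i \<inter> A z j = {}"
    and "i \<in> I" "j \<in> I" "i \<noteq> j" "finite I"
  shows "finite (avoidance_cover A I Z)" "\<Union>(avoidance_cover A I Z) = UNIV"
proof -
  have "avoidance_cover A I Z \<subseteq> (\<lambda>c. {x. \<forall>z\<in>Z. x \<notin> A z (c z)}) ` (Z \<rightarrow>\<^sub>E I)"
  proof
    fix V assume "V \<in> avoidance_cover A I Z"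
    then obtain c where "V = {x. \<forall>z\<in>Z. x \<notin> A z (c z)}" "c \<in> Z \<rightarrow> I"
      by (auto simp: avoidance_cover_def)
    then have "V = {x. \<forall>z\<in>Z. x \<notin> A z (restrict c Z z)}" "restrict c Z \<in> Z \<rightarrow>\<^sub>E I" by auto
    then show "V \<in> (\<lambda>c. {x. \<forall>z\<in>Z. x \<notin> A z (c z)}) ` (Z \<rightarrow>\<^sub>E I)" by blast
  qed
  then show "finite (avoidance_cover A I Z)"
    using assms by (meson finite_PiE finite_imageI finite_subset)
  have "x \<in> \<Union>(avoidance_cover A I Z)" for x
  proof -
    define c where "c z = (if x \<in> A z i then j else i)" for z
    have "c \<in> Z \<rightarrow> I" "\<forall>z\<in>Z. x \<notin> A z (c z)" using assms by (auto simp: c_def)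
    then show ?thesis unfolding avoidance_cover_def by blast
  qed
  then show "\<Union>(avoidance_cover A I Z) = UNIV" by blast
qed

text \<open>Every member of the union lies in at most \<open>|I| - 1\<close> of the families unless it lies in the intersection;
sum over the families.\<close>

lemma card_Union_Inter_family:
  assumes fin: "\<And>j. j \<in> I \<Longrightarrow> finite (\<S> j)" and I: "finite I" "2 \<le> card I"
    and m: "\<And>j. j \<in> I \<Longrightarrow> m \<le> real (card (\<S> j))"
  shows "real (card I) / (real (card I) - 1) * m \<le> real (card (\<Union>j\<in>I. \<S> j)) + real (card (\<Inter>j\<in>I. \<S> j))"
proof -
  define U where "U = (\<Union>j\<in>I. \<S> j)"
  define L where "L = (\<Inter>j\<in>I. \<S> j)"
  have finU: "finite U" using fin I by (auto simp: U_def)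
  have Ine: "I \<noteq> {}" using I by auto
  have LU: "L \<subseteq> U" using Ine by (auto simp: L_def U_def)
  have "real (card I) * m \<le> (\<Sum>j\<in>I. real (card (\<S> j)))"
    using sum_mono[OF m] by simp
  also have "\<dots> = (\<Sum>j\<in>I. \<Sum>W\<in>U. if W \<in> \<S> j then 1 else 0)"
  proof (intro sum.cong refl)
    fix j assume "j \<in> I"
    then have "U \<inter> \<S> j = \<S> j" by (auto simp: U_def)
    then show "real (card (\<S> j)) = (\<Sum>W\<in>U. if W \<in> \<S> j then 1 else 0)"
      using finU by (simp add: sum.If_cases)
  qed
  also have "\<dots> = (\<Sum>W\<in>U. \<Sum>j\<in>I. if W \<in> \<S> j then 1 else 0)" by (rule sum.swap)
  also have "\<dots> \<le> (\<Sum>W\<in>U. (real (card I) - 1) + (if W \<in> L then 1 else 0))"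
  proof (intro sum_mono)
    fix W assume "W \<in> U"
    have eq: "(\<Sum>j\<in>I. if W \<in> \<S> j then 1 else 0) = real (card {j\<in>I. W \<in> \<S> j})"
      using I by (simp add: sum.If_cases Int_def)
    show "(\<Sum>j\<in>I. if W \<in> \<S> j then 1 else 0) \<le> (real (card I) - 1) + (if W \<in> L then 1 else 0)"
    proof (cases "W \<in> L")
      case True
      have "card {j\<in>I. W \<in> \<S> j} \<le> card I" using I by (intro card_mono) auto
      then show ?thesis using True unfolding eq by simp
    next
      case False
      then have "{j\<in>I. W \<in> \<S> j} \<subset> I" by (auto simp: L_def)
      then have "card {j\<in>I. W \<in> \<S> j} < card I" using I psubset_card_mono by blast
      then show ?thesis using False unfolding eq by simp
    qed
  qed
  also have "\<dots> = (real (card I) - 1) * real (card U) + real (card L)"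
    using finU LU by (simp add: sum.distrib sum.If_cases Int_absorb1)
  also have "\<dots> \<le> (real (card I) - 1) * real (card U) + (real (card I) - 1) * real (card L)"
    using I by (simp add: mult_le_cancel_right1)
  finally show ?thesis
    using I unfolding U_def[symmetric] L_def[symmetric]
    by (simp add: divide_le_eq algebra_simps)
qed

text \<open>The analogue of Pajor's form of the Sauer-Shelah lemma for \<open>|I|\<close> labels. Induct on the coordinates. If at a
coordinate \<open>z\<close> all parts \<open>T \<inter> A z j\<close> still have covering number at least \<open>\<epsilon>\<close> times that of \<open>T\<close>, then a
set shattered by some part is shattered by \<open>T\<close>, a set shattered by all parts can be enlarged by \<open>z\<close>, and so the number of
shattered sets gains the factor \<open>|I| / (|I| - 1)\<close>, which makes up for the loss of \<open>\<epsilon>\<close>. Otherwise some part is small;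
removing it keeps the proportion \<open>1 - \<epsilon>\<close> of the covering number, and on the rest the label \<open>j\<close> may be avoided at \<open>z\<close>.\<close>

lemma card_shattered_ge:
  fixes A :: "'z \<Rightarrow> 'i \<Rightarrow> 'a set"
  assumes "finite Z" and I: "finite I" "2 \<le> card I"
    and disj: "\<And>z i j. z \<in> Z \<Longrightarrow> i \<in> I \<Longrightarrow> j \<in> I \<Longrightarrow> i \<noteq> j \<Longrightarrow> A z i \<inter> A z j = {}"
    and \<epsilon>: "0 < \<epsilon>" "\<epsilon> < 1" and \<alpha>: "0 < \<alpha>"
    and \<epsilon>\<alpha>: "(real (card I) - 1) / real (card I) \<le> \<epsilon> powr \<alpha>"
  shows "(real (covering_number T (avoidance_cover A I Z)) * (1 - \<epsilon>) ^ card Z) powr \<alpha>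
           \<le> real (card {W. W \<subseteq> Z \<and> shatters A I T W})"
  using \<open>finite Z\<close> disj
proof (induction Z arbitrary: T rule: finite_induct)
  case empty
  have "avoidance_cover A I {} = {UNIV}" by (auto simp: avoidance_cover_def)
  then have le: "covering_number T (avoidance_cover A I {}) \<le> (if T = {} then 0 else 1)"
    using covering_number_le[of "{}" "{UNIV}" T] covering_number_le[of "{UNIV}" "{UNIV}" T] by simp
  show ?case
  proof (cases "T = {}")
    case True
    then show ?thesis using le by simp
  next
    case False
    then have "{W. W \<subseteq> {} \<and> shatters A I T W} = {{}}" by (auto simp: shatters_def)
    moreover have "real (covering_number T (avoidance_cover A I {})) powr \<alpha> \<le> 1"
      using le False \<alpha> by (intro powr_le1) auto
    ultimately show ?thesis by simp
  qed
next
  case (insert z Z)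
  define N where "N Z T = covering_number T (avoidance_cover A I Z)" for Z T
  define Sh where "Sh Z T = {W. W \<subseteq> Z \<and> shatters A I T W}" for Z T
  have finSh: "finite (Sh Z T)" for T unfolding Sh_def using insert(1) by simp
  have finSh': "finite (Sh (insert z Z) T)" for T unfolding Sh_def using insert(1) by simp
  have IH: "(real (N Z T) * (1 - \<epsilon>) ^ card Z) powr \<alpha> \<le> real (card (Sh Z T))" for T
    unfolding N_def Sh_def by (rule insert.IH) (use insert.prems in blast)
  obtain i j where ij: "i \<in> I" "j \<in> I" "i \<noteq> j"
    using I(2) card_le_Suc0_iff_eq[OF I(1)] by auto
  have att: "\<exists>\<V>. \<V> \<subseteq> avoidance_cover A I Y \<and> finite \<V> \<and> S \<subseteq> \<Union>\<V> \<and> card \<V> = N Y S"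
    if "Y \<subseteq> insert z Z" for Y S
  proof -
    have Y: "finite Y" using that insert(1) by (simp add: finite_subset)
    have dY: "A y i \<inter> A y j = {}" if "y \<in> Y" "i \<in> I" "j \<in> I" "i \<noteq> j" for y i j
      using insert.prems[of y i j] that \<open>Y \<subseteq> insert z Z\<close> by blast
    have c: "finite (avoidance_cover A I Y)" "\<Union>(avoidance_cover A I Y) = UNIV"
      by (rule avoidance_cover_covers[of Y I A, OF Y _ ij I(1)]; (rule dY; assumption))+
    show ?thesis
      using covering_number_attained[OF order_refl c(1), where S = S] c(2)
      unfolding N_def by simp
  qed
  have avoid: "N (insert z Z) S \<le> N Z S" if "i \<in> I" "S \<inter> A z i = {}" for i S
  proof -
    obtain \<V> where \<V>: "\<V> \<subseteq> avoidance_cover A I Z" "finite \<V>" "S \<subseteq> \<Union>\<V>" "card \<V> = N Z S"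
      using att[of Z S] by auto
    have "N (insert z Z) S \<le> card \<V>"
      unfolding N_def
    proof (rule covering_number_refine[OF \<V>(2,3)])
      fix V assume "V \<in> \<V>"
      then obtain c where c: "c \<in> Z \<rightarrow> I" "V = {x. \<forall>z\<in>Z. x \<notin> A z (c z)}"
        using \<V>(1) by (auto simp: avoidance_cover_def)
      define c' where "c' = c(z := i)"
      have "c' \<in> insert z Z \<rightarrow> I" "S \<inter> V \<subseteq> {x. \<forall>z\<in>insert z Z. x \<notin> A z (c' z)}"
        using c that insert(2) by (auto simp: c'_def)
      then show "\<exists>U\<in>avoidance_cover A I (insert z Z). S \<inter> V \<subseteq> U"
        unfolding avoidance_cover_def by blast
    qed
    then show ?thesis using \<V>(4) by simp
  qed
  have inside: "N (insert z Z) (T \<inter> A z j) \<le> N Z (T \<inter> A z j)" if "j \<in> I" for j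
  proof -
    obtain i where "i \<in> I" "i \<noteq> j" using ij by metis
    then show ?thesis using avoid[of i] insert.prems[of z i j] that by blast
  qed
  have split: "N (insert z Z) T \<le> N (insert z Z) (T \<inter> A z j) + N (insert z Z) (T - A z j)" for j
  proof -
    obtain \<V>1 \<V>2 where \<V>: "\<V>1 \<subseteq> avoidance_cover A I (insert z Z)" "finite \<V>1" "T \<inter> A z j \<subseteq> \<Union>\<V>1"
      "card \<V>1 = N (insert z Z) (T \<inter> A z j)"
      "\<V>2 \<subseteq> avoidance_cover A I (insert z Z)" "finite \<V>2" "T - A z j \<subseteq> \<Union>\<V>2"
      "card \<V>2 = N (insert z Z) (T - A z j)"
      using att[of "insert z Z" "T \<inter> A z j"] att[of "insert z Z" "T - A z j"] by auto
    have "N (insert z Z) T \<le> card (\<V>1 \<union> \<V>2)"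
      unfolding N_def by (rule covering_number_le) (use \<V> in auto)
    also have "\<dots> \<le> card \<V>1 + card \<V>2" by (rule card_Un_le)
    finally show ?thesis using \<V> by simp
  qed
  have avoid': "N (insert z Z) (T - A z j) \<le> N Z (T - A z j)" if "j \<in> I" for j
    using avoid[OF that] by blast
  have sh_mono: "Sh Z S \<subseteq> Sh (insert z Z) T" if "S \<subseteq> T" for S
    using that unfolding Sh_def shatters_def by blast
  define n where "n = real (N (insert z Z) T)"
  show ?case
    unfolding N_def[symmetric] Sh_def[symmetric] n_def[symmetric]
  proof (cases "\<forall>j\<in>I. \<epsilon> * n \<le> real (N Z (T \<inter> A z j))")
    case True
    define m where "m = (\<epsilon> * n * (1 - \<epsilon>) ^ card Z) powr \<alpha>"
    have "m \<le> real (card (Sh Z (T \<inter> A z j)))" if "j \<in> I" for j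
    proof -
      have "m \<le> (real (N Z (T \<inter> A z j)) * (1 - \<epsilon>) ^ card Z) powr \<alpha>"
        unfolding m_def using True that \<epsilon> \<alpha> by (intro powr_mono2 mult_right_mono) (auto simp: n_def)
      then show ?thesis using IH order_trans by blast
    qed
    then have "real (card I) / (real (card I) - 1) * m
        \<le> real (card (\<Union>j\<in>I. Sh Z (T \<inter> A z j))) + real (card (\<Inter>j\<in>I. Sh Z (T \<inter> A z j)))"
      using finSh by (intro card_Union_Inter_family I) auto
    also have "\<dots> \<le> real (card (Sh (insert z Z) T))"
    proof -
      let ?U = "\<Union>j\<in>I. Sh Z (T \<inter> A z j)" and ?L = "\<Inter>j\<in>I. Sh Z (T \<inter> A z j)"
      have zL: "z \<notin> W" if "W \<in> ?U \<or> W \<in> ?L" for W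
        using that ij insert(2) by (auto simp: Sh_def)
      have "insert z W \<in> Sh (insert z Z) T" if W: "W \<in> ?L" for W
      proof -
        have "\<exists>x\<in>T. \<forall>y\<in>insert z W. x \<in> A y (\<omega> y)" if \<omega>: "\<omega> \<in> insert z W \<rightarrow> I" for \<omega>
        proof -
          have "shatters A I (T \<inter> A z (\<omega> z)) W" using W \<omega> by (auto simp: Sh_def)
          then obtain x where "x \<in> T \<inter> A z (\<omega> z)" "\<forall>y\<in>W. x \<in> A y (\<omega> y)"
            using \<omega> by (auto simp: shatters_def)
          then show ?thesis by blast
        qed
        moreover have "W \<subseteq> Z" using W ij by (auto simp: Sh_def)
        ultimately show ?thesis by (auto simp: Sh_def shatters_def)
      qed
      then have sub: "?U \<union> insert z ` ?L \<subseteq> Sh (insert z Z) T"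
        using sh_mono[of "T \<inter> A z _"] by blast
      have inj: "inj_on (insert z) ?L"
        using zL by (meson inj_onI insert_ident)
      have finL: "finite ?L" using finSh ij by (meson finite_INT)
      have "card ?U + card ?L = card (?U \<union> insert z ` ?L)"
        using zL I finSh finL card_image[OF inj] by (subst card_Un_disjoint) auto
      also have "\<dots> \<le> card (Sh (insert z Z) T)" using sub finSh' by (rule card_mono[rotated])
      finally show ?thesis by linarith
    qed
    finally have *: "real (card I) / (real (card I) - 1) * m \<le> real (card (Sh (insert z Z) T))" .
    have "(n * (1 - \<epsilon>) ^ card (insert z Z)) powr \<alpha> \<le> (n * (1 - \<epsilon>) ^ card Z) powr \<alpha>"
      using insert(1,2) \<epsilon> \<alpha>
      by (intro powr_mono2 mult_left_mono) (auto simp: n_def mult_left_le_one_le)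
    also have "\<dots> \<le> real (card I) / (real (card I) - 1) * (\<epsilon> powr \<alpha> * (n * (1 - \<epsilon>) ^ card Z) powr \<alpha>)"
    proof -
      have "1 \<le> real (card I) / (real (card I) - 1) * \<epsilon> powr \<alpha>"
        using \<epsilon>\<alpha> I by (simp add: field_simps)
      from mult_right_mono[OF this, of "(n * (1 - \<epsilon>) ^ card Z) powr \<alpha>"] show ?thesis
        by (simp add: mult.assoc)
    qed
    also have "\<epsilon> powr \<alpha> * (n * (1 - \<epsilon>) ^ card Z) powr \<alpha> = m"
      unfolding m_def using \<epsilon> by (simp add: powr_mult n_def mult.assoc)
    finally show "(n * (1 - \<epsilon>) ^ card (insert z Z)) powr \<alpha> \<le> real (card (Sh (insert z Z) T))"
      using * by linarith
  next
    case False
    then obtain j where j: "j \<in> I" "real (N Z (T \<inter> A z j)) < \<epsilon> * n" by auto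
    have "n \<le> real (N Z (T \<inter> A z j)) + real (N Z (T - A z j))"
      using split[of j] inside[OF j(1)] avoid'[OF j(1)] unfolding n_def by linarith
    then have "(1 - \<epsilon>) * n \<le> real (N Z (T - A z j))" using j by (simp add: algebra_simps)
    then have "(1 - \<epsilon>) * n * (1 - \<epsilon>) ^ card Z \<le> real (N Z (T - A z j)) * (1 - \<epsilon>) ^ card Z"
      using \<epsilon> by (intro mult_right_mono) auto
    then have "(n * (1 - \<epsilon>) ^ card (insert z Z)) powr \<alpha> \<le> (real (N Z (T - A z j)) * (1 - \<epsilon>) ^ card Z) powr \<alpha>"
      using insert(1,2) \<epsilon> \<alpha> by (intro powr_mono2) (simp_all add: n_def mult_ac)
    also have "\<dots> \<le> real (card (Sh Z (T - A z j)))" by (rule IH)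
    also have "\<dots> \<le> real (card (Sh (insert z Z) T))"
      using sh_mono[of "T - A z j"] finSh' by (simp add: card_mono)
    finally show "(n * (1 - \<epsilon>) ^ card (insert z Z)) powr \<alpha> \<le> real (card (Sh (insert z Z) T))" .
  qed
qed

text \<open>Weight a set \<open>W\<close> by \<open>x ^ |W|\<close>. All subsets together have weight \<open>(1 + x) ^ n\<close>, so there are too few
small sets to make up exponentially many.\<close>

lemma large_member_if_many:
  assumes "finite Z" "\<S> \<subseteq> Pow Z" and b: "0 < \<beta>" and x: "0 < x" "x < 1" "x \<le> \<beta> / 3"
    and many: "exp (\<beta> * real (card Z)) \<le> real (card \<S>)"
  shows "\<exists>W\<in>\<S>. \<beta> / (3 * ln (1 / x)) * real (card Z) \<le> real (card W)"
proof (rule ccontr)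
  define n where "n = real (card Z)"
  define q where "q = \<beta> / (3 * ln (1 / x))"
  assume "\<not> (\<exists>W\<in>\<S>. \<beta> / (3 * ln (1 / x)) * real (card Z) \<le> real (card W))"
  then have small: "real (card W) < q * n" if "W \<in> \<S>" for W
    using that by (force simp: q_def n_def)
  have lx: "ln x < 0" using x by simp
  have finS: "finite \<S>" using assms finite_subset by blast
  have ne: "\<S> \<noteq> {}" using many by (auto simp: not_le)
  then obtain W where "W \<in> \<S>" by blast
  then have "n \<noteq> 0" using small[of W] by auto
  then have n: "0 < n" by (simp add: n_def)
  have "x powr (q * n) * real (card \<S>) = (\<Sum>W\<in>\<S>. x powr (q * n))" by simp
  also have "\<dots> \<le> (\<Sum>W\<in>\<S>. x ^ card W)"
  proof (intro sum_mono)
    fix W assume "W \<in> \<S>"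
    then have "x powr (q * n) \<le> x powr real (card W)"
      using small[of W] x by (intro powr_mono') auto
    then show "x powr (q * n) \<le> x ^ card W" using x by (simp add: powr_realpow)
  qed
  also have "\<dots> \<le> (\<Sum>W\<in>Pow Z. x ^ card W)"
    using assms x by (intro sum_mono2) auto
  also have "\<dots> = (1 + x) ^ card Z"
    using prod_add[OF \<open>finite Z\<close>, of "\<lambda>_. x" "\<lambda>_. 1"] by (simp add: add.commute)
  also have "\<dots> = (1 + x) powr n" using x by (simp add: n_def powr_realpow)
  also have "\<dots> \<le> exp x powr n" using x n by (intro powr_mono2) auto
  also have "\<dots> = exp (x * n)" by (simp add: exp_powr_real)
  also have "\<dots> \<le> exp (\<beta> / 3 * n)" using x n by simp
  finally have le: "x powr (q * n) * real (card \<S>) \<le> exp (\<beta> / 3 * n)" .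
  have xq: "x powr (q * n) = exp (- (\<beta> / 3 * n))"
    using x lx by (simp add: powr_def q_def ln_div field_simps)
  have "exp (- (\<beta> / 3 * n)) * exp (\<beta> * n) \<le> exp (- (\<beta> / 3 * n)) * real (card \<S>)"
    using many by (intro mult_left_mono) (auto simp: n_def)
  also have "\<dots> \<le> exp (\<beta> / 3 * n)" using le unfolding xq .
  finally have "exp (- (\<beta> / 3 * n)) * exp (\<beta> * n) \<le> exp (\<beta> / 3 * n)" .
  then have "- (\<beta> / 3 * n) + \<beta> * n \<le> \<beta> / 3 * n"
    unfolding exp_add[symmetric] exp_le_cancel_iff .
  moreover have "0 < \<beta> * n" using b n by simp
  ultimately show False by linarith
qed

lemma large_shattered_set:
  assumes "2 \<le> k" and "0 < b"
  shows "\<exists>q>0. \<forall>Z (A :: 'z \<Rightarrow> 'i \<Rightarrow> 'a set) I T.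
      finite Z \<and> card I = k \<and> (\<forall>z\<in>Z. \<forall>i\<in>I. \<forall>j\<in>I. i \<noteq> j \<longrightarrow> A z i \<inter> A z j = {}) \<and>
      exp (b * real (card Z)) \<le> real (covering_number T (avoidance_cover A I Z)) \<longrightarrow>
      (\<exists>W\<subseteq>Z. shatters A I T W \<and> q * real (card Z) \<le> real (card W))"
proof -
  \<comment> \<open>The losses \<open>1 - \<epsilon>\<close> use up half of the exponent \<open>b\<close>, and \<open>\<alpha>\<close> balances a loss of \<open>\<epsilon>\<close> against the gain
of one branching.\<close>
  define \<epsilon> where "\<epsilon> = 1 - exp (- b / 2)"
  have \<epsilon>: "0 < \<epsilon>" "\<epsilon> < 1" using assms by (auto simp: \<epsilon>_def)
  define \<alpha> where "\<alpha> = ln ((real k - 1) / real k) / ln \<epsilon>"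
  have r: "0 < (real k - 1) / real k" "(real k - 1) / real k < 1" using assms by auto
  then have \<alpha>: "0 < \<alpha>" using \<epsilon> unfolding \<alpha>_def by (intro divide_neg_neg) auto
  have "ln \<epsilon> \<noteq> 0" using \<epsilon> by simp
  then have "\<epsilon> powr \<alpha> = exp (ln ((real k - 1) / real k))" using \<epsilon> by (simp add: powr_def \<alpha>_def)
  then have \<epsilon>\<alpha>: "\<epsilon> powr \<alpha> = (real k - 1) / real k" using r by simp
  define \<beta> where "\<beta> = \<alpha> * b / 2"
  have \<beta>: "0 < \<beta>" using \<alpha> assms by (simp add: \<beta>_def)
  define x where "x = min (\<beta> / 3) (1/2)"
  have x: "0 < x" "x < 1" "x \<le> \<beta> / 3" using \<beta> by (auto simp: x_def)
  define q where "q = \<beta> / (3 * ln (1 / x))"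
  have "0 < q" using \<beta> x by (simp add: q_def)
  moreover have "\<exists>W\<subseteq>Z. shatters A I T W \<and> q * real (card Z) \<le> real (card W)"
    if "finite Z" "card I = k" and disj: "\<forall>z\<in>Z. \<forall>i\<in>I. \<forall>j\<in>I. i \<noteq> j \<longrightarrow> A z i \<inter> A z j = {}"
      and N: "exp (b * real (card Z)) \<le> real (covering_number T (avoidance_cover A I Z))"
    for Z and A :: "'z \<Rightarrow> 'i \<Rightarrow> 'a set" and I T
  proof -
    let ?N = "real (covering_number T (avoidance_cover A I Z))" and ?n = "real (card Z)"
    let ?S = "{W. W \<subseteq> Z \<and> shatters A I T W}"
    have I: "2 \<le> card I" "finite I" using that(2) assms(1) by (simp_all add: card_ge_0_finite)
    have "(1 - \<epsilon>) ^ card Z = exp (?n * (- b / 2))"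
      unfolding exp_of_nat_mult by (simp add: \<epsilon>_def)
    then have "exp (b * ?n) * (1 - \<epsilon>) ^ card Z = exp (b * ?n + ?n * (- b / 2))"
      by (simp only: exp_add)
    then have "exp (b / 2 * ?n) = exp (b * ?n) * (1 - \<epsilon>) ^ card Z"
      by (simp add: algebra_simps)
    also have "\<dots> \<le> ?N * (1 - \<epsilon>) ^ card Z"
      using N \<epsilon> by (intro mult_right_mono) auto
    finally have "exp (b / 2 * ?n) powr \<alpha> \<le> (?N * (1 - \<epsilon>) ^ card Z) powr \<alpha>"
      using \<alpha> by (intro powr_mono2) auto
    also have "\<dots> \<le> real (card ?S)"
    proof (rule card_shattered_ge[OF \<open>finite Z\<close> I(2,1) _ \<epsilon> \<alpha>])
      show "(real (card I) - 1) / real (card I) \<le> \<epsilon> powr \<alpha>" using \<epsilon>\<alpha> that(2) by simp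
    qed (use disj in simp)
    also have "exp (b / 2 * ?n) powr \<alpha> = exp (\<beta> * ?n)"
      by (simp add: exp_powr_real \<beta>_def mult_ac)
    finally have many: "exp (\<beta> * ?n) \<le> real (card ?S)" .
    have "?S \<subseteq> Pow Z" by blast
    from large_member_if_many[OF \<open>finite Z\<close> this \<beta> x many] show ?thesis
      unfolding q_def[symmetric] by blast
  qed
  ultimately show ?thesis by (intro exI[of _ q]) auto
qed

section \<open>Entropy of finite covers\<close>

definition log_cover_number ::
  "'a set \<Rightarrow> ('g \<Rightarrow> 'a \<Rightarrow> 'a) \<Rightarrow> 'a set set \<Rightarrow> 'g set \<Rightarrow> real" where
  "log_cover_number S \<phi> \<U> F = ln (real (covering_number S (cover_join S \<phi> \<U> F)))"

text \<open>Only the values of the choice function on \<open>F\<close> matter, so extensional choice functions, of which there are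
finitely many, suffice.\<close>

lemma cover_join_eq_image:
  "cover_join S \<phi> \<U> F = (\<lambda>c. {x \<in> S. \<forall>g \<in> F. \<phi> g x \<in> c g}) ` (F \<rightarrow>\<^sub>E \<U>)"
proof (intro equalityI subsetI)
  fix V assume "V \<in> cover_join S \<phi> \<U> F"
  then obtain c where "V = {x \<in> S. \<forall>g \<in> F. \<phi> g x \<in> c g}" "c \<in> F \<rightarrow> \<U>"
    by (auto simp: cover_join_def)
  then have "V = {x \<in> S. \<forall>g \<in> F. \<phi> g x \<in> restrict c F g}" "restrict c F \<in> F \<rightarrow>\<^sub>E \<U>" by auto
  then show "V \<in> (\<lambda>c. {x \<in> S. \<forall>g \<in> F. \<phi> g x \<in> c g}) ` (F \<rightarrow>\<^sub>E \<U>)" by (rule image_eqI)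
next
  fix V assume "V \<in> (\<lambda>c. {x \<in> S. \<forall>g \<in> F. \<phi> g x \<in> c g}) ` (F \<rightarrow>\<^sub>E \<U>)"
  then obtain c where "V = {x \<in> S. \<forall>g \<in> F. \<phi> g x \<in> c g}" "c \<in> F \<rightarrow>\<^sub>E \<U>" by (rule imageE)
  then show "V \<in> cover_join S \<phi> \<U> F" by (auto simp: cover_join_def PiE_def)
qed

lemma finite_cover_join: "finite \<U> \<Longrightarrow> finite F \<Longrightarrow> finite (cover_join S \<phi> \<U> F)"
  unfolding cover_join_eq_image by (intro finite_imageI finite_PiE) auto

lemma card_cover_join_le: "finite \<U> \<Longrightarrow> finite F \<Longrightarrow> card (cover_join S \<phi> \<U> F) \<le> card \<U> ^ card F"
  unfolding cover_join_eq_image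
  using card_image_le[of "F \<rightarrow>\<^sub>E \<U>"] by (simp add: card_PiE finite_PiE)

lemma ln_of_nat_mono: "0 < a \<Longrightarrow> a \<le> b \<Longrightarrow> ln (real a) \<le> ln (real b)"
  by simp

context group_action
begin

lemma group_G: "group G"
  using group_hom by (simp add: group_hom_def)

lemma action_closed: "g \<in> carrier G \<Longrightarrow> x \<in> E \<Longrightarrow> \<phi> g x \<in> E"
  using element_image by blast

lemma cover_join_covers:
  assumes "E \<subseteq> \<Union>\<U>" "F \<subseteq> carrier G"
  shows "E \<subseteq> \<Union>(cover_join E \<phi> \<U> F)"
proof
  fix x assume x: "x \<in> E"
  have "\<forall>g\<in>F. \<exists>U\<in>\<U>. \<phi> g x \<in> U" using assms action_closed x by blast
  then obtain c where c: "\<forall>g\<in>F. c g \<in> \<U> \<and> \<phi> g x \<in> c g" by metis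
  then have "x \<in> {x \<in> E. \<forall>g \<in> F. \<phi> g x \<in> c g}" "c \<in> F \<rightarrow> \<U>" using x by auto
  then show "x \<in> \<Union>(cover_join E \<phi> \<U> F)" unfolding cover_join_def by blast
qed

lemma cover_join_attained:
  assumes "finite \<U>" "E \<subseteq> \<Union>\<U>" "finite F" "F \<subseteq> carrier G"
  shows "\<exists>\<V>\<subseteq>cover_join E \<phi> \<U> F. finite \<V> \<and> E \<subseteq> \<Union>\<V> \<and>
    card \<V> = covering_number E (cover_join E \<phi> \<U> F)"
  by (rule covering_number_attained[OF order_refl finite_cover_join cover_join_covers]) (use assms in auto)

lemma covering_number_join_pos:
  assumes "finite \<U>" "E \<subseteq> \<Union>\<U>" "finite F" "F \<subseteq> carrier G" "E \<noteq> {}"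
  shows "0 < covering_number E (cover_join E \<phi> \<U> F)"
  using covering_number_pos[OF finite_cover_join cover_join_covers] assms by blast

text \<open>If the join of the \<open>\<W> p\<close> refines \<open>\<U>\<close>, then the same holds after joining along \<open>F\<close>, coordinate by
coordinate.\<close>

lemma covering_number_join_le_prod:
  assumes P: "finite P" and W: "\<And>p. p \<in> P \<Longrightarrow> finite (\<W> p) \<and> E \<subseteq> \<Union>(\<W> p)"
    and F: "finite F" "F \<subseteq> carrier G"
    and ref: "\<And>c. (\<And>p. p \<in> P \<Longrightarrow> c p \<in> \<W> p) \<Longrightarrow> \<exists>U\<in>\<U>. {x \<in> E. \<forall>p\<in>P. x \<in> c p} \<subseteq> U"
  shows "covering_number E (cover_join E \<phi> \<U> F) \<le> (\<Prod>p\<in>P. covering_number E (cover_join E \<phi> (\<W> p) F))"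
proof -
  have "\<exists>\<V>. \<V> \<subseteq> cover_join E \<phi> (\<W> p) F \<and> finite \<V> \<and> E \<subseteq> \<Union>\<V> \<and>
      card \<V> = covering_number E (cover_join E \<phi> (\<W> p) F)" if "p \<in> P" for p
  proof -
    have "finite (\<W> p)" "E \<subseteq> \<Union>(\<W> p)" using W[OF that] by auto
    from cover_join_attained[OF this F] show ?thesis by blast
  qed
  then have "\<forall>p\<in>P. \<exists>\<V>. \<V> \<subseteq> cover_join E \<phi> (\<W> p) F \<and> finite \<V> \<and> E \<subseteq> \<Union>\<V> \<and>
      card \<V> = covering_number E (cover_join E \<phi> (\<W> p) F)" by blast
  from bchoice[OF this] obtain \<V> where \<V>: "\<forall>p\<in>P. \<V> p \<subseteq> cover_join E \<phi> (\<W> p) F \<and> finite (\<V> p) \<and> E \<subseteq> \<Union>(\<V> p) \<and>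
      card (\<V> p) = covering_number E (cover_join E \<phi> (\<W> p) F)" ..
  define J where "J = (\<lambda>v. {x \<in> E. \<forall>p\<in>P. x \<in> v p}) ` (PiE P \<V>)"
  have fin: "finite (PiE P \<V>)" using P \<V> by (intro finite_PiE) auto
  have "covering_number E (cover_join E \<phi> \<U> F) \<le> card J"
  proof (rule covering_number_refine)
    show "finite J" using fin by (simp add: J_def)
    show "E \<subseteq> \<Union>J"
    proof
      fix x assume x: "x \<in> E"
      then have "\<forall>p\<in>P. \<exists>V\<in>\<V> p. x \<in> V" using \<V> by blast
      then obtain v where "\<forall>p\<in>P. v p \<in> \<V> p \<and> x \<in> v p" by metis
      then have "restrict v P \<in> PiE P \<V>" "x \<in> {x \<in> E. \<forall>p\<in>P. x \<in> restrict v P p}" using x by auto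
      then show "x \<in> \<Union>J" unfolding J_def by blast
    qed
    fix V assume "V \<in> J"
    then obtain v where v: "v \<in> PiE P \<V>" "V = {x \<in> E. \<forall>p\<in>P. x \<in> v p}" by (auto simp: J_def)
    have "\<exists>c. c \<in> F \<rightarrow> \<W> p \<and> v p = {x \<in> E. \<forall>g\<in>F. \<phi> g x \<in> c g}" if "p \<in> P" for p
    proof -
      have "v p \<in> cover_join E \<phi> (\<W> p) F" using that v \<V> by blast
      then show ?thesis by (auto simp: cover_join_def)
    qed
    then have "\<forall>p\<in>P. \<exists>c. c \<in> F \<rightarrow> \<W> p \<and> v p = {x \<in> E. \<forall>g\<in>F. \<phi> g x \<in> c g}" by blast
    from bchoice[OF this]
    obtain c where c: "\<forall>p\<in>P. c p \<in> F \<rightarrow> \<W> p \<and> v p = {x \<in> E. \<forall>g\<in>F. \<phi> g x \<in> c p g}" ..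
    have "\<exists>U\<in>\<U>. {x \<in> E. \<forall>p\<in>P. x \<in> c p g} \<subseteq> U" if "g \<in> F" for g
      by (rule ref[of "\<lambda>p. c p g"]) (use c that in auto)
    then have "\<forall>g\<in>F. \<exists>U. U \<in> \<U> \<and> {x \<in> E. \<forall>p\<in>P. x \<in> c p g} \<subseteq> U" by blast
    from bchoice[OF this] obtain d where d: "\<forall>g\<in>F. d g \<in> \<U> \<and> {x \<in> E. \<forall>p\<in>P. x \<in> c p g} \<subseteq> d g" ..
    have "\<phi> g x \<in> d g" if "x \<in> V" "g \<in> F" for x g
    proof -
      have "\<phi> g x \<in> E" using that v F action_closed by auto
      moreover have "\<forall>p\<in>P. \<phi> g x \<in> c p g" using that v(2) c by auto
      ultimately show ?thesis using d that by blast
    qed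
    then have "E \<inter> V \<subseteq> {x \<in> E. \<forall>g\<in>F. \<phi> g x \<in> d g}" by blast
    moreover have "d \<in> F \<rightarrow> \<U>" using d by blast
    ultimately show "\<exists>U\<in>cover_join E \<phi> \<U> F. E \<inter> V \<subseteq> U"
      unfolding cover_join_def by blast
  qed
  also have "\<dots> \<le> card (PiE P \<V>)" unfolding J_def using fin by (rule card_image_le)
  also have "\<dots> = (\<Prod>p\<in>P. covering_number E (cover_join E \<phi> (\<W> p) F))"
    using P \<V> by (simp add: card_PiE)
  finally show ?thesis .
qed

lemma covering_number_join_Un:
  assumes U: "finite \<U>" "E \<subseteq> \<Union>\<U>" and A: "finite A" "A \<subseteq> carrier G" and B: "finite B" "B \<subseteq> carrier G"
  shows "covering_number E (cover_join E \<phi> \<U> (A \<union> B))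
     \<le> covering_number E (cover_join E \<phi> \<U> A) * covering_number E (cover_join E \<phi> \<U> B)"
proof -
  obtain \<V>1 where V1: "\<V>1 \<subseteq> cover_join E \<phi> \<U> A" "finite \<V>1" "E \<subseteq> \<Union>\<V>1"
    "card \<V>1 = covering_number E (cover_join E \<phi> \<U> A)" using cover_join_attained[OF U A] by blast
  obtain \<V>2 where V2: "\<V>2 \<subseteq> cover_join E \<phi> \<U> B" "finite \<V>2" "E \<subseteq> \<Union>\<V>2"
    "card \<V>2 = covering_number E (cover_join E \<phi> \<U> B)" using cover_join_attained[OF U B] by blast
  define J where "J = (\<lambda>(V, W). V \<inter> W) ` (\<V>1 \<times> \<V>2)"
  have "covering_number E (cover_join E \<phi> \<U> (A \<union> B)) \<le> card J"
  proof (rule covering_number_refine)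
    show "finite J" using V1 V2 by (simp add: J_def)
    show "E \<subseteq> \<Union>J"
    proof
      fix x assume x: "x \<in> E"
      obtain A1 where "A1 \<in> \<V>1" "x \<in> A1" using V1(3) x by blast
      moreover obtain A2 where "A2 \<in> \<V>2" "x \<in> A2" using V2(3) x by blast
      ultimately show "x \<in> \<Union>J" unfolding J_def by (intro UnionI[of "A1 \<inter> A2"]) auto
    qed
    fix V assume "V \<in> J"
    then obtain A1 A2 where A12: "A1 \<in> \<V>1" "A2 \<in> \<V>2" "V = A1 \<inter> A2" by (auto simp: J_def)
    have V: "A1 \<in> cover_join E \<phi> \<U> A" "A2 \<in> cover_join E \<phi> \<U> B"
      using A12 V1(1) V2(1) by auto
    obtain c1 where c1: "c1 \<in> A \<rightarrow> \<U>" "A1 = {x \<in> E. \<forall>g\<in>A. \<phi> g x \<in> c1 g}"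
      using V(1) by (auto simp: cover_join_def)
    obtain c2 where c2: "c2 \<in> B \<rightarrow> \<U>" "A2 = {x \<in> E. \<forall>g\<in>B. \<phi> g x \<in> c2 g}"
      using V(2) by (auto simp: cover_join_def)
    define c where "c g = (if g \<in> A then c1 g else c2 g)" for g
    have "c \<in> A \<union> B \<rightarrow> \<U>" "E \<inter> V \<subseteq> {x \<in> E. \<forall>g\<in>A \<union> B. \<phi> g x \<in> c g}"
      using c1 c2 A12(3) by (auto simp: c_def)
    then show "\<exists>U\<in>cover_join E \<phi> \<U> (A \<union> B). E \<inter> V \<subseteq> U"
      unfolding cover_join_def by blast
  qed
  also have "\<dots> \<le> card (\<V>1 \<times> \<V>2)" unfolding J_def using V1 V2 by (intro card_image_le) auto
  finally show ?thesis using V1 V2 by (simp add: card_cartesian_product)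
qed

lemma covering_number_join_translate:
  assumes U: "finite \<U>" "E \<subseteq> \<Union>\<U>" and A: "finite A" "A \<subseteq> carrier G" and h: "h \<in> carrier G"
  shows "covering_number E (cover_join E \<phi> \<U> (A #> h)) \<le> covering_number E (cover_join E \<phi> \<U> A)"
proof -
  interpret group G by (rule group_G)
  obtain \<V> where V: "\<V> \<subseteq> cover_join E \<phi> \<U> A" "finite \<V>" "E \<subseteq> \<Union>\<V>"
    "card \<V> = covering_number E (cover_join E \<phi> \<U> A)" using cover_join_attained[OF U A] by blast
  define J where "J = (\<lambda>V. {x \<in> E. \<phi> h x \<in> V}) ` \<V>"
  have "covering_number E (cover_join E \<phi> \<U> (A #> h)) \<le> card J"
  proof (rule covering_number_refine)
    show "finite J" using V by (simp add: J_def)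
    show "E \<subseteq> \<Union>J"
    proof
      fix x assume x: "x \<in> E"
      then obtain W where "W \<in> \<V>" "\<phi> h x \<in> W" using V(3) action_closed[OF h x] by blast
      then show "x \<in> \<Union>J" using x unfolding J_def by blast
    qed
    fix V' assume "V' \<in> J"
    then obtain W where W: "W \<in> \<V>" "V' = {x \<in> E. \<phi> h x \<in> W}" by (auto simp: J_def)
    then have "W \<in> cover_join E \<phi> \<U> A" using V(1) by blast
    then obtain c where c: "c \<in> A \<rightarrow> \<U>" "W = {x \<in> E. \<forall>g\<in>A. \<phi> g x \<in> c g}"
      by (auto simp: cover_join_def)
    then have c2: "V' = {x \<in> E. \<forall>g\<in>A. \<phi> g (\<phi> h x) \<in> c g}"
      using W(2) action_closed[OF h] by auto
    define d where "d k = c (k \<otimes> inv h)" for k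
    have gh: "(g \<otimes> h) \<otimes> inv h = g" if "g \<in> A" for g
      using that A h by (simp add: m_assoc subset_iff)
    have "d \<in> (A #> h) \<rightarrow> \<U>" using c(1) gh by (auto simp: d_def r_coset_def)
    moreover have "E \<inter> V' \<subseteq> {x \<in> E. \<forall>k\<in>(A #> h). \<phi> k x \<in> d k}"
      using c2 gh A h composition_rule[OF _ _ h] by (auto simp: d_def r_coset_def subset_iff)
    ultimately show "\<exists>U\<in>cover_join E \<phi> \<U> (A #> h). E \<inter> V' \<subseteq> U"
      unfolding cover_join_def by blast
  qed
  also have "\<dots> \<le> card \<V>" unfolding J_def using V by (intro card_image_le) auto
  finally show ?thesis using V by simp
qed

lemma cover_entropy_tendsto_aux:
  assumes am: "amenable G" and U: "finite \<U>" "E \<subseteq> \<Union>\<U>"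
  shows "\<exists>h. \<forall>F. folner_sequence G F \<longrightarrow>
    (\<lambda>m. log_cover_number E \<phi> \<U> (F m) / real (card (F m))) \<longlonglongrightarrow> h"
proof (cases "E = {}")
  case True
  then have "covering_number E (cover_join E \<phi> \<U> F) = 0" for F
    using covering_number_le[of "{}" "cover_join E \<phi> \<U> F" E] by simp
  then show ?thesis by (auto simp: log_cover_number_def)
next
  case False
  interpret group G by (rule group_G)
  have pos: "0 < covering_number E (cover_join E \<phi> \<U> A)" if "finite A" "A \<subseteq> carrier G" for A
    using covering_number_join_pos[OF U that False] .
  show ?thesis
  proof (rule ornstein_weiss[where f = "log_cover_number E \<phi> \<U>" and M = "ln (real (card \<U>))", OF am])
    fix A B assume A: "finite A" "A \<subseteq> carrier G" and B: "finite B" "B \<subseteq> carrier G"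
    have "log_cover_number E \<phi> \<U> (A \<union> B)
      \<le> ln (real (covering_number E (cover_join E \<phi> \<U> A) * covering_number E (cover_join E \<phi> \<U> B)))"
      unfolding log_cover_number_def
      by (rule ln_of_nat_mono[OF pos covering_number_join_Un[OF U A B]]) (use A B in auto)
    also have "\<dots> = log_cover_number E \<phi> \<U> A + log_cover_number E \<phi> \<U> B"
      using pos[OF A] pos[OF B] by (simp add: log_cover_number_def ln_mult)
    finally show "log_cover_number E \<phi> \<U> (A \<union> B) \<le> log_cover_number E \<phi> \<U> A + log_cover_number E \<phi> \<U> B" .
  next
    fix A g assume A: "finite A" "A \<subseteq> carrier G" and g: "g \<in> carrier G"
    show "log_cover_number E \<phi> \<U> (A #> g) \<le> log_cover_number E \<phi> \<U> A"
      unfolding log_cover_number_def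
      by (rule ln_of_nat_mono[OF pos covering_number_join_translate[OF U A g]])
        (use A g in \<open>auto simp: finite_r_coset dest: r_coset_subset_G[THEN subsetD]\<close>)
  next
    fix A assume A: "finite A" "A \<subseteq> carrier G"
    show "0 \<le> log_cover_number E \<phi> \<U> A"
      using ln_of_nat_mono[of 1] pos[OF A] by (simp add: log_cover_number_def)
    have "\<U> \<noteq> {}" using U(2) False by auto
    then have c: "0 < card \<U>" using U(1) by (simp add: card_gt_0_iff)
    have "covering_number E (cover_join E \<phi> \<U> A) \<le> card \<U> ^ card A"
      using covering_number_le[OF order_refl finite_cover_join[OF U(1) A(1)] cover_join_covers[OF U(2) A(2)]]
        card_cover_join_le[OF U(1) A(1)] by (rule order_trans)
    then have "log_cover_number E \<phi> \<U> A \<le> ln (real (card \<U> ^ card A))"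
      unfolding log_cover_number_def by (rule ln_of_nat_mono[OF pos[OF A]])
    then show "log_cover_number E \<phi> \<U> A \<le> ln (real (card \<U>)) * real (card A)"
      using c by (simp add: ln_realpow mult.commute)
  qed
qed

end

text \<open>The defining description of the entropy denotes the limit: the limit exists by the Ornstein-Weiss lemma, and it is
unique because an amenable group has at least one Folner sequence.\<close>

lemma cover_entropy_tendsto:
  assumes "amenable G" "group_action G (topspace X) \<phi>" "finite \<U>" "topspace X \<subseteq> \<Union>\<U>" "folner_sequence G F"
  shows "(\<lambda>m. log_cover_number (topspace X) \<phi> \<U> (F m) / real (card (F m))) \<longlonglongrightarrow> cover_entropy G X \<phi> \<U>"
proof -
  let ?P = "\<lambda>h. \<forall>F. folner_sequence G F \<longrightarrow>
    (\<lambda>m. log_cover_number (topspace X) \<phi> \<U> (F m) / real (card (F m))) \<longlonglongrightarrow> h"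
  obtain h where h: "?P h" using group_action.cover_entropy_tendsto_aux[OF assms(2,1,3,4)] by blast
  have "cover_entropy G X \<phi> \<U> = h"
    unfolding cover_entropy_def log_cover_number_def[symmetric]
  proof (rule the_equality)
    show "?P h" by (rule h)
    fix h' assume "?P h'"
    then show "h' = h" using h assms(5) LIMSEQ_unique by blast
  qed
  then show ?thesis using h assms(5) by blast
qed

lemma amenable_folner: "amenable G \<Longrightarrow> (\<And>F. folner_sequence G F \<Longrightarrow> thesis) \<Longrightarrow> thesis"
  by (auto simp: amenable_def)

lemma cover_entropy_le_sum:
  assumes am: "amenable G" and act: "group_action G (topspace X) \<phi>"
    and P: "finite P" and W: "\<And>p. p \<in> P \<Longrightarrow> finite (\<W> p) \<and> topspace X \<subseteq> \<Union>(\<W> p)"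
    and U: "finite \<U>" "topspace X \<subseteq> \<Union>\<U>"
    and ref: "\<And>c. (\<And>p. p \<in> P \<Longrightarrow> c p \<in> \<W> p) \<Longrightarrow> \<exists>U\<in>\<U>. {x \<in> topspace X. \<forall>p\<in>P. x \<in> c p} \<subseteq> U"
  shows "cover_entropy G X \<phi> \<U> \<le> (\<Sum>p\<in>P. cover_entropy G X \<phi> (\<W> p))"
proof -
  obtain F where F: "folner_sequence G F" using amenable_folner[OF am] by blast
  have Fm: "finite (F m)" "F m \<subseteq> carrier G" for m using F by (auto simp: folner_sequence_def)
  let ?S = "topspace X"
  have "log_cover_number ?S \<phi> \<U> (F m) / real (card (F m))
      \<le> (\<Sum>p\<in>P. log_cover_number ?S \<phi> (\<W> p) (F m) / real (card (F m)))" for m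
  proof -
    have "log_cover_number ?S \<phi> \<U> (F m) \<le> (\<Sum>p\<in>P. log_cover_number ?S \<phi> (\<W> p) (F m))"
    proof (cases "?S = {}")
      case True
      then have "covering_number ?S (cover_join ?S \<phi> \<V> (F m)) = 0" for \<V>
        using covering_number_le[of "{}" "cover_join ?S \<phi> \<V> (F m)" ?S] by simp
      then show ?thesis by (simp add: log_cover_number_def)
    next
      case False
      have pos: "0 < covering_number ?S (cover_join ?S \<phi> (\<W> p) (F m))" if "p \<in> P" for p
      proof -
        have "finite (\<W> p)" "topspace X \<subseteq> \<Union>(\<W> p)" using W[OF that] by auto
        from group_action.covering_number_join_pos[OF act this Fm False] show ?thesis .
      qed
      have "log_cover_number ?S \<phi> \<U> (F m)
         \<le> ln (real (\<Prod>p\<in>P. covering_number ?S (cover_join ?S \<phi> (\<W> p) (F m))))"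
        unfolding log_cover_number_def
      proof (intro ln_of_nat_mono group_action.covering_number_join_pos[OF act U Fm False]
            group_action.covering_number_join_le_prod[OF act P _ Fm])
        show "finite (\<W> p) \<and> topspace X \<subseteq> \<Union>(\<W> p)" if "p \<in> P" for p using W[OF that] .
        show "\<exists>U\<in>\<U>. {x \<in> topspace X. \<forall>p\<in>P. x \<in> c p} \<subseteq> U" if "\<And>p. p \<in> P \<Longrightarrow> c p \<in> \<W> p" for c
          using that by (rule ref)
      qed
      also have "\<dots> = ln (\<Prod>p\<in>P. real (covering_number ?S (cover_join ?S \<phi> (\<W> p) (F m))))"
        by simp
      also have "\<dots> = (\<Sum>p\<in>P. log_cover_number ?S \<phi> (\<W> p) (F m))"
        unfolding log_cover_number_def using pos by (intro ln_prod P) force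
      finally show ?thesis .
    qed
    then show ?thesis by (simp add: divide_right_mono flip: sum_divide_distrib)
  qed
  moreover have "(\<lambda>m. \<Sum>p\<in>P. log_cover_number ?S \<phi> (\<W> p) (F m) / real (card (F m)))
      \<longlonglongrightarrow> (\<Sum>p\<in>P. cover_entropy G X \<phi> (\<W> p))"
    using W by (intro tendsto_sum cover_entropy_tendsto[OF am act _ _ F]) auto
  ultimately show ?thesis
    by (intro LIMSEQ_le[OF cover_entropy_tendsto[OF am act U F]]) auto
qed

lemma cover_entropy_factor_le:
  assumes am: "amenable G" and actX: "group_action G (topspace X) \<phi>" and actY: "group_action G (topspace Y) \<psi>"
    and U: "finite \<U>" "topspace Y \<subseteq> \<Union>\<U>"
    and surj: "\<rho> ` topspace X = topspace Y"
    and eqv: "\<And>g x. g \<in> carrier G \<Longrightarrow> x \<in> topspace X \<Longrightarrow> \<rho> (\<phi> g x) = \<psi> g (\<rho> x)"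
  shows "cover_entropy G Y \<psi> \<U> \<le> cover_entropy G X \<phi> ((\<lambda>U. {x \<in> topspace X. \<rho> x \<in> U}) ` \<U>)"
proof -
  let ?U = "(\<lambda>U. {x \<in> topspace X. \<rho> x \<in> U}) ` \<U>"
  have U': "finite ?U" "topspace X \<subseteq> \<Union>?U" using U surj by auto
  obtain F where F: "folner_sequence G F" using amenable_folner[OF am] by blast
  have Fm: "finite (F m)" "F m \<subseteq> carrier G" for m using F by (auto simp: folner_sequence_def)
  have "log_cover_number (topspace Y) \<psi> \<U> (F m) \<le> log_cover_number (topspace X) \<phi> ?U (F m)" for m
  proof (cases "topspace X = {}")
    case True
    then have "topspace Y = {}" using surj by simp
    then have "covering_number (topspace Y) (cover_join (topspace Y) \<psi> \<U> (F m)) = 0"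
      using covering_number_le[of "{}" "cover_join (topspace Y) \<psi> \<U> (F m)" "topspace Y"] by simp
    moreover have "covering_number (topspace X) (cover_join (topspace X) \<phi> ?U (F m)) = 0"
      using covering_number_le[of "{}" "cover_join (topspace X) \<phi> ?U (F m)" "topspace X"] True by simp
    ultimately show ?thesis by (simp add: log_cover_number_def)
  next
    case False
    then have ne: "topspace Y \<noteq> {}" using surj by auto
    define \<J> where "\<J> = cover_join (topspace X) \<phi> ?U (F m)"
    have "\<exists>\<V>\<subseteq>\<J>. finite \<V> \<and> topspace X \<subseteq> \<Union>\<V> \<and> card \<V> = covering_number (topspace X) \<J>"
      unfolding \<J>_def by (rule group_action.cover_join_attained[OF actX U' Fm])
    then obtain \<V> where V: "\<V> \<subseteq> \<J>" "finite \<V>" "topspace X \<subseteq> \<Union>\<V>"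
      "card \<V> = covering_number (topspace X) \<J>"
      by blast
    have "covering_number (topspace Y) (cover_join (topspace Y) \<psi> \<U> (F m)) \<le> card ((`) \<rho> ` \<V>)"
    proof (rule covering_number_refine)
      have "\<rho> ` topspace X \<subseteq> \<rho> ` \<Union>\<V>" using V(3) by (rule image_mono)
      then show "topspace Y \<subseteq> \<Union>((`) \<rho> ` \<V>)" unfolding surj image_Union .
      fix V' assume "V' \<in> (`) \<rho> ` \<V>"
      then obtain W where W: "W \<in> \<J>" "V' = \<rho> ` W" using V(1) by blast
      then obtain c where c: "c \<in> F m \<rightarrow> ?U" "V' = \<rho> ` {x \<in> topspace X. \<forall>g\<in>F m. \<phi> g x \<in> c g}"
        unfolding \<J>_def cover_join_def by blast
      have "\<forall>g\<in>F m. \<exists>U. U \<in> \<U> \<and> c g = {x \<in> topspace X. \<rho> x \<in> U}" using c(1) by auto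
      from bchoice[OF this]
      obtain d where d: "\<forall>g\<in>F m. d g \<in> \<U> \<and> c g = {x \<in> topspace X. \<rho> x \<in> d g}" ..
      have "topspace Y \<inter> V' \<subseteq> {y \<in> topspace Y. \<forall>g\<in>F m. \<psi> g y \<in> d g}"
      proof
        fix y assume "y \<in> topspace Y \<inter> V'"
        then obtain x where x: "x \<in> topspace X" "\<forall>g\<in>F m. \<phi> g x \<in> c g" "y = \<rho> x" "y \<in> topspace Y"
          unfolding c(2) by blast
        have "\<psi> g y \<in> d g" if "g \<in> F m" for g
        proof -
          have "\<phi> g x \<in> c g" using x(2) that by blast
          then have "\<rho> (\<phi> g x) \<in> d g" using d that by auto
          moreover have "g \<in> carrier G" using that Fm(2) by blast
          ultimately show ?thesis using eqv x(1,3) by simp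
        qed
        then show "y \<in> {y \<in> topspace Y. \<forall>g\<in>F m. \<psi> g y \<in> d g}" using x(4) by blast
      qed
      moreover have "d \<in> F m \<rightarrow> \<U>" using d by blast
      ultimately show "\<exists>U\<in>cover_join (topspace Y) \<psi> \<U> (F m). topspace Y \<inter> V' \<subseteq> U"
        unfolding cover_join_def by blast
    qed (use V in simp)
    also have "\<dots> \<le> card \<V>" using V by (intro card_image_le)
    finally show ?thesis
      unfolding log_cover_number_def V(4)[unfolded \<J>_def, symmetric]
      by (intro ln_of_nat_mono group_action.covering_number_join_pos[OF actY U Fm ne])
  qed
  then have "log_cover_number (topspace Y) \<psi> \<U> (F m) / real (card (F m))
      \<le> log_cover_number (topspace X) \<phi> ?U (F m) / real (card (F m))" for m
    by (simp add: divide_right_mono)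
  then show ?thesis
    by (intro LIMSEQ_le[OF cover_entropy_tendsto[OF am actY U F] cover_entropy_tendsto[OF am actX U' F]]) blast
qed

section \<open>Independence density\<close>

definition independence_set :: "'a set \<Rightarrow> ('g \<Rightarrow> 'a \<Rightarrow> 'a) \<Rightarrow> 'i set \<Rightarrow> ('i \<Rightarrow> 'a set) \<Rightarrow> 'g set \<Rightarrow> bool" where
  "independence_set S \<phi> I V J \<longleftrightarrow> (\<forall>\<omega>\<in>J \<rightarrow> I. \<exists>x\<in>S. \<forall>g\<in>J. \<phi> g x \<in> V (\<omega> g))"

text \<open>The bound is required for all finite sets and not only along a Folner sequence. This is what allows the sets \<open>J\<close> of
different systems to be nested.\<close>

definition positive_density ::
  "('g, 'm) monoid_scheme \<Rightarrow> 'a set \<Rightarrow> ('g \<Rightarrow> 'a \<Rightarrow> 'a) \<Rightarrow> 'i set \<Rightarrow> ('i \<Rightarrow> 'a set) \<Rightarrow> bool" where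
  "positive_density G S \<phi> I V \<longleftrightarrow>
     (\<exists>q>0. \<forall>E. E \<subseteq> carrier G \<and> finite E \<longrightarrow>
        (\<exists>J\<subseteq>E. q * real (card E) \<le> real (card J) \<and> independence_set S \<phi> I V J))"

lemma positive_densityE:
  assumes "positive_density G S \<phi> I V"
  obtains q where "0 < q"
    "\<forall>E. E \<subseteq> carrier G \<and> finite E \<longrightarrow>
       (\<exists>J\<subseteq>E. q * real (card E) \<le> real (card J) \<and> independence_set S \<phi> I V J)"
  using assms unfolding positive_density_def by blast

lemma independence_set_subset:
  assumes "independence_set S \<phi> I V J" "J' \<subseteq> J" "i \<in> I"
  shows "independence_set S \<phi> I V J'"
  unfolding independence_set_def
proof
  fix \<omega> assume \<omega>: "\<omega> \<in> J' \<rightarrow> I"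
  define \<omega>' where "\<omega>' g = (if g \<in> J' then \<omega> g else i)" for g
  have "\<omega>' \<in> J \<rightarrow> I" using \<omega> assms(3) by (auto simp: \<omega>'_def)
  then obtain x where x: "x \<in> S" "\<forall>g\<in>J. \<phi> g x \<in> V (\<omega>' g)"
    using assms(1) unfolding independence_set_def by blast
  have "\<phi> g x \<in> V (\<omega> g)" if "g \<in> J'" for g
    using bspec[OF x(2), of g] assms(2) that by (auto simp: \<omega>'_def)
  then show "\<exists>x\<in>S. \<forall>g\<in>J'. \<phi> g x \<in> V (\<omega> g)" using x(1) by blast
qed

text \<open>Sets may be enlarged, and indices may be repeated or dropped along \<open>r\<close>.\<close>

lemma positive_density_mono:
  assumes dens: "positive_density G S \<phi> I V"
    and r: "r \<in> K \<rightarrow> I" and sub: "\<And>k. k \<in> K \<Longrightarrow> V (r k) \<subseteq> W k"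
  shows "positive_density G S \<phi> K W"
proof -
  have "independence_set S \<phi> K W J" if J: "independence_set S \<phi> I V J" for J
    unfolding independence_set_def
  proof
    fix \<omega> assume \<omega>: "\<omega> \<in> J \<rightarrow> K"
    then have "(\<lambda>g. r (\<omega> g)) \<in> J \<rightarrow> I" using r by auto
    from bspec[OF J[unfolded independence_set_def] this]
    obtain x where x: "x \<in> S" "\<forall>g\<in>J. \<phi> g x \<in> V (r (\<omega> g))" by blast
    have "\<phi> g x \<in> W (\<omega> g)" if "g \<in> J" for g
      using x(2) sub[of "\<omega> g"] \<omega> that by auto
    then show "\<exists>x\<in>S. \<forall>g\<in>J. \<phi> g x \<in> W (\<omega> g)" using x(1) by blast
  qed
  then show ?thesis
    using dens unfolding positive_density_def by meson
qed

text \<open>Nest the independence sets: \<open>L \<subseteq> J \<subseteq> E\<close> with \<open>J\<close> independent for \<open>V\<close> and \<open>L\<close> independent for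
\<open>W\<close>. On \<open>L\<close> a pattern is realised by a point of \<open>X\<close> and by a point of \<open>Y\<close>, hence by their pair. The index \<open>i\<close>
serves to extend patterns from \<open>L\<close> to \<open>J\<close>.\<close>

lemma positive_density_Times:
  assumes 1: "positive_density G (topspace X) \<phi> I V"
    and 2: "positive_density G (topspace Y) \<psi> I W" and i: "i \<in> I"
  shows "positive_density G (topspace (prod_topology X Y)) (diagonal_action X \<phi> Y \<psi>) I (\<lambda>i. V i \<times> W i)"
proof -
  obtain p where p: "0 < p" "\<forall>E. E \<subseteq> carrier G \<and> finite E \<longrightarrow>
       (\<exists>J\<subseteq>E. p * real (card E) \<le> real (card J) \<and> independence_set (topspace X) \<phi> I V J)"
    by (rule positive_densityE[OF 1])
  obtain q where q: "0 < q" "\<forall>E. E \<subseteq> carrier G \<and> finite E \<longrightarrow>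
       (\<exists>J\<subseteq>E. q * real (card E) \<le> real (card J) \<and> independence_set (topspace Y) \<psi> I W J)"
    by (rule positive_densityE[OF 2])
  have "\<exists>L\<subseteq>E. q * p * real (card E) \<le> real (card L) \<and>
      independence_set (topspace (prod_topology X Y)) (diagonal_action X \<phi> Y \<psi>) I (\<lambda>i. V i \<times> W i) L"
    if E: "E \<subseteq> carrier G" "finite E" for E
  proof -
    obtain J where J: "J \<subseteq> E" "p * real (card E) \<le> real (card J)" "independence_set (topspace X) \<phi> I V J"
      using p(2) E by blast
    have "J \<subseteq> carrier G" "finite J" using J(1) E finite_subset by auto
    then obtain L where L: "L \<subseteq> J" "q * real (card J) \<le> real (card L)" "independence_set (topspace Y) \<psi> I W L"
      using q(2) by blast
    have "q * p * real (card E) \<le> real (card L)"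
    proof -
      have "q * (p * real (card E)) \<le> q * real (card J)"
        using J(2) q(1) by (intro mult_left_mono) auto
      then show ?thesis using L(2) by (simp only: mult.assoc)
    qed
    moreover have "independence_set (topspace (prod_topology X Y)) (diagonal_action X \<phi> Y \<psi>) I (\<lambda>i. V i \<times> W i) L"
      unfolding independence_set_def
    proof
      fix \<omega> assume \<omega>: "\<omega> \<in> L \<rightarrow> I"
      obtain y where y: "y \<in> topspace Y" "\<forall>g\<in>L. \<psi> g y \<in> W (\<omega> g)"
        using L(3) \<omega> unfolding independence_set_def by blast
      obtain x where x: "x \<in> topspace X" "\<forall>g\<in>L. \<phi> g x \<in> V (\<omega> g)"
        using independence_set_subset[OF J(3) L(1) i] \<omega> unfolding independence_set_def by blast
      show "\<exists>z\<in>topspace (prod_topology X Y). \<forall>g\<in>L. diagonal_action X \<phi> Y \<psi> g z \<in> V (\<omega> g) \<times> W (\<omega> g)"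
        using x y by (intro bexI[of _ "(x, y)"]) (auto simp: diagonal_action_def)
    qed
    ultimately show ?thesis using L(1) J(1) by blast
  qed
  moreover have "0 < q * p" using p q by simp
  ultimately show ?thesis unfolding positive_density_def by blast
qed

context group
begin

text \<open>About \<open>|D|\<close> translates of \<open>E\<close> meet \<open>D\<close>, since \<open>D\<close> is almost invariant under \<open>E\<close>, and every point of \<open>W\<close>
lies in \<open>|E|\<close> of them. So on average a translate meets \<open>W\<close> in a fixed proportion of its points.\<close>

lemma exists_dense_translate:
  assumes E: "E \<subseteq> carrier G" "finite E" "E \<noteq> {}" and D: "almost_invariant G E 1 D"
    and W: "W \<subseteq> D" "q * real (card D) \<le> real (card W)" and q: "0 < q"
  shows "\<exists>s\<in>carrier G. q / 2 * real (card E) \<le> real (card {e \<in> E. e \<otimes> s \<in> W})"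
proof (rule ccontr)
  assume "\<not> (\<exists>s\<in>carrier G. q / 2 * real (card E) \<le> real (card {e \<in> E. e \<otimes> s \<in> W}))"
  then have less: "real (card {e \<in> E. e \<otimes> s \<in> W}) < q / 2 * real (card E)" if "s \<in> carrier G" for s
    using that by (simp add: not_le)
  have D': "D \<subseteq> carrier G" "finite D" "D \<noteq> {}" using D by (auto simp: almost_invariant_def)
  define I where "I = {c \<in> carrier G. E #> c \<subseteq> D}"
  note I = card_translates_inside[OF E D'(1,2), folded I_def]
  define T where "T = I \<union> folner_boundary G E D"
  have finT: "finite T" using I(1) finite_folner_boundary[OF E(1,2) D'(2)] by (simp add: T_def)
  have TG: "T \<subseteq> carrier G" by (auto simp: T_def I_def folner_boundary_def)
  have "real (card T) \<le> real (card I) + real (card (folner_boundary G E D))"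
    using card_Un_le[of I "folner_boundary G E D"] by (simp add: T_def)
  then have cardT: "real (card T) < 2 * real (card D)"
    using D I(2) by (simp add: almost_invariant_def)
  have meet: "{c \<in> carrier G. (E #> c) \<inter> W \<noteq> {}} \<subseteq> T"
  proof
    fix c assume "c \<in> {c \<in> carrier G. (E #> c) \<inter> W \<noteq> {}}"
    then obtain e where c: "c \<in> carrier G" "e \<in> E" "e \<otimes> c \<in> D" using W(1) by (auto simp: r_coset_def)
    show "c \<in> T"
    proof (cases "\<exists>k\<in>E. k \<otimes> c \<notin> D")
      case True
      then show ?thesis using c unfolding T_def folner_boundary_def by blast
    next
      case False
      then have "E #> c \<subseteq> D" by (auto simp: r_coset_def)
      then show ?thesis using c(1) by (simp add: T_def I_def)
    qed
  qed
  have W': "W \<subseteq> carrier G" "finite W" using W(1) D' finite_subset by auto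
  have Epos: "0 < real (card E)" using E by (simp add: card_gt_0_iff)
  have "real (card E * card W) = (\<Sum>c\<in>T. real (card ((E #> c) \<inter> W)))"
    by (simp add: sum_card_translates_eq[OF E(1) W' finT meet TG, symmetric])
  also have "\<dots> \<le> (\<Sum>c\<in>T. q / 2 * real (card E))"
  proof (intro sum_mono)
    fix c assume "c \<in> T"
    have "(E #> c) \<inter> W = (\<lambda>e. e \<otimes> c) ` {e \<in> E. e \<otimes> c \<in> W}" by (auto simp: r_coset_def)
    then have "card ((E #> c) \<inter> W) \<le> card {e \<in> E. e \<otimes> c \<in> W}"
      using E(2) by (simp add: card_image_le)
    moreover have "c \<in> carrier G" using \<open>c \<in> T\<close> TG by blast
    ultimately show "real (card ((E #> c) \<inter> W)) \<le> q / 2 * real (card E)"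
      using less[of c] by linarith
  qed
  also have "\<dots> = real (card T) * (q / 2 * real (card E))" by simp
  also have "\<dots> < 2 * real (card D) * (q / 2 * real (card E))"
    using cardT q Epos by (intro mult_strict_right_mono) auto
  also have "\<dots> = real (card E) * (q * real (card D))" by simp
  also have "\<dots> \<le> real (card E) * real (card W)" using W(2) by (intro mult_left_mono) auto
  finally show False by simp
qed

end

lemma independence_set_translate:
  assumes act: "group_action G S \<phi>" and W: "independence_set S \<phi> I V W" and i: "i \<in> I"
    and E: "E \<subseteq> carrier G" and s: "s \<in> carrier G"
  shows "independence_set S \<phi> I V {e \<in> E. e \<otimes>\<^bsub>G\<^esub> s \<in> W}"
  unfolding independence_set_def
proof
  interpret group_action G S \<phi> by (rule act)
  interpret group G by (rule group_G)
  let ?J = "{e \<in> E. e \<otimes>\<^bsub>G\<^esub> s \<in> W}"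
  fix \<omega> assume \<omega>: "\<omega> \<in> ?J \<rightarrow> I"
  define \<omega>' where "\<omega>' w = (if w \<otimes>\<^bsub>G\<^esub> inv\<^bsub>G\<^esub> s \<in> ?J then \<omega> (w \<otimes>\<^bsub>G\<^esub> inv\<^bsub>G\<^esub> s) else i)" for w
  have "\<omega>' \<in> W \<rightarrow> I" using \<omega> i by (auto simp: \<omega>'_def)
  then obtain x where x: "x \<in> S" "\<forall>w\<in>W. \<phi> w x \<in> V (\<omega>' w)"
    using W unfolding independence_set_def by blast
  have "\<phi> e (\<phi> s x) \<in> V (\<omega> e)" if e: "e \<in> ?J" for e
  proof -
    have eG: "e \<in> carrier G" using e E by auto
    then have "(e \<otimes>\<^bsub>G\<^esub> s) \<otimes>\<^bsub>G\<^esub> inv\<^bsub>G\<^esub> s = e" using s by (simp add: m_assoc)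
    then have "\<omega>' (e \<otimes>\<^bsub>G\<^esub> s) = \<omega> e" using e by (simp add: \<omega>'_def)
    moreover have "\<phi> (e \<otimes>\<^bsub>G\<^esub> s) x \<in> V (\<omega>' (e \<otimes>\<^bsub>G\<^esub> s))" using x(2) e by simp
    ultimately show ?thesis using composition_rule[OF x(1) eG s] by simp
  qed
  then show "\<exists>y\<in>S. \<forall>e\<in>?J. \<phi> e y \<in> V (\<omega> e)" using action_closed[OF s x(1)] by blast
qed

text \<open>Along a Folner sequence the covering numbers grow exponentially, so a fixed proportion of a Folner set is shattered,
that is, independent. Averaging moves a proportional part of this set into a translate of a given finite set \<open>E\<close>, and
independence is invariant under translation.\<close>

lemma positive_density_if_positive_entropy:
  fixes G :: "('g, 'm) monoid_scheme" and X :: "'a topology" and I :: "'i set"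
  assumes am: "amenable G" and act: "group_action G (topspace X) \<phi>"
    and I: "2 \<le> card I" and disj: "\<And>i j. \<lbrakk>i \<in> I; j \<in> I; i \<noteq> j\<rbrakk> \<Longrightarrow> V i \<inter> V j = {}"
    and pos: "0 < cover_entropy G X \<phi> ((\<lambda>i. topspace X - V i) ` I)"
  shows "positive_density G (topspace X) \<phi> I V"
proof -
  interpret group_action G "topspace X" \<phi> by (rule act)
  interpret group G by (rule group_G)
  let ?S = "topspace X"
  define \<U> where "\<U> = (\<lambda>i. ?S - V i) ` I"
  define b where "b = cover_entropy G X \<phi> \<U> / 2"
  have b: "0 < b" using pos by (simp add: b_def \<U>_def)
  have finI: "finite I" using I by (simp add: card_ge_0_finite)
  obtain i j where ij: "i \<in> I" "j \<in> I" "i \<noteq> j"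
    using I card_le_Suc0_iff_eq[OF finI] by auto
  have finU: "finite \<U>" using finI by (simp add: \<U>_def)
  have cov: "?S \<subseteq> \<Union>\<U>"
  proof
    fix x assume x: "x \<in> ?S"
    have "x \<in> ?S - V i \<or> x \<in> ?S - V j" using x disj[OF ij] by blast
    then show "x \<in> \<Union>\<U>" using ij unfolding \<U>_def by blast
  qed
  obtain F where F: "folner_sequence G F" using amenable_folner[OF am] by blast
  have Fm: "F m \<subseteq> carrier G" "finite (F m)" "F m \<noteq> {}" for m using F by (auto simp: folner_sequence_def)
  define A where "A g i = {x. \<phi> g x \<in> V i}" for g i
  have Adisj: "A z i \<inter> A z j = {}" if "i \<in> I" "j \<in> I" "i \<noteq> j" for z i j
    using disj[OF that] by (auto simp: A_def)
  obtain q where q: "0 < q" and q': "\<forall>Z (A :: 'g \<Rightarrow> 'i \<Rightarrow> 'a set) J T.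
      finite Z \<and> card J = card I \<and> (\<forall>z\<in>Z. \<forall>i\<in>J. \<forall>j\<in>J. i \<noteq> j \<longrightarrow> A z i \<inter> A z j = {}) \<and>
      exp (b * real (card Z)) \<le> real (covering_number T (avoidance_cover A J Z)) \<longrightarrow>
      (\<exists>W\<subseteq>Z. shatters A J T W \<and> q * real (card Z) \<le> real (card W))"
    using large_shattered_set[OF I b] by (elim exE conjE)
  have dense: "\<exists>W\<subseteq>F m. q * real (card (F m)) \<le> real (card W) \<and> independence_set ?S \<phi> I V W"
    if m: "b < log_cover_number ?S \<phi> \<U> (F m) / real (card (F m))" for m
  proof -
    define N where "N = covering_number ?S (cover_join ?S \<phi> \<U> (F m))"
    have cpos: "0 < real (card (F m))" using Fm by (simp add: card_gt_0_iff)
    have lnN: "b * real (card (F m)) < ln (real N)"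
      using m cpos by (simp add: log_cover_number_def N_def pos_less_divide_eq)
    moreover have "0 < b * real (card (F m))" using b cpos by simp
    ultimately have "0 < ln (real N)" by linarith
    then have "N \<noteq> 0" by (intro notI) simp
    have "exp (b * real (card (F m))) \<le> exp (ln (real N))"
      using lnN by (simp only: exp_le_cancel_iff)
    also have "\<dots> = real N" using \<open>N \<noteq> 0\<close> by simp
    also have "N \<le> covering_number ?S (avoidance_cover A I (F m))"
    proof -
      note c = avoidance_cover_covers[of "F m" I A, OF Fm(2) Adisj ij finI]
      have "\<exists>\<V>\<subseteq>avoidance_cover A I (F m). finite \<V> \<and> ?S \<subseteq> \<Union>\<V> \<and>
          card \<V> = covering_number ?S (avoidance_cover A I (F m))"
        by (rule covering_number_attained[OF order_refl c(1)]) (simp_all add: c(2))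
      then obtain \<V> where \<V>: "\<V> \<subseteq> avoidance_cover A I (F m)" "finite \<V>" "?S \<subseteq> \<Union>\<V>"
          "card \<V> = covering_number ?S (avoidance_cover A I (F m))" by blast
      have "N \<le> card \<V>"
        unfolding N_def
      proof (rule covering_number_refine[OF \<V>(2,3)])
        fix B assume "B \<in> \<V>"
        then have "B \<in> avoidance_cover A I (F m)" using \<V>(1) by blast
        then obtain c where c: "B = {x. \<forall>z\<in>F m. x \<notin> A z (c z)}" "c \<in> F m \<rightarrow> I"
          unfolding avoidance_cover_def by blast
        have "?S \<inter> B \<subseteq> {x \<in> ?S. \<forall>g\<in>F m. \<phi> g x \<in> ?S - V (c g)}"
          using c(1) action_closed Fm(1)[of m] by (auto simp: A_def)
        moreover have "(\<lambda>g. ?S - V (c g)) \<in> F m \<rightarrow> \<U>" using c(2) by (auto simp: \<U>_def)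
        then have "{x \<in> ?S. \<forall>g\<in>F m. \<phi> g x \<in> ?S - V (c g)} \<in> cover_join ?S \<phi> \<U> (F m)"
          unfolding cover_join_def by (intro CollectI exI[of _ "\<lambda>g. ?S - V (c g)"] conjI refl)
        ultimately show "\<exists>U\<in>cover_join ?S \<phi> \<U> (F m). ?S \<inter> B \<subseteq> U" by (rule bexI)
      qed
      then show ?thesis using \<V>(4) by simp
    qed
    finally have "exp (b * real (card (F m))) \<le> real (covering_number ?S (avoidance_cover A I (F m)))"
      by simp
    then have "finite (F m) \<and> card I = card I \<and>
        (\<forall>z\<in>F m. \<forall>i\<in>I. \<forall>j\<in>I. i \<noteq> j \<longrightarrow> A z i \<inter> A z j = {}) \<and>
        exp (b * real (card (F m))) \<le> real (covering_number ?S (avoidance_cover A I (F m)))"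
      using Fm(2) Adisj by simp
    from q'[rule_format, OF this]
    obtain W where "W \<subseteq> F m" "shatters A I ?S W" "q * real (card (F m)) \<le> real (card W)" by blast
    moreover from this(2) have "independence_set ?S \<phi> I V W"
      by (simp add: shatters_def independence_set_def A_def)
    ultimately show ?thesis by blast
  qed
  have ev: "\<forall>\<^sub>F m in sequentially. b < log_cover_number ?S \<phi> \<U> (F m) / real (card (F m))"
    by (rule order_tendstoD(1)[OF cover_entropy_tendsto[OF am act finU cov F]]) (use b in \<open>simp add: b_def\<close>)
  have "\<exists>J\<subseteq>E. q / 2 * real (card E) \<le> real (card J) \<and> independence_set ?S \<phi> I V J"
    if E: "E \<subseteq> carrier G" "finite E" for E
  proof (cases "E = {}")
    case True
    obtain m where "b < log_cover_number ?S \<phi> \<U> (F m) / real (card (F m))"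
      using ev by (auto simp: eventually_sequentially)
    then obtain W where "independence_set ?S \<phi> I V W" using dense by blast
    then have "independence_set ?S \<phi> I V {}" by (rule independence_set_subset[OF _ empty_subsetI ij(1)])
    then show ?thesis using True by auto
  next
    case False
    have "\<forall>\<^sub>F m in sequentially. almost_invariant G E 1 (F m)"
      using F E False unfolding folner_sequence_alt by simp
    then have "\<forall>\<^sub>F m in sequentially. almost_invariant G E 1 (F m) \<and>
        b < log_cover_number ?S \<phi> \<U> (F m) / real (card (F m))"
      using ev by (rule eventually_conj)
    then obtain m where m: "almost_invariant G E 1 (F m)"
        "b < log_cover_number ?S \<phi> \<U> (F m) / real (card (F m))"
      by (auto simp: eventually_sequentially)
    obtain W where W: "W \<subseteq> F m" "q * real (card (F m)) \<le> real (card W)" "independence_set ?S \<phi> I V W"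
      using dense[OF m(2)] by blast
    obtain s where s: "s \<in> carrier G" "q / 2 * real (card E) \<le> real (card {e \<in> E. e \<otimes>\<^bsub>G\<^esub> s \<in> W})"
      using exists_dense_translate[OF E False m(1) W(1,2) q] by blast
    have "independence_set ?S \<phi> I V {e \<in> E. e \<otimes>\<^bsub>G\<^esub> s \<in> W}"
      by (rule independence_set_translate[OF act W(3) ij(1) E(1) s(1)])
    then show ?thesis using s(2) by (intro exI[of _ "{e \<in> E. e \<otimes>\<^bsub>G\<^esub> s \<in> W}"]) auto
  qed
  moreover have "0 < q / 2" using q by simp
  ultimately show ?thesis unfolding positive_density_def by blast
qed

text \<open>A member of the join selects a label \<open>d g\<close> for every \<open>g\<close>, and it contains no point whose pattern agrees with \<open>d\<close>
somewhere on \<open>J\<close>. So it accounts for at most \<open>(k - 1) ^ |J|\<close> of the \<open>k ^ |J|\<close> patterns on an independent set \<open>J\<close>.\<close>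

lemma positive_entropy_if_positive_density:
  assumes am: "amenable G" and act: "group_action G (topspace X) \<phi>"
    and I: "2 \<le> card I" and disj: "\<And>i. i \<in> I \<Longrightarrow> U i \<inter> V i = {}"
    and cov: "topspace X \<subseteq> \<Union>(U ` I)"
    and dens: "positive_density G (topspace X) \<phi> I V"
  shows "0 < cover_entropy G X \<phi> (U ` I)"
proof -
  interpret group_action G "topspace X" \<phi> by (rule act)
  let ?S = "topspace X"
  define k where "k = card I"
  have finI: "finite I" using I by (simp add: card_ge_0_finite)
  have finU: "finite (U ` I)" using finI by simp
  obtain q where q: "0 < q" "\<forall>E. E \<subseteq> carrier G \<and> finite E \<longrightarrow>
       (\<exists>J\<subseteq>E. q * real (card E) \<le> real (card J) \<and> independence_set ?S \<phi> I V J)"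
    by (rule positive_densityE[OF dens])
  define r where "r = real k / (real k - 1)"
  have r: "1 < r" using I by (simp add: r_def k_def)
  have key: "q * ln r * real (card E) \<le> log_cover_number ?S \<phi> (U ` I) E"
    if E: "E \<subseteq> carrier G" "finite E" for E
  proof -
    obtain J where J: "J \<subseteq> E" "q * real (card E) \<le> real (card J)" "independence_set ?S \<phi> I V J"
      using q(2) E by blast
    have finJ: "finite J" using J(1) E(2) finite_subset by auto
    obtain \<V> where \<V>: "\<V> \<subseteq> cover_join ?S \<phi> (U ` I) E" "finite \<V>" "?S \<subseteq> \<Union>\<V>"
      "card \<V> = covering_number ?S (cover_join ?S \<phi> (U ` I) E)"
      using cover_join_attained[OF finU cov E(2,1)] by blast
    have "\<exists>d. d \<in> E \<rightarrow> I \<and> (\<forall>x\<in>B. \<forall>g\<in>E. \<phi> g x \<in> U (d g))" if B: "B \<in> \<V>" for B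
    proof -
      have "B \<in> cover_join ?S \<phi> (U ` I) E" using B \<V>(1) by blast
      then obtain c where c: "c \<in> E \<rightarrow> U ` I" "B = {x \<in> ?S. \<forall>g\<in>E. \<phi> g x \<in> c g}"
        unfolding cover_join_def by blast
      have "\<forall>g\<in>E. \<exists>i. i \<in> I \<and> c g = U i" using c(1) by auto
      from bchoice[OF this] obtain d where "\<forall>g\<in>E. d g \<in> I \<and> c g = U (d g)" ..
      then show ?thesis using c(2) by (intro exI[of _ d]) auto
    qed
    then have "\<forall>B\<in>\<V>. \<exists>d. d \<in> E \<rightarrow> I \<and> (\<forall>x\<in>B. \<forall>g\<in>E. \<phi> g x \<in> U (d g))" by blast
    from bchoice[OF this]
    obtain d where d: "\<forall>B\<in>\<V>. d B \<in> E \<rightarrow> I \<and> (\<forall>x\<in>B. \<forall>g\<in>E. \<phi> g x \<in> U (d B g))" ..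
    have "(J \<rightarrow>\<^sub>E I) \<subseteq> (\<Union>B\<in>\<V>. PiE J (\<lambda>g. I - {d B g}))"
    proof
      fix \<omega> assume \<omega>: "\<omega> \<in> J \<rightarrow>\<^sub>E I"
      then have "\<omega> \<in> J \<rightarrow> I" by (auto simp: PiE_def)
      then obtain x where x: "x \<in> ?S" "\<forall>g\<in>J. \<phi> g x \<in> V (\<omega> g)"
        using J(3) unfolding independence_set_def by blast
      obtain B where B: "B \<in> \<V>" "x \<in> B" using x(1) \<V>(3) by blast
      have "\<omega> g \<noteq> d B g" if g: "g \<in> J" for g
      proof
        assume eq: "\<omega> g = d B g"
        have "\<phi> g x \<in> U (d B g)" using d B g J(1) by blast
        moreover have "\<phi> g x \<in> V (d B g)" using x(2) g eq by auto
        moreover have "d B g \<in> I" using PiE_mem[OF \<omega> g] eq by simp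
        ultimately show False using disj by blast
      qed
      then have "\<omega> \<in> PiE J (\<lambda>g. I - {d B g})" using \<omega> by (auto simp: PiE_iff)
      then show "\<omega> \<in> (\<Union>B\<in>\<V>. PiE J (\<lambda>g. I - {d B g}))" using B(1) by blast
    qed
    then have "card (J \<rightarrow>\<^sub>E I) \<le> card (\<Union>B\<in>\<V>. PiE J (\<lambda>g. I - {d B g}))"
      using \<V>(2) finJ finI by (intro card_mono finite_UN_I finite_PiE) auto
    also have "\<dots> \<le> (\<Sum>B\<in>\<V>. card (PiE J (\<lambda>g. I - {d B g})))"
      using \<V>(2) by (rule card_UN_le)
    also have "\<dots> = (\<Sum>B\<in>\<V>. (k - 1) ^ card J)"
    proof (intro sum.cong refl)
      fix B assume B: "B \<in> \<V>"
      have "card (I - {d B g}) = k - 1" if "g \<in> J" for g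
      proof -
        have "d B \<in> E \<rightarrow> I" using d B by blast
        then have "d B g \<in> I" using that J(1) by (auto dest: Pi_mem)
        then show ?thesis by (simp add: k_def)
      qed
      then show "card (PiE J (\<lambda>g. I - {d B g})) = (k - 1) ^ card J"
        using finJ by (simp add: card_PiE)
    qed
    finally have "k ^ card J \<le> card \<V> * (k - 1) ^ card J"
      using finJ by (simp add: card_PiE k_def)
    then have "real (k ^ card J) \<le> real (card \<V> * (k - 1) ^ card J)" by (simp only: of_nat_le_iff)
    then have "real k ^ card J \<le> real (card \<V>) * (real k - 1) ^ card J"
      using I by (simp add: k_def of_nat_diff)
    moreover have "0 < (real k - 1) ^ card J" using I by (simp add: k_def)
    ultimately have le: "r ^ card J \<le> real (card \<V>)"
      by (simp add: r_def power_divide pos_divide_le_eq)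
    have "q * ln r * real (card E) = ln r * (q * real (card E))" by simp
    also have "\<dots> \<le> ln r * real (card J)" using J(2) r by (intro mult_left_mono) auto
    also have "\<dots> = ln (r ^ card J)" using r by (simp add: ln_realpow mult.commute)
    also have "\<dots> \<le> ln (real (card \<V>))"
    proof -
      have "0 < r ^ card J" using r by simp
      then show ?thesis using le by simp
    qed
    finally show ?thesis by (simp add: log_cover_number_def \<V>(4))
  qed
  obtain F where F: "folner_sequence G F" using amenable_folner[OF am] by blast
  have "q * ln r \<le> log_cover_number ?S \<phi> (U ` I) (F m) / real (card (F m))" for m
  proof -
    have "F m \<subseteq> carrier G" "finite (F m)" "0 < real (card (F m))"
      using F by (auto simp: folner_sequence_def card_gt_0_iff)
    then show ?thesis using key[of "F m"] by (simp add: pos_le_divide_eq)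
  qed
  then have "q * ln r \<le> cover_entropy G X \<phi> (U ` I)"
    by (intro LIMSEQ_le_const[OF cover_entropy_tendsto[OF am act finU cov F]]) auto
  moreover have "0 < q * ln r" using q r by simp
  ultimately show ?thesis by linarith
qed

section \<open>Uniform positive entropy and topological K\<close>

lemma G_systemD:
  assumes "G_system G X \<phi>"
  shows "compact_space X" "metrizable_space X" "group_action G (topspace X) \<phi>" "Hausdorff_space X" "regular_space X"
  using assms by (auto simp: G_system_def metrizable_imp_Hausdorff_space metrizable_imp_regular_space)

lemma group_actionI:
  assumes G: "group G"
    and ext: "\<And>g. g \<in> carrier G \<Longrightarrow> \<phi> g \<in> extensional S"
    and cl: "\<And>g x. \<lbrakk>g \<in> carrier G; x \<in> S\<rbrakk> \<Longrightarrow> \<phi> g x \<in> S"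
    and mult: "\<And>g h x. \<lbrakk>g \<in> carrier G; h \<in> carrier G; x \<in> S\<rbrakk> \<Longrightarrow> \<phi> (g \<otimes>\<^bsub>G\<^esub> h) x = \<phi> g (\<phi> h x)"
    and one: "\<And>x. x \<in> S \<Longrightarrow> \<phi> \<one>\<^bsub>G\<^esub> x = x"
  shows "group_action G S \<phi>"
proof -
  interpret group G by (rule G)
  have bij: "\<phi> g \<in> carrier (BijGroup S)" if g: "g \<in> carrier G" for g
  proof -
    have "bij_betw (\<phi> g) S S"
    proof (rule bij_betw_byWitness[where f' = "\<phi> (inv\<^bsub>G\<^esub> g)"])
      show "\<forall>x\<in>S. \<phi> (inv\<^bsub>G\<^esub> g) (\<phi> g x) = x" "\<forall>x\<in>S. \<phi> g (\<phi> (inv\<^bsub>G\<^esub> g) x) = x"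
        using mult[of "inv\<^bsub>G\<^esub> g" g] mult[of g "inv\<^bsub>G\<^esub> g"] one g by auto
    qed (use cl g in auto)
    then show ?thesis using ext[OF g] by (simp add: BijGroup_def Bij_def)
  qed
  show ?thesis
    unfolding group_action_def group_hom_def group_hom_axioms_def
  proof (intro conjI G group_BijGroup homI bij)
    fix g h assume gh: "g \<in> carrier G" "h \<in> carrier G"
    have "\<phi> (g \<otimes>\<^bsub>G\<^esub> h) = compose S (\<phi> g) (\<phi> h)"
    proof (rule extensionalityI[where A = S])
      show "\<phi> (g \<otimes>\<^bsub>G\<^esub> h) \<in> extensional S" using ext gh by simp
    qed (use mult[OF gh] in \<open>auto simp: compose_def\<close>)
    then show "\<phi> (g \<otimes>\<^bsub>G\<^esub> h) = \<phi> g \<otimes>\<^bsub>BijGroup S\<^esub> \<phi> h"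
      using bij gh by (simp add: BijGroup_def)
  qed
qed

lemma group_action_one:
  assumes "group_action G S \<phi>" "x \<in> S"
  shows "\<phi> \<one>\<^bsub>G\<^esub> x = x"
  using group_action.id_eq_one[OF assms(1)] assms(2) by (metis restrict_apply')

lemma group_action_diagonal:
  assumes X: "group_action G (topspace X) \<phi>" and Y: "group_action G (topspace Y) \<psi>"
  shows "group_action G (topspace (prod_topology X Y)) (diagonal_action X \<phi> Y \<psi>)"
proof (rule group_actionI)
  interpret X: group_action G "topspace X" \<phi> by (rule X)
  interpret Y: group_action G "topspace Y" \<psi> by (rule Y)
  interpret group G by (rule X.group_G)
  show "group G" by (rule X.group_G)
  show "diagonal_action X \<phi> Y \<psi> g \<in> extensional (topspace (prod_topology X Y))" for g
    by (simp add: diagonal_action_def)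
  fix z assume z: "z \<in> topspace (prod_topology X Y)"
  then obtain x y where xy: "z = (x, y)" "x \<in> topspace X" "y \<in> topspace Y" by auto
  show "diagonal_action X \<phi> Y \<psi> \<one>\<^bsub>G\<^esub> z = z"
    using xy group_action_one[OF X] group_action_one[OF Y] by (simp add: diagonal_action_def)
  fix g assume g: "g \<in> carrier G"
  show "diagonal_action X \<phi> Y \<psi> g z \<in> topspace (prod_topology X Y)"
    using xy g X.action_closed Y.action_closed by (simp add: diagonal_action_def)
  fix h assume h: "h \<in> carrier G"
  then show "diagonal_action X \<phi> Y \<psi> (g \<otimes>\<^bsub>G\<^esub> h) z = diagonal_action X \<phi> Y \<psi> g (diagonal_action X \<phi> Y \<psi> h z)"
    using xy g X.action_closed Y.action_closed X.composition_rule[OF xy(2) g h] Y.composition_rule[OF xy(3) g h]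
    by (simp add: diagonal_action_def)
qed

lemma regular_space_closed_nbhd:
  assumes reg: "regular_space X" and O: "openin X O'" "x \<in> O'"
  obtains U where "openin X U" "x \<in> U" "X closure_of U \<subseteq> O'"
proof -
  have "closedin X (topspace X - O')" "x \<in> topspace X - (topspace X - O')"
    using O openin_subset by auto
  then obtain U where U: "openin X U" "x \<in> U" "disjnt (topspace X - O') (X closure_of U)"
    using reg unfolding regular_space by blast
  then have "X closure_of U \<subseteq> O'"
    using closure_of_subset_topspace[of X U] by (auto simp: disjnt_iff)
  then show ?thesis using that U by blast
qed

text \<open>Shrink to disjoint closed neighbourhoods \<open>V y\<close> of the distinct values \<open>y\<close> of \<open>p\<close>. There are at least two of them,
so their complements form a cover by non-dense open sets, indexed by \<open>{..<n}\<close> with repetitions. Its entropy is positive by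
hypothesis, and this gives positive density for the disjoint sets.\<close>

lemma positive_density_nonconstant:
  assumes G: "amenable G" "G_system G X \<phi>" and upe: "has_upe n G X \<phi>"
    and p: "\<And>i. i < n \<Longrightarrow> openin X (A i) \<and> p i \<in> A i" and ne: "j < n" "k < n" "p j \<noteq> p k"
  shows "positive_density G (topspace X) \<phi> {..<n} A"
proof -
  note sys = G_systemD[OF G(2)]
  define P where "P = p ` {..<n}"
  have finP: "finite P" by (simp add: P_def)
  have PX: "y \<in> topspace X" if y: "y \<in> P" for y
  proof -
    obtain i where "i < n" "y = p i" using y by (auto simp: P_def)
    then show ?thesis using p[of i] openin_subset by blast
  qed
  have "\<exists>UV. y \<in> P \<and> z \<in> P \<and> y \<noteq> z \<longrightarrow> openin X (fst UV) \<and> openin X (snd UV) \<and>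
      y \<in> fst UV \<and> z \<in> snd UV \<and> disjnt (fst UV) (snd UV)" for y z
  proof (cases "y \<in> P \<and> z \<in> P \<and> y \<noteq> z")
    case True
    then have "y \<in> topspace X \<and> z \<in> topspace X \<and> y \<noteq> z" using PX by simp
    from sys(4)[unfolded Hausdorff_space_def, rule_format, OF this]
    obtain U V where "openin X U" "openin X V" "y \<in> U" "z \<in> V" "disjnt U V" by blast
    then show ?thesis by (intro exI[of _ "(U, V)"]) simp
  qed auto
  then have "\<forall>q. \<exists>UV. fst q \<in> P \<and> snd q \<in> P \<and> fst q \<noteq> snd q \<longrightarrow> openin X (fst UV) \<and> openin X (snd UV) \<and>
      fst q \<in> fst UV \<and> snd q \<in> snd UV \<and> disjnt (fst UV) (snd UV)" by blast
  from choice[OF this] obtain D where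
    D: "\<forall>q. fst q \<in> P \<and> snd q \<in> P \<and> fst q \<noteq> snd q \<longrightarrow> openin X (fst (D q)) \<and> openin X (snd (D q)) \<and>
      fst q \<in> fst (D q) \<and> snd q \<in> snd (D q) \<and> disjnt (fst (D q)) (snd (D q))" ..
  define L where "L y z = fst (D (y, z))" for y z
  define R where "R y z = snd (D (y, z))" for y z
  have LR: "openin X (L y z) \<and> openin X (R y z) \<and> y \<in> L y z \<and> z \<in> R y z \<and> disjnt (L y z) (R y z)"
    if "y \<in> P" "z \<in> P" "y \<noteq> z" for y z
    using D[THEN spec, of "(y, z)"] that by (simp add: L_def R_def)
  \<comment> \<open>The pair \<open>(L y z, R y z)\<close> separates \<open>y\<close> from \<open>z\<close>; using both \<open>L y z\<close> and \<open>R z y\<close> makes \<open>N y\<close>, \<open>N z\<close> disjoint.\<close>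
  define N where "N y = topspace X \<inter> (\<Inter>z\<in>P - {y}. L y z \<inter> R z y) \<inter> (\<Inter>i\<in>{i. i < n \<and> p i = y}. A i)" for y
  have N: "openin X (N y) \<and> y \<in> N y" if y: "y \<in> P" for y
  proof
    have "openin X (L y z \<inter> R z y)" if "z \<in> P - {y}" for z
      using LR[of y z] LR[of z y] y that by auto
    then have "openin X (topspace X \<inter> (\<Inter>z\<in>P - {y}. L y z \<inter> R z y))"
      using finP by (intro openin_Int_Inter) auto
    from openin_Int_Inter[OF _ this, of "A ` {i. i < n \<and> p i = y}"]
    show "openin X (N y)" unfolding N_def using p by fastforce
    show "y \<in> N y"
      using LR[of y] LR[of _ y] y PX[OF y] p by (auto simp: N_def)
  qed
  have Ndisj: "N y \<inter> N z = {}" if "y \<in> P" "z \<in> P" "y \<noteq> z" for y z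
  proof -
    have "N y \<subseteq> L y z" "N z \<subseteq> R y z" using that by (auto simp: N_def)
    then show ?thesis using LR[OF that] by (auto simp: disjnt_iff)
  qed
  have "\<exists>W. openin X W \<and> y \<in> W \<and> X closure_of W \<subseteq> N y" if "y \<in> P" for y
  proof -
    have "openin X (N y)" "y \<in> N y" using N[OF that] by auto
    then obtain W where "openin X W" "y \<in> W" "X closure_of W \<subseteq> N y"
      by (rule regular_space_closed_nbhd[OF sys(5)])
    then show ?thesis by blast
  qed
  then have "\<forall>y\<in>P. \<exists>W. openin X W \<and> y \<in> W \<and> X closure_of W \<subseteq> N y" by blast
  from bchoice[OF this] obtain W where
    W: "\<forall>y\<in>P. openin X (W y) \<and> y \<in> W y \<and> X closure_of W y \<subseteq> N y" ..
  define V where "V y = X closure_of W y" for y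
  have VN: "V y \<subseteq> N y" if "y \<in> P" for y using W that by (auto simp: V_def)
  have Vdisj: "V y \<inter> V z = {}" if "y \<in> P" "z \<in> P" "y \<noteq> z" for y z
    using VN[OF that(1)] VN[OF that(2)] Ndisj[OF that] by blast
  have pP: "p i \<in> P" if "i < n" for i using that by (simp add: P_def)
  have "0 < cover_entropy G X \<phi> ((\<lambda>i. topspace X - V (p i)) ` {..<n})"
  proof (rule upe[unfolded has_upe_def, rule_format], intro conjI allI impI)
    fix i assume i: "i < n"
    show "openin X (topspace X - V (p i))" by (simp add: V_def openin_diff)
    have Wi: "openin X (W (p i))" "p i \<in> W (p i)" using W pP[OF i] by auto
    then have "W (p i) \<subseteq> V (p i)" unfolding V_def by (simp add: closure_of_subset openin_subset)
    then have "W (p i) \<inter> (topspace X - V (p i)) = {}" by blast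
    then have "W (p i) \<inter> X closure_of (topspace X - V (p i)) = {}"
      using openin_Int_closure_of_eq_empty[OF Wi(1)] by blast
    moreover have "p i \<in> topspace X" using PX pP[OF i] by blast
    ultimately show "X closure_of (topspace X - V (p i)) \<noteq> topspace X" using Wi(2) by blast
  next
    have "x \<in> (\<Union>i\<in>{..<n}. topspace X - V (p i))" if x: "x \<in> topspace X" for x
    proof -
      have "x \<notin> V (p j) \<or> x \<notin> V (p k)" using Vdisj[OF pP[OF ne(1)] pP[OF ne(2)] ne(3)] by blast
      then show ?thesis using x ne by blast
    qed
    then show "(\<Union>i\<in>{..<n}. topspace X - V (p i)) = topspace X" by blast
  qed
  also have "(\<lambda>i. topspace X - V (p i)) ` {..<n} = (\<lambda>y. topspace X - V y) ` P"
    unfolding P_def image_image ..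
  finally have pos: "0 < cover_entropy G X \<phi> ((\<lambda>y. topspace X - V y) ` P)" .
  have "{p j, p k} \<subseteq> P" using pP ne by auto
  from card_mono[OF finP this] have card: "2 \<le> card P" using ne(3) by simp
  have "positive_density G (topspace X) \<phi> P V"
    by (rule positive_density_if_positive_entropy[OF G(1) sys(3) card Vdisj pos])
  then show ?thesis
  proof (rule positive_density_mono)
    show "p \<in> {..<n} \<rightarrow> P" using pP by auto
    fix i assume "i \<in> {..<n}"
    then have i: "i < n" by simp
    then have "V (p i) \<subseteq> N (p i)" using VN pP by blast
    also have "\<dots> \<subseteq> A i" using i by (auto simp: N_def)
    finally show "V (p i) \<subseteq> A i" .
  qed
qed

text \<open>Points \<open>p i \<in> A i\<close> can be chosen not all equal, except when all \<open>A i\<close> are the same isolated point \<open>x\<close>. In that case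
apply the previous lemma to \<open>{x}\<close> and the whole space, and use only the label of \<open>{x}\<close>. On a one-point space every set
is independent.\<close>

lemma positive_density_if_upe:
  assumes G: "amenable G" "G_system G X \<phi>" and upe: "has_upe n G X \<phi>" and n: "2 \<le> n"
    and A: "\<And>i. i < n \<Longrightarrow> openin X (A i) \<and> A i \<noteq> {}"
  shows "positive_density G (topspace X) \<phi> {..<n} A"
proof -
  note sys = G_systemD[OF G(2)]
  interpret group_action G "topspace X" \<phi> by (rule sys(3))
  show ?thesis
  proof (cases "\<exists>x. \<forall>i<n. A i = {x}")
    case True
    then obtain x where x: "\<And>i. i < n \<Longrightarrow> A i = {x}" by blast
    have "x \<in> A 0" "openin X (A 0)" using x[of 0] A[of 0] n by auto
    then have xX: "x \<in> topspace X" using openin_subset by blast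
    show ?thesis
    proof (cases "topspace X = {x}")
      case True
      have "independence_set (topspace X) \<phi> {..<n} A E" if E: "E \<subseteq> carrier G" for E
        unfolding independence_set_def
      proof
        fix \<omega> assume \<omega>: "\<omega> \<in> E \<rightarrow> {..<n}"
        have "\<phi> g x \<in> A (\<omega> g)" if g: "g \<in> E" for g
        proof -
          have "\<omega> g < n" using \<omega> g by auto
          moreover have "\<phi> g x = x" using action_closed[of g x] E g xX True by auto
          ultimately show ?thesis using x by simp
        qed
        then show "\<exists>x\<in>topspace X. \<forall>g\<in>E. \<phi> g x \<in> A (\<omega> g)" using xX by blast
      qed
      then show ?thesis
        unfolding positive_density_def by (intro exI[of _ 1]) auto
    next
      case False
      then obtain y where y: "y \<in> topspace X" "y \<noteq> x" using xX by blast
      define B where "B i = (if i = 0 then {x} else topspace X)" for i :: nat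
      define p where "p i = (if i = 0 then x else y)" for i :: nat
      have ox: "openin X {x}" using A[of 0] x[of 0] n by simp
      have "openin X (B i) \<and> p i \<in> B i" for i using ox y(1) by (simp add: B_def p_def)
      moreover have "0 < n" "1 < n" "p 0 \<noteq> p 1" using n y(2) by (auto simp: p_def)
      ultimately have "positive_density G (topspace X) \<phi> {..<n} B"
        using positive_density_nonconstant[OF G upe] by blast
      then show ?thesis
      proof (rule positive_density_mono)
        show "(\<lambda>_. 0) \<in> {..<n} \<rightarrow> {..<n}" using n by auto
        show "B 0 \<subseteq> A i" if "i \<in> {..<n}" for i using x that by (simp add: B_def)
      qed
    qed
  next
    case False
    have "\<exists>p j k. (\<forall>i<n. p i \<in> A i) \<and> j < n \<and> k < n \<and> p j \<noteq> p k"
    proof -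
      have "\<forall>i\<in>{..<n}. \<exists>x. x \<in> A i" using A by blast
      from bchoice[OF this] obtain p where p: "\<forall>i\<in>{..<n}. p i \<in> A i" ..
      show ?thesis
      proof (cases "\<exists>k<n. p k \<noteq> p 0")
        case True
        then obtain k where "k < n" "p k \<noteq> p 0" by blast
        then show ?thesis using p n by (intro exI[of _ p] exI[of _ k] exI[of _ 0]) auto
      next
        case eq: False
        obtain j where j: "j < n" "A j \<noteq> {p 0}" using False by blast
        have "p j = p 0" using eq j(1) by blast
        moreover have "p j \<in> A j" using bspec[OF p, of j] j(1) by simp
        ultimately have "\<not> A j \<subseteq> {p 0}" using j(2) by auto
        then obtain y where y: "y \<in> A j" "y \<noteq> p 0" by blast
        obtain k where k: "k < n" "k \<noteq> j"
        proof (cases "j = 0")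
          case True
          then show ?thesis using that[of 1] n by simp
        next
          case False
          then show ?thesis using that[of 0] n by simp
        qed
        have "p k = p 0" using eq k(1) by blast
        then have "(p(j := y)) j \<noteq> (p(j := y)) k" using k(2) y(2) by simp
        moreover have "\<forall>i<n. (p(j := y)) i \<in> A i" using p y by auto
        ultimately show ?thesis
          by (intro exI[of _ "p(j := y)"] exI[of _ j] exI[of _ k]) (use j k in simp)
      qed
    qed
    then obtain p j k where p: "\<forall>i<n. p i \<in> A i" "j < n" "k < n" "p j \<noteq> p k" by blast
    show ?thesis
      by (rule positive_density_nonconstant[OF G upe _ p(2-4)]) (use A p(1) in auto)
  qed
qed

lemma has_upe_product:
  assumes am: "amenable G" and X: "G_system G X \<phi>" "has_upe n G X \<phi>"
    and Y: "G_system G Y \<psi>" "has_upe n G Y \<psi>" and n: "2 \<le> n"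
  shows "has_upe n G (prod_topology X Y) (diagonal_action X \<phi> Y \<psi>)"
  unfolding has_upe_def
proof (intro allI impI, elim conjE)
  let ?Z = "prod_topology X Y"
  fix U assume U: "\<forall>i<n. openin ?Z (U i) \<and> ?Z closure_of (U i) \<noteq> topspace ?Z"
    and cov: "(\<Union>i\<in>{..<n}. U i) = topspace ?Z"
  have "\<exists>A B. openin X A \<and> openin Y B \<and> A \<noteq> {} \<and> B \<noteq> {} \<and> U i \<inter> (A \<times> B) = {}" if i: "i < n" for i
  proof -
    have "?Z closure_of (U i) \<subseteq> topspace ?Z" by (rule closure_of_subset_topspace)
    then obtain x y where xy: "(x, y) \<in> topspace ?Z - (?Z closure_of (U i))"
      using U i by fast
    have op: "openin ?Z (topspace ?Z - (?Z closure_of (U i)))" by (intro openin_diff openin_topspace closedin_closure_of)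
    from openin_prod_topology_alt[THEN iffD1, OF op, rule_format, OF xy]
    obtain A B where AB: "openin X A" "openin Y B" "x \<in> A" "y \<in> B"
        "A \<times> B \<subseteq> topspace ?Z - (?Z closure_of (U i))" by (elim exE conjE)
    have "openin ?Z (U i)" using U i by blast
    then have "U i \<subseteq> ?Z closure_of (U i)" by (intro closure_of_subset openin_subset)
    then have "U i \<inter> (A \<times> B) = {}" using AB(5) by blast
    then show ?thesis using AB by blast
  qed
  then have "\<forall>i\<in>{..<n}. \<exists>A B. openin X A \<and> openin Y B \<and> A \<noteq> {} \<and> B \<noteq> {} \<and> U i \<inter> (A \<times> B) = {}"
    by simp
  from bchoice[OF this] obtain A where
    "\<forall>i\<in>{..<n}. \<exists>B. openin X (A i) \<and> openin Y B \<and> A i \<noteq> {} \<and> B \<noteq> {} \<and> U i \<inter> (A i \<times> B) = {}" ..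
  from bchoice[OF this] obtain B where
    AB: "\<forall>i\<in>{..<n}. openin X (A i) \<and> openin Y (B i) \<and> A i \<noteq> {} \<and> B i \<noteq> {} \<and> U i \<inter> (A i \<times> B i) = {}" ..
  have dX: "positive_density G (topspace X) \<phi> {..<n} A"
    by (rule positive_density_if_upe[OF am X n]) (use AB in simp)
  have dY: "positive_density G (topspace Y) \<psi> {..<n} B"
    by (rule positive_density_if_upe[OF am Y n]) (use AB in simp)
  show "0 < cover_entropy G ?Z (diagonal_action X \<phi> Y \<psi>) (U ` {..<n})"
  proof (rule positive_entropy_if_positive_density)
    show "amenable G" by (rule am)
    show "group_action G (topspace ?Z) (diagonal_action X \<phi> Y \<psi>)"
      by (rule group_action_diagonal[OF G_systemD(3)[OF X(1)] G_systemD(3)[OF Y(1)]])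
    show "2 \<le> card {..<n}" using n by simp
    show "positive_density G (topspace ?Z) (diagonal_action X \<phi> Y \<psi>) {..<n} (\<lambda>i. A i \<times> B i)"
      by (rule positive_density_Times[OF dX dY, of 0]) (use n in simp)
    show "U i \<inter> (A i \<times> B i) = {}" if "i \<in> {..<n}" for i using AB that by simp
    show "topspace ?Z \<subseteq> \<Union>(U ` {..<n})" using cov by simp
  qed
qed

lemma cover_entropy_empty_space:
  assumes am: "amenable G" and act: "group_action G (topspace X) \<phi>"
    and empty: "topspace X = {}" and fin: "finite \<U>"
  shows "cover_entropy G X \<phi> \<U> = 0"
proof -
  obtain F where F: "folner_sequence G F" using amenable_folner[OF am] by blast
  have "covering_number {} (cover_join {} \<phi> \<U> (F m)) = 0" for m
    using covering_number_le[of "{}" "cover_join {} \<phi> \<U> (F m)" "{}"] by simp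
  then have "(\<lambda>m. log_cover_number (topspace X) \<phi> \<U> (F m) / real (card (F m))) = (\<lambda>m. 0)"
    by (simp add: log_cover_number_def empty)
  moreover have "(\<lambda>m. log_cover_number (topspace X) \<phi> \<U> (F m) / real (card (F m)))
      \<longlonglongrightarrow> cover_entropy G X \<phi> \<U>"
    by (rule cover_entropy_tendsto[OF am act fin _ F]) (simp add: empty)
  ultimately show ?thesis by (simp add: LIMSEQ_const_iff)
qed

text \<open>On the empty space the empty family is a cover by non-dense open sets, and it has entropy zero.\<close>

lemma topspace_nonempty_if_topological_K:
  assumes am: "amenable G" and act: "group_action G (topspace X) \<phi>" and K: "has_topological_K G X \<phi>"
  shows "topspace X \<noteq> {}"
proof
  assume empty: "topspace X = {}"
  then have "0 < cover_entropy G X \<phi> {}"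
    using K by (simp add: has_topological_K_def finite_open_cover_def)
  then show False using cover_entropy_empty_space[OF am act empty] by simp
qed

lemma has_upe_if_topological_K:
  assumes "has_topological_K G X \<phi>"
  shows "has_upe n G X \<phi>"
  unfolding has_upe_def
proof (intro allI impI, elim conjE)
  fix U assume "\<forall>i<n. openin X (U i) \<and> X closure_of (U i) \<noteq> topspace X" "(\<Union>i\<in>{..<n}. U i) = topspace X"
  then show "0 < cover_entropy G X \<phi> (U ` {..<n})"
    using assms by (auto simp: has_topological_K_def finite_open_cover_def)
qed

lemma topological_K_if_has_upe:
  assumes ne: "topspace X \<noteq> {}" and upe: "\<And>n. 2 \<le> n \<Longrightarrow> has_upe n G X \<phi>"
  shows "has_topological_K G X \<phi>"
  unfolding has_topological_K_def
proof (intro allI impI, elim conjE)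
  fix \<U> assume fin: "finite_open_cover X \<U>" and nd: "\<forall>U\<in>\<U>. X closure_of U \<noteq> topspace X"
  have finU: "finite \<U>" and cov: "\<Union>\<U> = topspace X" using fin by (auto simp: finite_open_cover_def)
  obtain U where U: "U ` {..<card \<U>} = \<U>"
    using ex_bij_betw_nat_finite[OF finU] by (auto simp: bij_betw_def atLeast0LessThan)
  have "\<U> \<noteq> {}" using ne cov by blast
  then have "card \<U> \<noteq> 0" using finU by simp
  moreover have "card \<U> \<noteq> 1"
  proof
    assume "card \<U> = 1"
    then obtain V where "\<U> = {V}" by (rule card_1_singletonE)
    then have "V = topspace X" using cov by simp
    then show False using nd \<open>\<U> = {V}\<close> by simp
  qed
  ultimately have "2 \<le> card \<U>" by linarith
  from upe[OF this] have "0 < cover_entropy G X \<phi> (U ` {..<card \<U>})"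
    unfolding has_upe_def
  proof (rule allE[where x = U], elim mp, intro conjI allI impI)
    fix i assume "i < card \<U>"
    then have "U i \<in> \<U>" using U by auto
    then show "openin X (U i)" "X closure_of (U i) \<noteq> topspace X"
      using fin nd by (auto simp: finite_open_cover_def)
  next
    show "(\<Union>i\<in>{..<card \<U>}. U i) = topspace X" using U cov by simp
  qed
  then show "0 < cover_entropy G X \<phi> \<U>" using U by simp
qed

lemma has_topological_K_product:
  assumes am: "amenable G" and X: "G_system G X \<phi>" "has_topological_K G X \<phi>"
    and Y: "G_system G Y \<psi>" "has_topological_K G Y \<psi>"
  shows "has_topological_K G (prod_topology X Y) (diagonal_action X \<phi> Y \<psi>)"
proof (rule topological_K_if_has_upe)
  show "topspace (prod_topology X Y) \<noteq> {}"
    using topspace_nonempty_if_topological_K[OF am G_systemD(3)[OF X(1)] X(2)]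
      topspace_nonempty_if_topological_K[OF am G_systemD(3)[OF Y(1)] Y(2)] by simp
  show "has_upe n G (prod_topology X Y) (diagonal_action X \<phi> Y \<psi>)" if "2 \<le> n" for n
    using has_upe_product[OF am X(1) _ Y(1) _ that] has_upe_if_topological_K[OF X(2)] has_upe_if_topological_K[OF Y(2)]
    by blast
qed

section \<open>Completely positive entropy\<close>

text \<open>These are the IE-pairs of Kerr and Li. The two points may coincide.\<close>

definition independence_pair ::
  "('g, 'm) monoid_scheme \<Rightarrow> 'a topology \<Rightarrow> ('g \<Rightarrow> 'a \<Rightarrow> 'a) \<Rightarrow> 'a \<Rightarrow> 'a \<Rightarrow> bool" where
  "independence_pair G X \<phi> x x' \<longleftrightarrow> x \<in> topspace X \<and> x' \<in> topspace X \<and>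
     (\<forall>A B. openin X A \<and> openin X B \<and> x \<in> A \<and> x' \<in> B \<longrightarrow>
        positive_density G (topspace X) \<phi> UNIV (\<lambda>b. if b then A else B))"

lemma independence_pairD:
  assumes "independence_pair G X \<phi> x x'"
  shows "x \<in> topspace X" "x' \<in> topspace X"
    "\<lbrakk>openin X A; openin X B; x \<in> A; x' \<in> B\<rbrakk> \<Longrightarrow>
       positive_density G (topspace X) \<phi> UNIV (\<lambda>b. if b then A else B)"
  using assms unfolding independence_pair_def by simp_all

lemma independence_pair_diagonal:
  assumes p: "independence_pair G X \<phi> x x'"
  shows "independence_pair G X \<phi> x x" "independence_pair G X \<phi> x' x'"
proof -
  note D = independence_pairD[OF p]
  have "positive_density G (topspace X) \<phi> UNIV (\<lambda>b. if b then A else B)"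
    if AB: "openin X A" "openin X B" "x \<in> A" "x \<in> B" for A B
  proof -
    have "positive_density G (topspace X) \<phi> UNIV (\<lambda>b. if b then A \<inter> B else topspace X)"
      by (rule D(3)) (use AB D in auto)
    then show ?thesis
      by (rule positive_density_mono[where r = "\<lambda>_. True"]) auto
  qed
  then show "independence_pair G X \<phi> x x" unfolding independence_pair_def using D(1) by simp
  have "positive_density G (topspace X) \<phi> UNIV (\<lambda>b. if b then A else B)"
    if AB: "openin X A" "openin X B" "x' \<in> A" "x' \<in> B" for A B
  proof -
    have "positive_density G (topspace X) \<phi> UNIV (\<lambda>b. if b then topspace X else A \<inter> B)"
      by (rule D(3)) (use AB D in auto)
    then show ?thesis
      by (rule positive_density_mono[where r = "\<lambda>_. False"]) auto
  qed
  then show "independence_pair G X \<phi> x' x'" unfolding independence_pair_def using D(2) by simp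
qed

lemma G_system_continuous:
  assumes "G_system G X \<phi>" "g \<in> carrier G"
  shows "continuous_map X X (\<phi> g)"
proof -
  have 1: "continuous_map (prod_topology (discrete_topology (carrier G)) X) X (\<lambda>(g, x). \<phi> g x)"
    using assms by (simp add: G_system_def)
  have 2: "continuous_map X (prod_topology (discrete_topology (carrier G)) X) (\<lambda>x. (g, x))"
    using assms(2) by (simp add: continuous_map_pairedI)
  show ?thesis
    using continuous_map_compose[OF 2 1] by (simp add: comp_def)
qed

text \<open>If \<open>J\<close> is independent for \<open>V\<close>, then \<open>g J\<close> is independent for the images under \<open>g\<close>.\<close>

lemma positive_density_preimage:
  assumes act: "group_action G S \<phi>" and g: "g \<in> carrier G"
    and dens: "positive_density G S \<phi> I V"
    and sub: "\<And>i x. \<lbrakk>i \<in> I; x \<in> S; x \<in> V i\<rbrakk> \<Longrightarrow> \<phi> g x \<in> W i"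
  shows "positive_density G S \<phi> I W"
proof -
  interpret group_action G S \<phi> by (rule act)
  interpret group G by (rule group_G)
  obtain q where q: "0 < q" "\<forall>E. E \<subseteq> carrier G \<and> finite E \<longrightarrow>
       (\<exists>J\<subseteq>E. q * real (card E) \<le> real (card J) \<and> independence_set S \<phi> I V J)"
    by (rule positive_densityE[OF dens])
  have "\<exists>J\<subseteq>E. q * real (card E) \<le> real (card J) \<and> independence_set S \<phi> I W J"
    if E: "E \<subseteq> carrier G" "finite E" for E
  proof -
    define E' where "E' = (\<lambda>e. inv\<^bsub>G\<^esub> g \<otimes>\<^bsub>G\<^esub> e) ` E"
    have inj1: "inj_on (\<lambda>e. inv\<^bsub>G\<^esub> g \<otimes>\<^bsub>G\<^esub> e) E"
      using g by (intro inj_on_subset[OF _ E(1)]) (simp add: inj_on_def)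
    have "E' \<subseteq> carrier G" "finite E'" using E g by (auto simp: E'_def)
    then obtain J' where J': "J' \<subseteq> E'" "q * real (card E') \<le> real (card J')" "independence_set S \<phi> I V J'"
      using q(2) by blast
    have J'G: "J' \<subseteq> carrier G" using J'(1) \<open>E' \<subseteq> carrier G\<close> by blast
    have inj2: "inj_on (\<lambda>e. g \<otimes>\<^bsub>G\<^esub> e) J'"
      using g by (intro inj_on_subset[OF _ J'G]) (simp add: inj_on_def)
    define J where "J = (\<lambda>e. g \<otimes>\<^bsub>G\<^esub> e) ` J'"
    have "J \<subseteq> E"
    proof
      fix j assume "j \<in> J"
      then obtain e where e: "e \<in> E" "j = g \<otimes>\<^bsub>G\<^esub> (inv\<^bsub>G\<^esub> g \<otimes>\<^bsub>G\<^esub> e)"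
        using J'(1) by (auto simp: J_def E'_def)
      moreover have "e \<in> carrier G" using e(1) E(1) by blast
      ultimately show "j \<in> E" using g by (simp add: m_assoc[symmetric])
    qed
    moreover have "card J = card J'" "card E' = card E"
      using inj1 inj2 by (simp_all add: J_def E'_def card_image)
    moreover have "independence_set S \<phi> I W J"
      unfolding independence_set_def
    proof
      fix \<omega> assume \<omega>: "\<omega> \<in> J \<rightarrow> I"
      then have "(\<lambda>e. \<omega> (g \<otimes>\<^bsub>G\<^esub> e)) \<in> J' \<rightarrow> I" by (auto simp: J_def)
      from bspec[OF J'(3)[unfolded independence_set_def] this]
      obtain x where x: "x \<in> S" "\<forall>e\<in>J'. \<phi> e x \<in> V (\<omega> (g \<otimes>\<^bsub>G\<^esub> e))" by blast
      have "\<phi> j x \<in> W (\<omega> j)" if j: "j \<in> J" for j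
      proof -
        obtain e where e: "e \<in> J'" "j = g \<otimes>\<^bsub>G\<^esub> e" using j by (auto simp: J_def)
        have eG: "e \<in> carrier G" using e(1) J'G by blast
        have "\<omega> j \<in> I" using \<omega> j by blast
        moreover have "\<phi> e x \<in> V (\<omega> j)" using x(2) e by simp
        ultimately have "\<phi> g (\<phi> e x) \<in> W (\<omega> j)"
          using sub action_closed[OF eG x(1)] by blast
        then show ?thesis using composition_rule[OF x(1) g eG] e(2) by simp
      qed
      then show "\<exists>x\<in>S. \<forall>j\<in>J. \<phi> j x \<in> W (\<omega> j)" using x(1) by blast
    qed
    ultimately show ?thesis using J'(2) by (intro exI[of _ J]) simp
  qed
  then show ?thesis unfolding positive_density_def using q(1) by blast
qed

lemma independence_pair_translate:
  assumes sys: "G_system G X \<phi>" and p: "independence_pair G X \<phi> x x'" and g: "g \<in> carrier G"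
  shows "independence_pair G X \<phi> (\<phi> g x) (\<phi> g x')"
proof -
  note D = independence_pairD[OF p]
  interpret group_action G "topspace X" \<phi> by (rule G_systemD(3)[OF sys])
  have "positive_density G (topspace X) \<phi> UNIV (\<lambda>b. if b then A else B)"
    if AB: "openin X A" "openin X B" "\<phi> g x \<in> A" "\<phi> g x' \<in> B" for A B
  proof -
    have "openin X {y \<in> topspace X. \<phi> g y \<in> A}" "openin X {y \<in> topspace X. \<phi> g y \<in> B}"
      using AB G_system_continuous[OF sys g] by (auto intro: openin_continuous_map_preimage)
    then have "positive_density G (topspace X) \<phi> UNIV
        (\<lambda>b. if b then {y \<in> topspace X. \<phi> g y \<in> A} else {y \<in> topspace X. \<phi> g y \<in> B})"
      by (rule D(3)) (use AB D(1,2) in auto)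
    then show ?thesis
      by (rule positive_density_preimage[OF G_systemD(3)[OF sys] g]) (auto split: if_splits)
  qed
  then show ?thesis
    unfolding independence_pair_def using action_closed[OF g] D(1,2) by simp
qed

text \<open>Disjoint closed neighbourhoods of the two points inside a pair of sets without positive density have complements that
form a cover of entropy zero.\<close>

lemma zero_entropy_nbhds:
  assumes am: "amenable G" and sys: "G_system G X \<phi>"
    and x: "x \<in> topspace X" "x' \<in> topspace X" "x \<noteq> x'" and np: "\<not> independence_pair G X \<phi> x x'"
  shows "\<exists>A B. openin X A \<and> openin X B \<and> x \<in> A \<and> x' \<in> B \<and> X closure_of A \<inter> X closure_of B = {} \<and>
    cover_entropy G X \<phi> {topspace X - X closure_of A, topspace X - X closure_of B} \<le> 0"
proof -
  note s = G_systemD[OF sys]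
  obtain P Q where PQ: "openin X P" "openin X Q" "x \<in> P" "x' \<in> Q"
      "\<not> positive_density G (topspace X) \<phi> UNIV (\<lambda>b. if b then P else Q)"
    using np x(1,2) unfolding independence_pair_def by blast
  have "x \<in> topspace X \<and> x' \<in> topspace X \<and> x \<noteq> x'" using x by simp
  from s(4)[unfolded Hausdorff_space_def, rule_format, OF this]
  obtain L R where LR: "openin X L" "openin X R" "x \<in> L" "x' \<in> R" "disjnt L R" by blast
  have "openin X (P \<inter> L)" "x \<in> P \<inter> L" using PQ LR by auto
  then obtain A where A: "openin X A" "x \<in> A" "X closure_of A \<subseteq> P \<inter> L"
    by (rule regular_space_closed_nbhd[OF s(5)])
  have "openin X (Q \<inter> R)" "x' \<in> Q \<inter> R" using PQ LR by auto
  then obtain B where B: "openin X B" "x' \<in> B" "X closure_of B \<subseteq> Q \<inter> R"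
    by (rule regular_space_closed_nbhd[OF s(5)])
  define V where "V b = (if b then X closure_of A else X closure_of B)" for b
  have disj: "X closure_of A \<inter> X closure_of B = {}"
    using A(3) B(3) LR(5) by (auto simp: disjnt_iff)
  have eq: "{topspace X - X closure_of A, topspace X - X closure_of B} = (\<lambda>b. topspace X - V b) ` UNIV"
    by (auto simp: V_def UNIV_bool)
  have "\<not> 0 < cover_entropy G X \<phi> ((\<lambda>b. topspace X - V b) ` UNIV)"
  proof
    assume pos: "0 < cover_entropy G X \<phi> ((\<lambda>b. topspace X - V b) ` UNIV)"
    have "positive_density G (topspace X) \<phi> UNIV V"
    proof (rule positive_density_if_positive_entropy[OF am s(3) _ _ pos])
      show "V i \<inter> V j = {}" if "i \<noteq> j" for i j
        using that disj by (cases i; cases j) (auto simp: V_def)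
    qed simp
    then have "positive_density G (topspace X) \<phi> UNIV (\<lambda>b. if b then P else Q)"
    proof (rule positive_density_mono[where r = id])
      fix b show "V (id b) \<subseteq> (if b then P else Q)" using A(3) B(3) by (simp add: V_def)
    qed simp
    then show False using PQ(5) by simp
  qed
  then show ?thesis unfolding eq[symmetric] using A B disj by (intro exI[of _ A] exI[of _ B]) simp
qed

lemma compactin_finite_subfamily:
  assumes comp: "compactin X K" and O: "\<And>x. x \<in> K \<Longrightarrow> openin X (N x) \<and> x \<in> N x"
  shows "\<exists>T\<subseteq>K. finite T \<and> K \<subseteq> (\<Union>x\<in>T. N x)"
proof -
  have "(\<forall>U\<in>N ` K. openin X U) \<and> K \<subseteq> \<Union>(N ` K)" using O by blast
  then obtain \<F> where F: "finite \<F>" "\<F> \<subseteq> N ` K" "K \<subseteq> \<Union>\<F>"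
    using comp unfolding compactin_def by metis
  obtain T where "T \<subseteq> K" "finite T" "\<F> = N ` T" using finite_subset_image[OF F(1,2)] by blast
  then show ?thesis using F(3) by blast
qed

text \<open>Suppose no independence pair is separated. For a point \<open>x \<in> U \<in> \<U>\<close>, each point outside \<open>U\<close> has a closed
neighbourhood that forms with some neighbourhood of \<open>x\<close> a pair of entropy zero. By compactness finitely many such pairs
\<open>(D, C)\<close> serve a neighbourhood of \<open>x\<close> and all of the complement of \<open>U\<close>, and finitely many points \<open>x\<close> serve the
whole space. Let \<open>E\<close> be a member of the join of the finitely many two-set covers by the complements of \<open>D\<close> and \<open>C\<close>. If \<open>E\<close> has a point near
\<open>x\<close>, then it has to avoid the sets \<open>C\<close> that belong to \<open>x\<close>, so it lies in \<open>U\<close>. Hence the join refines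
\<open>\<U>\<close>, and the entropy of \<open>\<U>\<close> is at most a sum of zeros.\<close>

lemma separating_independence_pair:
  assumes am: "amenable G" and sys: "G_system G X \<phi>"
    and \<U>: "finite_open_cover X \<U>" and pos: "0 < cover_entropy G X \<phi> \<U>"
  shows "\<exists>x x' U. independence_pair G X \<phi> x x' \<and> U \<in> \<U> \<and> x \<in> U \<and> x' \<notin> U"
proof (rule ccontr)
  note s = G_systemD[OF sys]
  let ?S = "topspace X"
  assume "\<not> (\<exists>x x' U. independence_pair G X \<phi> x x' \<and> U \<in> \<U> \<and> x \<in> U \<and> x' \<notin> U)"
  then have no: "\<not> independence_pair G X \<phi> x x'" if "U \<in> \<U>" "x \<in> U" "x' \<notin> U" for x x' U
    using that by blast
  have finU: "finite \<U>" and opU: "\<And>U. U \<in> \<U> \<Longrightarrow> openin X U" and covU: "\<Union>\<U> = ?S"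
    using \<U> by (auto simp: finite_open_cover_def)
  have ne: "?S \<noteq> {}" using cover_entropy_empty_space[OF am s(3) _ finU] pos by force
  define zero where "zero p \<longleftrightarrow> fst p \<inter> snd p = {} \<and> cover_entropy G X \<phi> {?S - fst p, ?S - snd p} \<le> 0" for p
  have local: "\<exists>U A \<P>. U \<in> \<U> \<and> openin X A \<and> x \<in> A \<and> finite \<P> \<and> (\<forall>p\<in>\<P>. zero p \<and> A \<subseteq> fst p) \<and>
      ?S - U \<subseteq> (\<Union>p\<in>\<P>. snd p)" if x: "x \<in> ?S" for x
  proof -
    obtain U where U: "U \<in> \<U>" "x \<in> U" using x covU by blast
    have "\<exists>AB. openin X (fst AB) \<and> openin X (snd AB) \<and> x \<in> fst AB \<and> y \<in> snd AB \<and>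
        zero (X closure_of (fst AB), X closure_of (snd AB))" if y: "y \<in> ?S - U" for y
    proof -
      have "y \<in> ?S" "x \<noteq> y" "\<not> independence_pair G X \<phi> x y" using y U no[OF U] by auto
      from zero_entropy_nbhds[OF am sys x this]
      obtain A B where "openin X A" "openin X B" "x \<in> A" "y \<in> B" "X closure_of A \<inter> X closure_of B = {}"
        "cover_entropy G X \<phi> {?S - X closure_of A, ?S - X closure_of B} \<le> 0" by blast
      then show ?thesis by (intro exI[of _ "(A, B)"]) (simp add: zero_def)
    qed
    then have "\<forall>y\<in>?S - U. \<exists>AB. openin X (fst AB) \<and> openin X (snd AB) \<and> x \<in> fst AB \<and> y \<in> snd AB \<and>
        zero (X closure_of (fst AB), X closure_of (snd AB))" by blast
    from bchoice[OF this] obtain D where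
      D: "\<forall>y\<in>?S - U. openin X (fst (D y)) \<and> openin X (snd (D y)) \<and> x \<in> fst (D y) \<and> y \<in> snd (D y) \<and>
        zero (X closure_of (fst (D y)), X closure_of (snd (D y)))" ..
    have "closedin X (?S - U)" using opU[OF U(1)] by (intro closedin_diff closedin_topspace)
    then have "compactin X (?S - U)" by (rule closedin_compact_space[OF s(1)])
    then have "\<exists>T\<subseteq>?S - U. finite T \<and> ?S - U \<subseteq> (\<Union>y\<in>T. snd (D y))"
      by (rule compactin_finite_subfamily) (use D in blast)
    then obtain T where T: "T \<subseteq> ?S - U" "finite T" "?S - U \<subseteq> (\<Union>y\<in>T. snd (D y))" by blast
    define A where "A = ?S \<inter> (\<Inter>y\<in>T. fst (D y))"
    define \<P> where "\<P> = (\<lambda>y. (X closure_of (fst (D y)), X closure_of (snd (D y)))) ` T"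
    have cl: "fst (D y) \<subseteq> X closure_of (fst (D y))" "snd (D y) \<subseteq> X closure_of (snd (D y))" if "y \<in> T" for y
    proof -
      have "openin X (fst (D y))" "openin X (snd (D y))" using D T(1) that by blast+
      then show "fst (D y) \<subseteq> X closure_of (fst (D y))" "snd (D y) \<subseteq> X closure_of (snd (D y))"
        by (auto intro!: closure_of_subset openin_subset)
    qed
    have "openin X A"
      unfolding A_def by (rule openin_Int_Inter) (use T(1,2) D in auto)
    moreover have "x \<in> A" using x D T(1) by (auto simp: A_def)
    moreover have "finite \<P>" using T(2) by (simp add: \<P>_def)
    moreover have "zero p \<and> A \<subseteq> fst p" if p: "p \<in> \<P>" for p
    proof -
      obtain y where y: "y \<in> T" "p = (X closure_of (fst (D y)), X closure_of (snd (D y)))"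
        using p by (auto simp: \<P>_def)
      have "A \<subseteq> fst (D y)" using y(1) by (auto simp: A_def)
      then have "A \<subseteq> fst p" using cl(1)[OF y(1)] y(2) by auto
      moreover have "zero p" using D T(1) y by auto
      ultimately show ?thesis by blast
    qed
    moreover have "?S - U \<subseteq> (\<Union>p\<in>\<P>. snd p)"
    proof
      fix z assume "z \<in> ?S - U"
      then obtain y where y: "y \<in> T" "z \<in> snd (D y)" using T(3) by blast
      then have "z \<in> X closure_of (snd (D y))" using cl(2) by blast
      then show "z \<in> (\<Union>p\<in>\<P>. snd p)" using y(1) by (auto simp: \<P>_def)
    qed
    ultimately show ?thesis using U(1) by blast
  qed
  have "\<forall>x\<in>?S. \<exists>U. \<exists>A \<P>. U \<in> \<U> \<and> openin X A \<and> x \<in> A \<and> finite \<P> \<and> (\<forall>p\<in>\<P>. zero p \<and> A \<subseteq> fst p) \<and>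
      ?S - U \<subseteq> (\<Union>p\<in>\<P>. snd p)" using local by blast
  from bchoice[OF this] obtain U where "\<forall>x\<in>?S. \<exists>A \<P>. U x \<in> \<U> \<and> openin X A \<and> x \<in> A \<and> finite \<P> \<and>
      (\<forall>p\<in>\<P>. zero p \<and> A \<subseteq> fst p) \<and> ?S - U x \<subseteq> (\<Union>p\<in>\<P>. snd p)" ..
  from bchoice[OF this] obtain A where "\<forall>x\<in>?S. \<exists>\<P>. U x \<in> \<U> \<and> openin X (A x) \<and> x \<in> A x \<and> finite \<P> \<and>
      (\<forall>p\<in>\<P>. zero p \<and> A x \<subseteq> fst p) \<and> ?S - U x \<subseteq> (\<Union>p\<in>\<P>. snd p)" ..
  from bchoice[OF this] obtain \<P> where
    UAP: "\<forall>x\<in>?S. U x \<in> \<U> \<and> openin X (A x) \<and> x \<in> A x \<and> finite (\<P> x) \<and>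
      (\<forall>p\<in>\<P> x. zero p \<and> A x \<subseteq> fst p) \<and> ?S - U x \<subseteq> (\<Union>p\<in>\<P> x. snd p)" ..
  have "\<exists>T\<subseteq>?S. finite T \<and> ?S \<subseteq> (\<Union>x\<in>T. A x)"
    by (rule compactin_finite_subfamily[OF s(1)[unfolded compact_space_def]]) (use UAP in blast)
  then obtain T where T: "T \<subseteq> ?S" "finite T" "?S \<subseteq> (\<Union>x\<in>T. A x)" by blast
  define P where "P = (\<Union>x\<in>T. \<P> x)"
  have zeroP: "zero p" if "p \<in> P" for p using that UAP T(1) unfolding P_def by blast
  have "cover_entropy G X \<phi> \<U> \<le> (\<Sum>p\<in>P. cover_entropy G X \<phi> {?S - fst p, ?S - snd p})"
  proof (rule cover_entropy_le_sum[OF am s(3)])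
    show "finite P" unfolding P_def using UAP T(1,2) by blast
    show "finite {?S - fst p, ?S - snd p} \<and> ?S \<subseteq> \<Union>{?S - fst p, ?S - snd p}" if "p \<in> P" for p
      using zeroP[OF that] by (auto simp: zero_def)
    show "finite \<U>" by (rule finU)
    show "?S \<subseteq> \<Union>\<U>" using covU by simp
    fix c assume c: "\<And>p. p \<in> P \<Longrightarrow> c p \<in> {?S - fst p, ?S - snd p}"
    let ?E = "{y \<in> ?S. \<forall>p\<in>P. y \<in> c p}"
    show "\<exists>U\<in>\<U>. ?E \<subseteq> U"
    proof (cases "?E = {}")
      case True
      obtain V where "V \<in> \<U>" using ne covU by blast
      then show ?thesis using True by blast
    next
      case False
      then obtain y where y: "y \<in> ?S" "\<forall>p\<in>P. y \<in> c p" by blast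
      then obtain x where x: "x \<in> T" "y \<in> A x" using T(3) by blast
      have xS: "x \<in> ?S" using x(1) T(1) by blast
      have "?E \<subseteq> U x"
      proof
        fix z assume z: "z \<in> ?E"
        show "z \<in> U x"
        proof (rule ccontr)
          assume "z \<notin> U x"
          then obtain p where p: "p \<in> \<P> x" "z \<in> snd p" using z UAP xS by blast
          have pP: "p \<in> P" using p(1) x(1) by (auto simp: P_def)
          have "y \<in> fst p" using UAP xS p(1) x(2) by blast
          then have "c p \<noteq> ?S - fst p" using y(2) pP by blast
          then have "c p = ?S - snd p" using c[OF pP] by blast
          then show False using z pP p(2) by blast
        qed
      qed
      moreover have "U x \<in> \<U>" using UAP xS by blast
      ultimately show ?thesis by blast
    qed
  qed
  also have "\<dots> \<le> 0" by (rule sum_nonpos) (use zeroP in \<open>simp add: zero_def\<close>)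
  finally show False using pos by simp
qed

lemma continuous_map_discrete_times:
  assumes "\<And>g. g \<in> D \<Longrightarrow> continuous_map Y Z (f g)"
  shows "continuous_map (prod_topology (discrete_topology D) Y) Z (\<lambda>(g, x). f g x)"
  unfolding continuous_map_def
proof (intro conjI allI impI)
  show "(\<lambda>(g, x). f g x) \<in> topspace (prod_topology (discrete_topology D) Y) \<rightarrow> topspace Z"
    using assms by (auto dest: continuous_map_funspace)
  fix U assume U: "openin Z U"
  have eq: "{p \<in> topspace (prod_topology (discrete_topology D) Y). (case p of (g, x) \<Rightarrow> f g x) \<in> U}
      = (\<Union>g\<in>D. {g} \<times> {x \<in> topspace Y. f g x \<in> U})" by auto
  have "openin (prod_topology (discrete_topology D) Y) ({g} \<times> {x \<in> topspace Y. f g x \<in> U})" if "g \<in> D" for g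
    using openin_continuous_map_preimage[OF assms[OF that] U] that by (simp add: openin_prod_Times_iff)
  then show "openin (prod_topology (discrete_topology D) Y)
      {p \<in> topspace (prod_topology (discrete_topology D) Y). (case p of (g, x) \<Rightarrow> f g x) \<in> U}"
    unfolding eq by blast
qed

text \<open>The orbit map \<open>\<rho> x = (u (g x))\<close>, \<open>g \<in> G\<close>, is a factor map onto a subsystem of the shift on \<open>Z ^ G\<close>, which is
metrizable since \<open>G\<close> is countable. If this factor is not a point, it has a cover of positive entropy. The
preimage of that cover is separated by an independence pair, whose translates are again identified by \<open>u\<close>, so \<open>\<rho>\<close>
identifies the pair as well. This is a contradiction.\<close>

lemma cpe_constant:
  fixes G :: "('g, 'm) monoid_scheme" and X :: "'a topology" and u :: "'a \<Rightarrow> 'z"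
  assumes am: "amenable G" and count: "countable (carrier G)" and sys: "G_system G X \<phi>"
    and cpe: "has_cpe G X \<phi>" and u: "continuous_map X Z u" and Z: "metrizable_space Z"
    and pairs: "\<And>x x'. independence_pair G X \<phi> x x' \<Longrightarrow> u x = u x'"
    and xy: "x \<in> topspace X" "y \<in> topspace X"
  shows "u x = u y"
proof -
  note s = G_systemD[OF sys]
  let ?S = "topspace X"
  interpret group_action G ?S \<phi> by (rule s(3))
  interpret group G by (rule group_G)
  define \<rho> where "\<rho> x = (\<lambda>g\<in>carrier G. u (\<phi> g x))" for x
  define T where "T = product_topology (\<lambda>_. Z) (carrier G)"
  define Q where "Q = subtopology T (\<rho> ` ?S)"
  define \<psi> where "\<psi> h = restrict (\<lambda>f. \<lambda>g\<in>carrier G. f (g \<otimes>\<^bsub>G\<^esub> h)) (\<rho> ` ?S)" for h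
  have eqv: "\<psi> h (\<rho> x) = \<rho> (\<phi> h x)" if "h \<in> carrier G" "x \<in> ?S" for h x
    using that composition_rule[OF that(2) _ that(1)]
    by (auto simp: \<psi>_def \<rho>_def intro!: restrict_ext)
  have cont\<rho>: "continuous_map X T \<rho>"
    unfolding T_def continuous_map_componentwise
  proof (intro conjI ballI)
    show "\<rho> ` ?S \<subseteq> extensional (carrier G)" by (auto simp: \<rho>_def)
    fix g assume g: "g \<in> carrier G"
    have "continuous_map X Z (u \<circ> \<phi> g)"
      by (rule continuous_map_compose[OF G_system_continuous[OF sys g] u])
    then show "continuous_map X Z (\<lambda>x. \<rho> x g)" using g by (simp add: \<rho>_def comp_def)
  qed
  have topQ: "topspace Q = \<rho> ` ?S"
    using continuous_map_image_subset_topspace[OF cont\<rho>] by (auto simp: Q_def)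
  have contQ: "continuous_map X Q \<rho>"
    unfolding Q_def by (simp add: continuous_map_in_subtopology cont\<rho>)
  have "compactin T (\<rho> ` ?S)"
    by (rule image_compactin[OF s(1)[unfolded compact_space_def] cont\<rho>])
  then have compQ: "compact_space Q" unfolding Q_def by (rule compact_space_subtopology)
  have "metrizable_space T"
    unfolding T_def metrizable_space_product_topology using Z count by simp
  then have metQ: "metrizable_space Q" unfolding Q_def by (rule metrizable_space_subtopology)
  have actQ: "group_action G (topspace Q) \<psi>"
    unfolding topQ
  proof (rule group_actionI)
    show "group G" by (rule group_G)
    show "\<psi> g \<in> extensional (\<rho> ` ?S)" for g by (simp add: \<psi>_def)
    fix q assume "q \<in> \<rho> ` ?S"
    then obtain x where x: "x \<in> ?S" "q = \<rho> x" by blast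
    show "\<psi> \<one>\<^bsub>G\<^esub> q = q"
      using eqv[OF one_closed x(1)] group_action_one[OF s(3) x(1)] x(2) by simp
    fix g assume g: "g \<in> carrier G"
    show "\<psi> g q \<in> \<rho> ` ?S" using eqv[OF g x(1)] action_closed[OF g x(1)] x(2) by simp
    fix h assume h: "h \<in> carrier G"
    show "\<psi> (g \<otimes>\<^bsub>G\<^esub> h) q = \<psi> g (\<psi> h q)"
      using eqv[OF m_closed[OF g h] x(1)] eqv[OF h x(1)] eqv[OF g action_closed[OF h x(1)]]
        composition_rule[OF x(1) g h] x(2) by simp
  qed
  have contact: "continuous_map (prod_topology (discrete_topology (carrier G)) Q) Q (\<lambda>(g, q). \<psi> g q)"
  proof (rule continuous_map_discrete_times)
    fix h assume h: "h \<in> carrier G"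
    have "continuous_map Q T (\<psi> h)"
      unfolding T_def continuous_map_componentwise
    proof (intro conjI ballI)
      show "\<psi> h ` topspace Q \<subseteq> extensional (carrier G)" by (auto simp: topQ \<psi>_def)
      fix g assume g: "g \<in> carrier G"
      have "continuous_map T Z (\<lambda>f. f (g \<otimes>\<^bsub>G\<^esub> h))"
        unfolding T_def using continuous_map_product_projection[of "g \<otimes>\<^bsub>G\<^esub> h" "carrier G" "\<lambda>_. Z"] g h by simp
      then have "continuous_map Q Z (\<lambda>f. f (g \<otimes>\<^bsub>G\<^esub> h))"
        unfolding Q_def by (rule continuous_map_from_subtopology)
      then show "continuous_map Q Z (\<lambda>q. \<psi> h q g)"
        by (rule continuous_map_eq) (use g in \<open>simp add: topQ \<psi>_def\<close>)
    qed
    moreover have "\<psi> h ` topspace Q \<subseteq> \<rho> ` ?S"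
      unfolding topQ using eqv[OF h] action_closed[OF h] by auto
    ultimately have "continuous_map Q (subtopology T (\<rho> ` ?S)) (\<psi> h)"
      by (intro continuous_map_into_subtopology) auto
    then show "continuous_map Q Q (\<psi> h)" unfolding Q_def[symmetric] .
  qed
  have sysQ: "G_system G Q \<psi>"
    unfolding G_system_def using compQ metQ actQ contact by simp
  have fac: "is_factor G X \<phi> Q \<psi>"
    unfolding is_factor_def
  proof (intro conjI sysQ exI[of _ \<rho>] ballI)
    show "continuous_map X Q \<rho>" by (rule contQ)
    show "\<rho> ` ?S = topspace Q" by (simp add: topQ)
    show "\<rho> (\<phi> g x) = \<psi> g (\<rho> x)" if "g \<in> carrier G" "x \<in> ?S" for g x using eqv[OF that] by simp
  qed
  have "\<not> nontrivial_space Q"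
  proof
    assume "nontrivial_space Q"
    then have "0 < topological_entropy G Q \<psi>" by (rule has_cpe_factor[OF cpe fac])
    then obtain \<U> where \<U>: "finite_open_cover Q \<U>" and pos: "0 < cover_entropy G Q \<psi> \<U>"
      unfolding topological_entropy_def less_SUP_iff by auto
    define \<U>' where "\<U>' = (\<lambda>U. {x \<in> ?S. \<rho> x \<in> U}) ` \<U>"
    have U: "finite \<U>" "\<And>U. U \<in> \<U> \<Longrightarrow> openin Q U" "\<Union>\<U> = topspace Q"
      using \<U> by (auto simp: finite_open_cover_def)
    have "cover_entropy G Q \<psi> \<U> \<le> cover_entropy G X \<phi> \<U>'"
      unfolding \<U>'_def
      by (rule cover_entropy_factor_le[OF am s(3) actQ]) (use U topQ eqv in auto)
    then have pos': "0 < cover_entropy G X \<phi> \<U>'" using pos by simp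
    have "finite_open_cover X \<U>'"
      unfolding finite_open_cover_def
    proof (intro conjI ballI)
      show "finite \<U>'" using U(1) by (simp add: \<U>'_def)
      show "openin X V" if "V \<in> \<U>'" for V
        using that U(2) openin_continuous_map_preimage[OF contQ] by (auto simp: \<U>'_def)
      have "\<Union>\<U>' = {x \<in> ?S. \<rho> x \<in> \<Union>\<U>}" by (auto simp: \<U>'_def)
      also have "\<dots> = ?S" unfolding U(3) topQ by auto
      finally show "\<Union>\<U>' = ?S" .
    qed
    from separating_independence_pair[OF am sys this pos']
    obtain x x' V where p: "independence_pair G X \<phi> x x'" "V \<in> \<U>'" "x \<in> V" "x' \<notin> V" by blast
    have "u (\<phi> g x) = u (\<phi> g x')" if "g \<in> carrier G" for g
      by (rule pairs[OF independence_pair_translate[OF sys p(1) that]])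
    then have "\<rho> x = \<rho> x'" by (auto simp: \<rho>_def intro!: restrict_ext)
    moreover have "x' \<in> ?S" by (rule independence_pairD(2)[OF p(1)])
    ultimately show False using p(2-4) by (auto simp: \<U>'_def)
  qed
  then obtain q where "topspace Q = {q}" unfolding nontrivial_space_def by blast
  then have "\<rho> x = \<rho> y" using xy topQ by (metis imageI singletonD)
  then have "\<rho> x \<one>\<^bsub>G\<^esub> = \<rho> y \<one>\<^bsub>G\<^esub>" by simp
  then show ?thesis using group_action_one[OF s(3)] xy by (simp add: \<rho>_def)
qed

text \<open>If \<open>x\<close> has a neighbourhood \<open>C\<close> without positive density, then \<open>C\<close> contains no point of any independence pair. A
Urysohn function that vanishes at \<open>x\<close> and is \<open>1\<close> outside \<open>C\<close> then equals \<open>1\<close> on all independence pairs. So it is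
constant, \<open>C\<close> is the whole space, and the whole space trivially has positive density.\<close>

lemma cpe_independence_pair_diagonal:
  fixes X :: "'a topology"
  assumes am: "amenable G" and count: "countable (carrier G)" and sys: "G_system G X \<phi>"
    and cpe: "has_cpe G X \<phi>" and x: "x \<in> topspace X"
  shows "independence_pair G X \<phi> x x"
proof (rule ccontr)
  note s = G_systemD[OF sys]
  interpret group_action G "topspace X" \<phi> by (rule s(3))
  assume "\<not> independence_pair G X \<phi> x x"
  then obtain A B where AB: "openin X A" "openin X B" "x \<in> A" "x \<in> B"
      "\<not> positive_density G (topspace X) \<phi> UNIV (\<lambda>b. if b then A else B)"
    using x unfolding independence_pair_def by blast
  define C where "C = A \<inter> B"
  have C: "openin X C" "x \<in> C" using AB by (auto simp: C_def)
  have nd: "\<not> positive_density G (topspace X) \<phi> UNIV (\<lambda>b. if b then C else C)"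
  proof
    assume "positive_density G (topspace X) \<phi> UNIV (\<lambda>b. if b then C else C)"
    then have "positive_density G (topspace X) \<phi> UNIV (\<lambda>b. if b then A else B)"
      by (rule positive_density_mono[where r = id]) (auto simp: C_def)
    then show False using AB(5) by simp
  qed
  have "closedin X (topspace X - C)" "x \<in> topspace X - (topspace X - C)" using C x by auto
  then have "\<exists>f. continuous_map X (top_of_set {0..1::real}) f \<and> f x = 0 \<and> f ` (topspace X - C) \<subseteq> {1}"
    using metrizable_imp_completely_regular_space[OF s(2)] unfolding completely_regular_space_def by blast
  then obtain f :: "'a \<Rightarrow> real" where f: "continuous_map X (top_of_set {0..1}) f" "f x = 0" "f ` (topspace X - C) \<subseteq> {1}"
    by blast
  have outside: "f z = 1" if p: "independence_pair G X \<phi> z z" for z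
  proof -
    have "z \<notin> C" using independence_pairD(3)[OF p C(1) C(1)] nd by blast
    then show ?thesis using f(3) independence_pairD(1)[OF p] by blast
  qed
  have const: "f y = f x" if y: "y \<in> topspace X" for y
  proof (rule cpe_constant[OF am count sys cpe f(1) _ _ y x])
    show "metrizable_space (top_of_set {0..1::real})"
      by (simp add: metrizable_space_euclidean metrizable_space_subtopology)
    show "f z = f z'" if "independence_pair G X \<phi> z z'" for z z'
      using independence_pair_diagonal[OF that] outside by simp
  qed
  have all: "topspace X \<subseteq> C" using const f(2,3) by force
  have "independence_set (topspace X) \<phi> UNIV (\<lambda>b. if b then C else C) E" if "E \<subseteq> carrier G" for E
    unfolding independence_set_def using action_closed x that all by (intro ballI bexI[of _ x]) auto
  then have "positive_density G (topspace X) \<phi> UNIV (\<lambda>b. if b then C else C)"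
    unfolding positive_density_def by (intro exI[of _ 1]) auto
  then show False using nd by simp
qed

lemma positive_density_factor:
  assumes dens: "positive_density G S \<phi> I V"
    and \<pi>: "\<And>x. x \<in> S \<Longrightarrow> \<pi> x \<in> R" and eqv: "\<And>g x. g \<in> carrier G \<Longrightarrow> x \<in> S \<Longrightarrow> \<pi> (\<phi> g x) = \<psi> g (\<pi> x)"
    and sub: "\<And>i z. i \<in> I \<Longrightarrow> z \<in> V i \<Longrightarrow> \<pi> z \<in> W i"
  shows "positive_density G R \<psi> I W"
proof -
  have ind: "independence_set R \<psi> I W J" if J: "independence_set S \<phi> I V J" "J \<subseteq> carrier G" for J
    unfolding independence_set_def
  proof
    fix \<omega> assume \<omega>: "\<omega> \<in> J \<rightarrow> I"
    from bspec[OF J(1)[unfolded independence_set_def] this]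
    obtain x where x: "x \<in> S" "\<forall>g\<in>J. \<phi> g x \<in> V (\<omega> g)" by blast
    have "\<psi> g (\<pi> x) \<in> W (\<omega> g)" if g: "g \<in> J" for g
    proof -
      have "\<omega> g \<in> I" "g \<in> carrier G" using \<omega> g J(2) by auto
      then show ?thesis using sub[of "\<omega> g" "\<phi> g x"] x g eqv[of g x] by simp
    qed
    then show "\<exists>y\<in>R. \<forall>g\<in>J. \<psi> g y \<in> W (\<omega> g)" using \<pi>[OF x(1)] by blast
  qed
  obtain q where q: "0 < q" "\<forall>E. E \<subseteq> carrier G \<and> finite E \<longrightarrow>
       (\<exists>J\<subseteq>E. q * real (card E) \<le> real (card J) \<and> independence_set S \<phi> I V J)"
    by (rule positive_densityE[OF dens])
  have "\<exists>J\<subseteq>E. q * real (card E) \<le> real (card J) \<and> independence_set R \<psi> I W J"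
    if E: "E \<subseteq> carrier G" "finite E" for E
  proof -
    obtain J where J: "J \<subseteq> E" "q * real (card E) \<le> real (card J)" "independence_set S \<phi> I V J"
      using q(2) E by blast
    have "J \<subseteq> carrier G" using J(1) E(1) by blast
    then show ?thesis using J ind by blast
  qed
  then show ?thesis unfolding positive_density_def using q(1) by blast
qed

text \<open>If the images differ, then they have neighbourhoods with disjoint closures. Boxes around the two points have positive
density, so these neighbourhoods have positive density as well, and the complements of their closures form an open cover of
positive entropy.\<close>

lemma zero_entropy_factor_identifies_pairs:
  assumes am: "amenable G" and X: "G_system G X \<phi>" and Y: "G_system G Y \<psi>" and Z: "G_system G Z \<theta>"
    and \<pi>: "continuous_map (prod_topology X Y) Z \<pi>"
    and eqv: "\<And>g z. g \<in> carrier G \<Longrightarrow> z \<in> topspace (prod_topology X Y) \<Longrightarrow>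
       \<pi> (diagonal_action X \<phi> Y \<psi> g z) = \<theta> g (\<pi> z)"
    and zero: "\<not> 0 < topological_entropy G Z \<theta>"
    and px: "independence_pair G X \<phi> x x'" and py: "independence_pair G Y \<psi> y y'"
  shows "\<pi> (x, y) = \<pi> (x', y')"
proof (rule ccontr)
  assume neq: "\<pi> (x, y) \<noteq> \<pi> (x', y')"
  note Dx = independence_pairD[OF px] and Dy = independence_pairD[OF py] and sZ = G_systemD[OF Z]
  let ?P = "prod_topology X Y"
  have xyP: "(x, y) \<in> topspace ?P" "(x', y') \<in> topspace ?P" using Dx(1,2) Dy(1,2) by auto
  have img: "\<pi> z \<in> topspace Z" if "z \<in> topspace ?P" for z
    using continuous_map_funspace[OF \<pi>] that by blast
  have "\<pi> (x, y) \<in> topspace Z \<and> \<pi> (x', y') \<in> topspace Z \<and> \<pi> (x, y) \<noteq> \<pi> (x', y')"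
    using img xyP neq by blast
  from sZ(4)[unfolded Hausdorff_space_def, rule_format, OF this]
  obtain L R where LR: "openin Z L" "openin Z R" "\<pi> (x, y) \<in> L" "\<pi> (x', y') \<in> R" "disjnt L R" by blast
  obtain M where M: "openin Z M" "\<pi> (x, y) \<in> M" "Z closure_of M \<subseteq> L"
    by (rule regular_space_closed_nbhd[OF sZ(5) LR(1,3)])
  obtain N where N: "openin Z N" "\<pi> (x', y') \<in> N" "Z closure_of N \<subseteq> R"
    by (rule regular_space_closed_nbhd[OF sZ(5) LR(2,4)])
  have oM: "openin ?P {z \<in> topspace ?P. \<pi> z \<in> M}" and oN: "openin ?P {z \<in> topspace ?P. \<pi> z \<in> N}"
    using openin_continuous_map_preimage[OF \<pi>] M(1) N(1) by blast+
  have inM: "(x, y) \<in> {z \<in> topspace ?P. \<pi> z \<in> M}" and inN: "(x', y') \<in> {z \<in> topspace ?P. \<pi> z \<in> N}"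
    using xyP M(2) N(2) by blast+
  from openin_prod_topology_alt[THEN iffD1, OF oM, rule_format, OF inM]
  obtain A B where AB: "openin X A" "openin Y B" "x \<in> A" "y \<in> B" "A \<times> B \<subseteq> {z \<in> topspace ?P. \<pi> z \<in> M}"
    by (elim exE conjE)
  from openin_prod_topology_alt[THEN iffD1, OF oN, rule_format, OF inN]
  obtain A' B' where AB': "openin X A'" "openin Y B'" "x' \<in> A'" "y' \<in> B'" "A' \<times> B' \<subseteq> {z \<in> topspace ?P. \<pi> z \<in> N}"
    by (elim exE conjE)
  have "positive_density G (topspace ?P) (diagonal_action X \<phi> Y \<psi>) UNIV
      (\<lambda>b. (if b then A else A') \<times> (if b then B else B'))"
    by (rule positive_density_Times[OF Dx(3)[OF AB(1) AB'(1) AB(3) AB'(3)]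
        Dy(3)[OF AB(2) AB'(2) AB(4) AB'(4)] UNIV_I])
  then have dens: "positive_density G (topspace Z) \<theta> UNIV (\<lambda>b. if b then M else N)"
  proof (rule positive_density_factor[where \<pi> = \<pi>])
    show "\<pi> z \<in> topspace Z" if "z \<in> topspace ?P" for z by (rule img[OF that])
    show "\<pi> (diagonal_action X \<phi> Y \<psi> g z) = \<theta> g (\<pi> z)" if "g \<in> carrier G" "z \<in> topspace ?P" for g z
      by (rule eqv[OF that])
    show "\<pi> z \<in> (if b then M else N)" if "z \<in> (if b then A else A') \<times> (if b then B else B')" for b z
      using that AB(5) AB'(5) by (cases b) auto
  qed
  define U where "U b = (if b then topspace Z - (Z closure_of M) else topspace Z - (Z closure_of N))" for b
  have cov: "\<Union>(U ` UNIV) = topspace Z"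
    using M(3) N(3) LR(5) by (auto simp: U_def UNIV_bool disjnt_iff)
  have "0 < cover_entropy G Z \<theta> (U ` UNIV)"
  proof (rule positive_entropy_if_positive_density[OF am sZ(3) _ _ _ dens])
    show "2 \<le> card (UNIV :: bool set)" by simp
    have "M \<subseteq> Z closure_of M" "N \<subseteq> Z closure_of N"
      using M(1) N(1) by (auto intro!: closure_of_subset openin_subset)
    then show "U b \<inter> (if b then M else N) = {}" for b by (auto simp: U_def)
    show "topspace Z \<subseteq> \<Union>(U ` UNIV)" using cov by simp
  qed
  moreover have "finite_open_cover Z (U ` UNIV)"
    unfolding finite_open_cover_def using cov by (auto simp: U_def intro!: openin_diff)
  ultimately have "0 < topological_entropy G Z \<theta>"
    unfolding topological_entropy_def less_SUP_iff by (intro bexI[of _ "U ` UNIV"]) auto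
  then show False using zero by simp
qed

text \<open>The empty space is a factor of itself, counts as non-trivial and has entropy zero.\<close>

lemma topspace_nonempty_if_cpe:
  assumes am: "amenable G" and sys: "G_system G X \<phi>" and cpe: "has_cpe G X \<phi>"
  shows "topspace X \<noteq> {}"
proof
  assume empty: "topspace X = {}"
  have "is_factor G X \<phi> X \<phi>"
    unfolding is_factor_def using sys by (intro conjI exI[of _ id]) auto
  moreover have "nontrivial_space X" using empty by (simp add: nontrivial_space_def)
  ultimately have "0 < topological_entropy G X \<phi>" using cpe unfolding has_cpe_def by blast
  then obtain \<U> where \<U>: "finite_open_cover X \<U>" "0 < cover_entropy G X \<phi> \<U>"
    unfolding topological_entropy_def less_SUP_iff by auto
  then have "finite \<U>" by (simp add: finite_open_cover_def)
  from cover_entropy_empty_space[OF am G_systemD(3)[OF sys] empty this] \<U>(2) show False by simp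
qed

text \<open>A factor map of entropy zero is constant in each variable. For \<open>y\<close> fixed it identifies independence pairs of \<open>X\<close>,
because \<open>y\<close> forms an independence pair with itself.\<close>

lemma has_cpe_product:
  fixes X :: "'a topology" and Y :: "'b topology"
  assumes am: "amenable G" and count: "countable (carrier G)"
    and X: "G_system G X \<phi>" "has_cpe G X \<phi>" and Y: "G_system G Y \<psi>" "has_cpe G Y \<psi>"
  shows "has_cpe G (prod_topology X Y) (diagonal_action X \<phi> Y \<psi>)"
  unfolding has_cpe_def
proof (intro allI impI, elim conjE, rule ccontr)
  let ?P = "prod_topology X Y"
  fix Z :: "('a \<times> 'b) topology" and \<theta>
  assume fac: "is_factor G ?P (diagonal_action X \<phi> Y \<psi>) Z \<theta>" and nt: "nontrivial_space Z"
    and zero: "\<not> 0 < topological_entropy G Z \<theta>"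
  obtain \<pi> where Z: "G_system G Z \<theta>" and \<pi>: "continuous_map ?P Z \<pi>" and surj: "\<pi> ` topspace ?P = topspace Z"
    and eqv: "\<And>g z. g \<in> carrier G \<Longrightarrow> z \<in> topspace ?P \<Longrightarrow> \<pi> (diagonal_action X \<phi> Y \<psi> g z) = \<theta> g (\<pi> z)"
    using fac unfolding is_factor_def by blast
  note same = zero_entropy_factor_identifies_pairs[OF am X(1) Y(1) Z \<pi> eqv zero]
  have left: "\<pi> (x, y) = \<pi> (x', y)" if "x \<in> topspace X" "x' \<in> topspace X" "y \<in> topspace Y" for x x' y
  proof (rule cpe_constant[OF am count X _ G_systemD(2)[OF Z] _ that(1,2), where u = "\<lambda>x. \<pi> (x, y)"])
    have "continuous_map X ?P (\<lambda>x. (x, y))" using that(3) by (simp add: continuous_map_pairedI)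
    from continuous_map_compose[OF this \<pi>] show "continuous_map X Z (\<lambda>x. \<pi> (x, y))" by (simp add: comp_def)
    show "\<pi> (z, y) = \<pi> (z', y)" if "independence_pair G X \<phi> z z'" for z z'
      by (rule same[OF _ _ that cpe_independence_pair_diagonal[OF am count Y \<open>y \<in> topspace Y\<close>]])
  qed
  have right: "\<pi> (x, y) = \<pi> (x, y')" if "x \<in> topspace X" "y \<in> topspace Y" "y' \<in> topspace Y" for x y y'
  proof (rule cpe_constant[OF am count Y _ G_systemD(2)[OF Z] _ that(2,3), where u = "\<lambda>y. \<pi> (x, y)"])
    have "continuous_map Y ?P (\<lambda>y. (x, y))" using that(1) by (simp add: continuous_map_pairedI)
    from continuous_map_compose[OF this \<pi>] show "continuous_map Y Z (\<lambda>y. \<pi> (x, y))" by (simp add: comp_def)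
    show "\<pi> (x, z) = \<pi> (x, z')" if "independence_pair G Y \<psi> z z'" for z z'
      by (rule same[OF _ _ cpe_independence_pair_diagonal[OF am count X \<open>x \<in> topspace X\<close>] that])
  qed
  obtain a where a: "a \<in> topspace X" using topspace_nonempty_if_cpe[OF am X] by blast
  obtain b where b: "b \<in> topspace Y" using topspace_nonempty_if_cpe[OF am Y] by blast
  have const: "\<pi> z = \<pi> (a, b)" if zP: "z \<in> topspace ?P" for z
  proof -
    obtain x y where z: "z = (x, y)" "x \<in> topspace X" "y \<in> topspace Y" using zP by auto
    then show ?thesis using left[OF z(2) a z(3)] right[OF a z(3) b] by simp
  qed
  have "(a, b) \<in> topspace ?P" using a b by simp
  then have "\<pi> ` topspace ?P = {\<pi> (a, b)}" using const by blast
  then have "topspace Z = {\<pi> (a, b)}" using surj by simp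
  then show False using nt unfolding nontrivial_space_def by blast
qed

theorem corollary7p6:
  fixes G :: "('g, 'm) monoid_scheme"
    and X1 :: "'a topology" and \<phi>1 :: "'g \<Rightarrow> 'a \<Rightarrow> 'a"
    and X2 :: "'b topology" and \<phi>2 :: "'g \<Rightarrow> 'b \<Rightarrow> 'b"
    and n :: nat
  assumes "group G" and "countable (carrier G)" and "infinite (carrier G)" and "amenable G"
    and "G_system G X1 \<phi>1" and "G_system G X2 \<phi>2"
    and "n \<ge> 2"
  shows "(has_upe n G X1 \<phi>1 \<and> has_upe n G X2 \<phi>2
            \<longrightarrow> has_upe n G (prod_topology X1 X2) (diagonal_action X1 \<phi>1 X2 \<phi>2)) \<and>
         (has_topological_K G X1 \<phi>1 \<and> has_topological_K G X2 \<phi>2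
            \<longrightarrow> has_topological_K G (prod_topology X1 X2) (diagonal_action X1 \<phi>1 X2 \<phi>2)) \<and>
         (has_cpe G X1 \<phi>1 \<and> has_cpe G X2 \<phi>2
            \<longrightarrow> has_cpe G (prod_topology X1 X2) (diagonal_action X1 \<phi>1 X2 \<phi>2))"
proof (intro conjI impI; elim conjE)
  assume "has_upe n G X1 \<phi>1" "has_upe n G X2 \<phi>2"
  then show "has_upe n G (prod_topology X1 X2) (diagonal_action X1 \<phi>1 X2 \<phi>2)"
    using has_upe_product[OF assms(4,5) _ assms(6) _ assms(7)] by blast
next
  assume "has_topological_K G X1 \<phi>1" "has_topological_K G X2 \<phi>2"
  then show "has_topological_K G (prod_topology X1 X2) (diagonal_action X1 \<phi>1 X2 \<phi>2)"
    using has_topological_K_product[OF assms(4,5) _ assms(6)] by blast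
next
  assume "has_cpe G X1 \<phi>1" "has_cpe G X2 \<phi>2"
  then show "has_cpe G (prod_topology X1 X2) (diagonal_action X1 \<phi>1 X2 \<phi>2)"
    using has_cpe_product[OF assms(4,2,5) _ assms(6)] by blast
qed

end
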